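(* Let $d\nu$ be a real signed Borel measure on $\mathbb{R}_+=(0,\infty)$, singular with respect to Lebesgue measure, with $|d\nu|((0,c))<\infty$ for all $c>0$, and let $q$ be real-valued with $q\in L^1(0,c)$ for all $c>0$. Assume that the closed topological support $\Sigma$ of $d\nu$ is unbounded and has Lebesgue measure zero, write $\mathbb{R}_+\setminus\Sigma=\bigcup_{k=1}^\infty\Delta_k$ with $\Delta_k$ the component intervals, $d_k=|\Delta_k|$, and assume $$\sup_k d_k<\infty,\qquad \sup_{k\in\mathbb{N}}\frac{1}{d_k}\int_{\Delta_k}q_-(x)\,dx<\infty,\qquad q_-:=(|q|-q)/2.$$ Assume also that the operator $\mathrm{H}_{\nu,q}$ is self-adjoint and lower semibounded in $L^2(\mathbb{R}_+)$. If $q$ does not satisfy Molchanov's condition $$\lim_{x\to\infty}\int_x^{x+\varepsilon}q(t)\,dt=+\infty\quad\text{for every }\varepsilon>0,$$ then the spectrum of $\mathrm{H}_{\nu,q}$ is not discrete.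
   Context: Put $dP=dx+d\nu$. A function $f$ is locally absolutely continuous with respect to $dP$ if it is locally of bounded variation and its Borel measure satisfies $df=f^{[1]}\,dP$ for some $f^{[1]}\in L^1_{\mathrm{loc}}(\mathbb{R}_+;dP)$ (the quasi-derivative; left-continuous representatives of $f$ are used). $\mathrm{H}_{\nu,q}$ is the operator $f\mapsto-(f^{[1]})'+qf$ in $L^2(\mathbb{R}_+)$ on all $f\in L^2(\mathbb{R}_+)$ which are locally absolutely continuous with respect to $dP$, with $f^{[1]}\in AC_{\mathrm{loc}}(\mathbb{R}_+)$, $-(f^{[1]})'+qf\in L^2(\mathbb{R}_+)$ and Neumann condition $f^{[1]}(0)=0$; it corresponds to the closure of the quadratic form $\int_{\mathbb{R}_+}|f^{[1]}|^2dP+\int_{\mathbb{R}_+}q|f|^2dx$ on the functions $f\in L^2(\mathbb{R}_+)$ with bounded support in $[0,\infty)$, locally absolutely continuous with respect to $dP$, with $f^{[1]}\in L^2(\mathbb{R}_+;|dP|)$. Discrete spectrum means that the spectrum consists of isolated eigenvalues of finite multiplicity. *)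

theory Defs
  imports "HOL-Analysis.Analysis"
begin

section \<open>Real signed Radon measures on the half-line\<close>

text \<open>
  A real signed Borel measure on \<open>(0,\<infinity>)\<close> that has finite variation on every \<open>(0,c)\<close> need not
  be defined on unbounded sets. It is given here by its Jordan decomposition \<open>\<nu> = \<nu>\<^sub>p - \<nu>\<^sub>n\<close>,
  i.e. by two mutually singular positive Borel measures on \<open>(0,\<infinity>)\<close>; thus \<open>|\<nu>| = \<nu>\<^sub>p + \<nu>\<^sub>n\<close>.
\<close>

definition mutually_singular :: "'a measure \<Rightarrow> 'a measure \<Rightarrow> bool" where
  "mutually_singular M N \<longleftrightarrow>
     (\<exists>A \<in> sets M \<inter> sets N. emeasure M A = 0 \<and> emeasure N (space N - A) = 0)"

definition signed_radon_measure :: "real measure \<Rightarrow> real measure \<Rightarrow> bool" where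
  "signed_radon_measure \<nu>\<^sub>p \<nu>\<^sub>n \<longleftrightarrow>
     sets \<nu>\<^sub>p = sets (restrict_space borel {0<..}) \<and>
     sets \<nu>\<^sub>n = sets (restrict_space borel {0<..}) \<and>
     mutually_singular \<nu>\<^sub>p \<nu>\<^sub>n \<and>
     (\<forall>c>0. emeasure \<nu>\<^sub>p {0<..<c} + emeasure \<nu>\<^sub>n {0<..<c} < \<infinity>)"

definition singular_wrt_lebesgue :: "real measure \<Rightarrow> real measure \<Rightarrow> bool" where
  "singular_wrt_lebesgue \<nu>\<^sub>p \<nu>\<^sub>n \<longleftrightarrow>
     mutually_singular \<nu>\<^sub>p (restrict_space lborel {0<..}) \<and>
     mutually_singular \<nu>\<^sub>n (restrict_space lborel {0<..})"

definition topological_support :: "real measure \<Rightarrow> real measure \<Rightarrow> real set" where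
  "topological_support \<nu>\<^sub>p \<nu>\<^sub>n =
     {x. 0 < x \<and> (\<forall>U. open U \<and> x \<in> U \<longrightarrow>
        emeasure \<nu>\<^sub>p (U \<inter> {0<..}) + emeasure \<nu>\<^sub>n (U \<inter> {0<..}) > 0)}"


section \<open>Absolute continuity with respect to \<open>dP = dx + d\<nu>\<close>\<close>

definition locally_integrable_dP :: "real measure \<Rightarrow> real measure \<Rightarrow> (real \<Rightarrow> complex) \<Rightarrow> bool" where
  "locally_integrable_dP \<nu>\<^sub>p \<nu>\<^sub>n g \<longleftrightarrow>
     (\<forall>c>0. set_integrable lborel {0<..<c} g \<and>
            set_integrable \<nu>\<^sub>p {0<..<c} g \<and> set_integrable \<nu>\<^sub>n {0<..<c} g)"

definition integral_dP ::
  "real measure \<Rightarrow> real measure \<Rightarrow> real set \<Rightarrow> (real \<Rightarrow> complex) \<Rightarrow> complex" where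
  "integral_dP \<nu>\<^sub>p \<nu>\<^sub>n A g =
     (LINT x:A|lborel. g x) + (LINT x:A|\<nu>\<^sub>p. g x) - (LINT x:A|\<nu>\<^sub>n. g x)"

definition locally_bounded_variation :: "(real \<Rightarrow> complex) \<Rightarrow> bool" where
  "locally_bounded_variation f \<longleftrightarrow>
     (\<forall>c>0. \<exists>B. \<forall>n x. mono_on {..n} x \<and> x ` {..n} \<subseteq> {0<..<c} \<longrightarrow>
        (\<Sum>i<n. cmod (f (x (Suc i)) - f (x i))) \<le> B)"

text \<open>
  \<open>f\<close> is the left-continuous representative, so its Borel measure is determined by
  \<open>df [a,b) = f b - f a\<close>; the last conjunct is the identity \<open>df = g dP\<close>, with \<open>g = f\<^sup>[\<^sup>1\<^sup>]\<close>.
\<close>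

definition has_quasi_derivative ::
  "real measure \<Rightarrow> real measure \<Rightarrow> (real \<Rightarrow> complex) \<Rightarrow> (real \<Rightarrow> complex) \<Rightarrow> bool" where
  "has_quasi_derivative \<nu>\<^sub>p \<nu>\<^sub>n f g \<longleftrightarrow>
     locally_bounded_variation f \<and>
     (\<forall>x>0. continuous (at_left x) f) \<and>
     locally_integrable_dP \<nu>\<^sub>p \<nu>\<^sub>n g \<and>
     (\<forall>a b. 0 < a \<and> a < b \<longrightarrow> f b - f a = integral_dP \<nu>\<^sub>p \<nu>\<^sub>n {a..<b} g)"

text \<open>
  \<open>u\<close> is absolutely continuous on every \<open>[0,c]\<close>, with derivative \<open>w\<close> (unique almost everywhere).
  The endpoint \<open>0\<close> is included, so that the boundary value \<open>u 0\<close> makes sense.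
\<close>

definition has_ac_derivative :: "(real \<Rightarrow> complex) \<Rightarrow> (real \<Rightarrow> complex) \<Rightarrow> bool" where
  "has_ac_derivative u w \<longleftrightarrow>
     (\<forall>c>0. set_integrable lebesgue {0<..<c} w) \<and>
     (\<forall>x\<ge>0. u x = u 0 + (LINT t:{0<..<x}|lebesgue. w t))"


section \<open>Unbounded operators in \<open>L\<^sup>2(0,\<infinity>)\<close>\<close>

text \<open>
  Elements of \<open>L\<^sup>2\<close> are represented by functions, equality being equality almost everywhere on
  \<open>(0,\<infinity>)\<close>. An operator is represented by its graph, i.e. by the set of all pairs of
  representatives of \<open>f\<close> and \<open>H f\<close>.
\<close>

abbreviation half_line :: "real measure" where
  "half_line \<equiv> lebesgue_on {0<..}"

type_synonym l2_operator = "((real \<Rightarrow> complex) \<times> (real \<Rightarrow> complex)) set"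

definition L2 :: "(real \<Rightarrow> complex) set" where
  "L2 = {f. f \<in> borel_measurable half_line \<and> integrable half_line (\<lambda>x. (cmod (f x))\<^sup>2)}"

definition L2_inner :: "(real \<Rightarrow> complex) \<Rightarrow> (real \<Rightarrow> complex) \<Rightarrow> complex" where
  "L2_inner f g = (LINT x|half_line. f x * cnj (g x))"

definition L2_norm :: "(real \<Rightarrow> complex) \<Rightarrow> real" where
  "L2_norm f = sqrt (LINT x|half_line. (cmod (f x))\<^sup>2)"

definition densely_defined :: "l2_operator \<Rightarrow> bool" where
  "densely_defined H \<longleftrightarrow> (\<forall>g\<in>L2. \<forall>e>0. \<exists>(f, k)\<in>H. L2_norm (\<lambda>x. f x - g x) < e)"

definition adjoint_operator :: "l2_operator \<Rightarrow> l2_operator" where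
  "adjoint_operator H =
     {(g, h). g \<in> L2 \<and> h \<in> L2 \<and> (\<forall>(f, k)\<in>H. L2_inner k g = L2_inner f h)}"

definition self_adjoint :: "l2_operator \<Rightarrow> bool" where
  "self_adjoint H \<longleftrightarrow> densely_defined H \<and> adjoint_operator H = H"

definition lower_semibounded :: "l2_operator \<Rightarrow> bool" where
  "lower_semibounded H \<longleftrightarrow>
     (\<exists>\<gamma>::real. \<forall>(f, k)\<in>H. Re (L2_inner k f) \<ge> \<gamma> * (L2_norm f)\<^sup>2)"

text \<open>\<open>z\<close> is in the resolvent set iff \<open>H - z\<close> is onto and has a bounded inverse.\<close>

definition resolvent_set :: "l2_operator \<Rightarrow> complex set" where
  "resolvent_set H =
     {z. (\<forall>h\<in>L2. \<exists>(f, k)\<in>H. AE x in half_line. k x - z * f x = h x) \<and>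
         (\<exists>C. \<forall>(f, k)\<in>H. L2_norm f \<le> C * L2_norm (\<lambda>x. k x - z * f x))}"

definition operator_spectrum :: "l2_operator \<Rightarrow> complex set" where
  "operator_spectrum H = - resolvent_set H"

definition eigenspace :: "l2_operator \<Rightarrow> complex \<Rightarrow> (real \<Rightarrow> complex) set" where
  "eigenspace H z = {f. (f, \<lambda>x. z * f x) \<in> H}"

definition is_eigenvalue :: "l2_operator \<Rightarrow> complex \<Rightarrow> bool" where
  "is_eigenvalue H z \<longleftrightarrow> (\<exists>f\<in>eigenspace H z. \<not> (AE x in half_line. f x = 0))"

definition finite_multiplicity :: "l2_operator \<Rightarrow> complex \<Rightarrow> bool" where
  "finite_multiplicity H z \<longleftrightarrow>
     (\<exists>B. finite B \<and> B \<subseteq> eigenspace H z \<and>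
        (\<forall>f\<in>eigenspace H z. \<exists>c. AE x in half_line. f x = (\<Sum>b\<in>B. c b * b x)))"

definition discrete_spectrum :: "l2_operator \<Rightarrow> bool" where
  "discrete_spectrum H \<longleftrightarrow>
     (\<forall>z\<in>operator_spectrum H.
        z isolated_in operator_spectrum H \<and> is_eigenvalue H z \<and> finite_multiplicity H z)"


section \<open>The operator and Molchanov's condition\<close>

text \<open>
  In \<open>H_op\<close>, \<open>f\<^sub>0\<close> is the left-continuous representative of \<open>f\<close>, \<open>u\<close> is its
  quasi-derivative and \<open>w = u'\<close>; as \<open>u\<close> is continuous, all three are determined by \<open>f\<close>
  (\<open>w\<close> almost everywhere).
\<close>

definition H_op :: "real measure \<Rightarrow> real measure \<Rightarrow> (real \<Rightarrow> real) \<Rightarrow> l2_operator" where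
  "H_op \<nu>\<^sub>p \<nu>\<^sub>n q =
     {(f, h). f \<in> L2 \<and> h \<in> L2 \<and>
        (\<exists>f\<^sub>0 u w.
           (AE x in half_line. f x = f\<^sub>0 x) \<and>
           has_quasi_derivative \<nu>\<^sub>p \<nu>\<^sub>n f\<^sub>0 u \<and>
           has_ac_derivative u w \<and>
           u 0 = 0 \<and>
           (AE x in half_line. h x = - w x + complex_of_real (q x) * f x))}"

definition molchanov :: "(real \<Rightarrow> real) \<Rightarrow> bool" where
  "molchanov q \<longleftrightarrow>
     (\<forall>\<epsilon>>0. filterlim (\<lambda>x. LINT t:{x..x + \<epsilon>}|lebesgue. q t) at_top at_top)"

definition neg_part :: "(real \<Rightarrow> real) \<Rightarrow> real \<Rightarrow> real" where
  "neg_part q x = (\<bar>q x\<bar> - q x) / 2"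

end

(*
  Every Lipschitz function f of compact support lies in the form domain, with quasi-derivative f' off
  the support Sigma of nu and 0 on Sigma, since Sigma is a Lebesgue null set. The bound on the averages
  of q_- makes the integrals of q_- over intervals of length epsilon uniformly bounded. So if Molchanov's
  condition fails for epsilon, there are infinitely many disjoint intervals of length epsilon on which
  the integral of |q| is bounded, and tent functions on them span an infinite-dimensional space on which
  the form is at most K times the squared norm. A lower semibounded self-adjoint operator with this
  property has essential spectrum.

  The form enters only through elements of the operator domain: each tent function is approximated by an
  element of the domain supported in the same interval. The spectral theorem is avoided by working
  with A = (H - mu)^(-1) for mu below the lower bound of H. The infimum over finite sets F of the
  supremum of the quadratic form of A on the unit sphere orthogonal to F is a positive number m which
  has approximate eigenvectors orthogonal to any given finite set, whereas an isolated eigenvalue of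
  finite multiplicity leaves a gap on the orthogonal complement of its eigenspace.
*)

theory Submission
  imports Defs
begin

section \<open>Symmetric bounded operators on a real Hilbert space\<close>

text \<open>The potential is only locally integrable, so for bounded f the product q f need not be
  square integrable: a tent function lies in the form domain but in general not in the operator
  domain. The derivative of the quasi-derivative u has to cancel the unbounded part of q f, and
  since f = \<integral> u dP, this makes u the solution of a fixed point equation. Two conditions at
  the right end of the interval, u = 0 and f = 0, confine the support, and two auxiliary functions
  restore them. The corrected u no longer vanishes on \<Sigma>, but it is uniformly as small there
  as desired, so \<nu> adds at most a constant to the form. On the abstract side, an upper bound for
  the form of H on an infinite-dimensional space becomes a lower bound for the form of A by
  Cauchy-Schwarz: for x = A y, |x|^4 = (A y, x)^2 \<le> (A y, y) (A x, x). In place of functional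
  calculus stands the inequality |G x|^2 \<le> b (G x, x) for positive G, by which near-minimisers
  of a form are approximate null vectors.\<close>

definition symmetric_op :: "('a::real_inner \<Rightarrow> 'a) \<Rightarrow> bool" where
  "symmetric_op A \<longleftrightarrow> bounded_linear A \<and> (\<forall>x y. A x \<bullet> y = x \<bullet> A y)"

text \<open>A lower bound on the norm, not on the form: for \<open>A - s\<close> it says that s is
  not an approximate eigenvalue. The spectral arguments for symmetric operators below run on this
  estimate instead of on resolvents.\<close>

definition bounded_below :: "('a::real_normed_vector \<Rightarrow> 'a) \<Rightarrow> bool" where
  "bounded_below A \<longleftrightarrow> (\<exists>\<kappa>>0. \<forall>x. \<kappa> * norm x \<le> norm (A x))"

lemma bounded_below_comp:
  assumes "bounded_below A" "bounded_below B"
  shows "bounded_below (\<lambda>x. A (B x))"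
proof -
  obtain a b where a: "a > 0" "\<And>x. a * norm x \<le> norm (A x)"
    and b: "b > 0" "\<And>x. b * norm x \<le> norm (B x)"
    using assms unfolding bounded_below_def by auto
  have "a * (b * norm x) \<le> norm (A (B x))" for x
    using a(2)[of "B x"] mult_left_mono[OF b(2)[of x], of a] a(1) by linarith
  then show ?thesis
    unfolding bounded_below_def using a(1) b(1)
    by (intro exI[of _ "a * b"]) (auto simp: mult.assoc)
qed

lemma nonneg_quadratic_discriminant:
  fixes a b c :: real
  assumes "\<And>t. 0 \<le> a + 2 * b * t + c * t\<^sup>2" "0 \<le> a" "0 \<le> c"
  shows "b\<^sup>2 \<le> a * c"
proof (cases "c = 0")
  case True
  have "b = 0"
  proof (rule ccontr)
    assume "b \<noteq> 0"
    \<comment> \<open>At t = -(a + 1) / (2 b) the remaining polynomial a + 2 b t equals -1.\<close>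
    then show False
      using assms(1)[of "- (a + 1) / (2 * b)"] True by (simp add: field_simps)
  qed
  then show ?thesis using assms by simp
next
  case False
  then have "c > 0" using assms(3) by simp
  then show ?thesis
    using assms(1)[of "- b / c"] by (simp add: field_simps power2_eq_square)
qed

text \<open>The quadratic t \<mapsto> (G (x + t y), x + t y) is nonnegative. Positivity is asked on
  a subspace V only, because V will be the orthogonal complement of a finite set, and G may fail to
  be positive elsewhere.\<close>

lemma psd_Cauchy_Schwarz:
  fixes G :: "'a::real_inner \<Rightarrow> 'a"
  assumes "symmetric_op G" "subspace V" "\<And>z. z \<in> V \<Longrightarrow> 0 \<le> G z \<bullet> z" "x \<in> V" "y \<in> V"
  shows "(G x \<bullet> y)\<^sup>2 \<le> (G x \<bullet> x) * (G y \<bullet> y)"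
proof (rule nonneg_quadratic_discriminant)
  fix t :: real
  interpret G: bounded_linear G using assms(1) unfolding symmetric_op_def by auto
  have "G x \<bullet> y = G y \<bullet> x"
    using assms(1) unfolding symmetric_op_def by (metis inner_commute)
  moreover have "0 \<le> G (x + t *\<^sub>R y) \<bullet> (x + t *\<^sub>R y)"
    using assms(2,4,5) by (intro assms(3)) (simp add: subspace_add subspace_scale)
  ultimately show "0 \<le> G x \<bullet> x + 2 * (G x \<bullet> y) * t + G y \<bullet> y * t\<^sup>2"
    by (simp add: G.add G.scaleR inner_add_left inner_add_right power2_eq_square algebra_simps)
qed (use assms in auto)

text \<open>Cauchy-Schwarz with \<open>G x\<close> as second vector: |G x|^4 \<le> (G x, x) (G G x,
  G x) \<le> (G x, x) b |G x|^2. A small value of the form thus forces \<open>G x\<close> to be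
  small. The form is evaluated at \<open>G x\<close> too, hence the condition
  \<open>G x \<in> V\<close>.\<close>

lemma psd_norm_bound:
  fixes G :: "'a::real_inner \<Rightarrow> 'a"
  assumes "symmetric_op G" "subspace V" "\<And>z. z \<in> V \<Longrightarrow> 0 \<le> G z \<bullet> z" "x \<in> V" "G x \<in> V"
    and b: "\<And>z. norm (G z) \<le> b * norm z"
  shows "(norm (G x))\<^sup>2 \<le> b * (G x \<bullet> x)"
proof (cases "G x = 0")
  case False
  define n where "n = (norm (G x))\<^sup>2"
  have n: "G x \<bullet> G x = n" by (simp add: dot_square_norm n_def)
  have "n\<^sup>2 \<le> (G x \<bullet> x) * (G (G x) \<bullet> G x)"
    using psd_Cauchy_Schwarz[OF assms(1,2,3,4,5)] n by simp
  also have "\<dots> \<le> (G x \<bullet> x) * (b * n)"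
  proof (intro mult_left_mono)
    have "G (G x) \<bullet> G x \<le> norm (G (G x)) * norm (G x)" by (rule norm_cauchy_schwarz)
    also have "\<dots> \<le> (b * norm (G x)) * norm (G x)" by (intro mult_right_mono b) auto
    finally show "G (G x) \<bullet> G x \<le> b * n" by (simp add: n_def power2_eq_square mult.assoc)
  qed (use assms in auto)
  finally have "n * n \<le> (b * (G x \<bullet> x)) * n" by (simp add: power2_eq_square mult_ac)
  moreover have "n > 0" using False by (simp add: n_def)
  ultimately show ?thesis unfolding n_def by (rule mult_right_le_imp_le)
qed simp

lemma symmetric_op_shift:
  assumes "symmetric_op A"
  shows "symmetric_op (\<lambda>x. A x - c *\<^sub>R x)"
  using assms unfolding symmetric_op_def
  by (auto intro!: bounded_linear_sub bounded_linear_scaleR_right bounded_linear_ident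
      simp: inner_diff_left inner_diff_right)

lemma symmetric_op_square:
  assumes "symmetric_op A"
  shows "symmetric_op (\<lambda>x. A (A x))"
  using assms unfolding symmetric_op_def by (auto intro: bounded_linear_compose)

lemma symmetric_op_uminus:
  assumes "symmetric_op A"
  shows "symmetric_op (\<lambda>x. - A x)"
  using assms unfolding symmetric_op_def by (auto intro: bounded_linear_minus)

lemma symmetric_op_bound:
  assumes "symmetric_op A"
  obtains b where "b > 0" "\<And>x. norm (A x) \<le> b * norm x"
  using assms bounded_linear.pos_bounded unfolding symmetric_op_def by (metis mult.commute)

text \<open>If the infimum m of |G x|^2 over the unit sphere were below c^2, then Q = G^2 - m = (G -
  sqrt m) (G + sqrt m) would be bounded below. As Q is also positive, its form would then be bounded
  away from 0 on the sphere, contrary to the choice of m.\<close>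

lemma spectral_gap_bounded_below:
  fixes G :: "'a::real_inner \<Rightarrow> 'a"
  assumes G: "symmetric_op G" and "c > 0"
    and bb: "\<And>t. \<bar>t\<bar> < c \<Longrightarrow> bounded_below (\<lambda>x. G x - t *\<^sub>R x)"
  shows "c * norm x \<le> norm (G x)"
proof (cases "x = 0")
  case False
  interpret G: bounded_linear G using G unfolding symmetric_op_def by auto
  let ?N = "(\<lambda>x. (norm (G x))\<^sup>2) ` {x. norm x = 1}"
  define m where "m = Inf ?N"
  have unit: "norm (x /\<^sub>R norm x) = 1" using False by simp
  then have ne: "?N \<noteq> {}" by blast
  have bdd: "bdd_below ?N" by (rule bdd_belowI[of _ 0]) auto
  have m_le: "m \<le> (norm (G y))\<^sup>2" if "norm y = 1" for y
    unfolding m_def using that by (intro cInf_lower bdd) auto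
  have m0: "m \<ge> 0" unfolding m_def by (rule cInf_greatest[OF ne]) auto
  have "c\<^sup>2 \<le> m"
  proof (rule ccontr)
    assume "\<not> c\<^sup>2 \<le> m"
    then have t: "sqrt m < c" using \<open>c > 0\<close> by (simp add: real_less_lsqrt m0)
    define Q where "Q = (\<lambda>x. G (G x) - m *\<^sub>R x)"
    have symQ: "symmetric_op Q"
      unfolding Q_def by (intro symmetric_op_shift symmetric_op_square G)
    have Qf: "Q y = G (G y - (- sqrt m) *\<^sub>R y) - sqrt m *\<^sub>R (G y - (- sqrt m) *\<^sub>R y)" for y
      unfolding Q_def using m0 by (simp add: G.add G.scaleR scaleR_add_right)
    have "bounded_below Q"
      unfolding Qf[abs_def]
      by (rule bounded_below_comp[OF bb[of "sqrt m"] bb[of "- sqrt m"]]) (use t m0 in auto)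
    then obtain k where k: "k > 0" "\<And>y. k * norm y \<le> norm (Q y)"
      unfolding bounded_below_def by auto
    obtain b where b: "b > 0" "\<And>y. norm (Q y) \<le> b * norm y"
      using symmetric_op_bound[OF symQ] by blast
    have Qyy: "Q y \<bullet> y = (norm (G y))\<^sup>2 - m * (norm y)\<^sup>2" for y
      using G unfolding Q_def symmetric_op_def
      by (simp add: inner_diff_left dot_square_norm)
    have psd: "0 \<le> Q y \<bullet> y" for y
    proof (cases "y = 0")
      case False
      then have "m \<le> (norm (G (y /\<^sub>R norm y)))\<^sup>2" by (intro m_le) simp
      then show ?thesis using False
        by (simp add: Qyy G.scaleR power_mult_distrib power_inverse divide_simps)
    qed (simp add: Q_def)
    \<comment> \<open>From k^2 \<le> |Q y|^2 \<le> b (Q y, y) the form of Q exceeds 0 by at least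
      k^2 / b on the unit sphere.\<close>
    have "m + k\<^sup>2 / b \<le> (norm (G y))\<^sup>2" if "norm y = 1" for y
    proof -
      have "k\<^sup>2 \<le> (norm (Q y))\<^sup>2" using k(2)[of y] that k(1) by (intro power_mono) auto
      also have "\<dots> \<le> b * (Q y \<bullet> y)"
        by (rule psd_norm_bound[OF symQ subspace_UNIV psd _ _ b(2)]) auto
      also have "\<dots> = b * ((norm (G y))\<^sup>2 - m)" using that by (simp add: Qyy)
      finally show ?thesis using b(1) by (simp add: field_simps)
    qed
    then have "m + k\<^sup>2 / b \<le> m"
      unfolding m_def by (intro cInf_greatest[OF ne]) auto
    then show False using k(1) b(1) by (simp add: field_simps)
  qed
  then have "c\<^sup>2 \<le> (norm (G (x /\<^sub>R norm x)))\<^sup>2" using m_le[OF unit] by linarith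
  then have "c \<le> norm (G (x /\<^sub>R norm x))" using \<open>c > 0\<close> by (simp add: power_mono_iff)
  then show ?thesis using False by (simp add: G.scaleR field_simps)
qed (use assms in simp)

text \<open>For S = T^2 the hypothesis excludes approximate eigenvalues in (0, r^2). This gives S^2
  \<ge> r^2 S as forms, hence S \<ge> r^2 on the range of S, and a vector orthogonal to the kernel
  is a limit of vectors in that range.\<close>

lemma isolated_point_gap:
  fixes T :: "'a::{real_inner,banach} \<Rightarrow> 'a"
  assumes T: "symmetric_op T" and "r > 0"
    and bb: "\<And>s. 0 < \<bar>s\<bar> \<Longrightarrow> \<bar>s\<bar> < r \<Longrightarrow> bounded_below (\<lambda>x. T x - s *\<^sub>R x)"
    and perp: "\<And>y. T y = 0 \<Longrightarrow> x \<bullet> y = 0"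
  shows "r\<^sup>2 * (norm x)\<^sup>2 \<le> (norm (T x))\<^sup>2"
proof -
  interpret T: bounded_linear T using T unfolding symmetric_op_def by auto
  define S where "S = (\<lambda>x. T (T x))"
  have S: "symmetric_op S" unfolding S_def by (rule symmetric_op_square[OF T])
  then interpret S: bounded_linear S unfolding symmetric_op_def by auto
  have sym: "S x \<bullet> y = x \<bullet> S y" for x y using S unfolding symmetric_op_def by auto
  have Sxx: "S x \<bullet> x = (norm (T x))\<^sup>2" for x
    using T unfolding S_def symmetric_op_def by (simp add: dot_square_norm)
  \<comment> \<open>The midpoint of the gap (0, r^2): expanding |S y - c y|^2 \<ge> c^2 |y|^2, the
    terms c^2 |y|^2 cancel and |S y|^2 \<ge> 2 c (S y, y) = r^2 (S y, y) remains.\<close>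
  define c where "c = r\<^sup>2 / 2"
  have c: "c > 0" using \<open>r > 0\<close> by (simp add: c_def)
  have bbS: "bounded_below (\<lambda>x. S x - s *\<^sub>R x)" if "0 < s" "s < r\<^sup>2" for s
  proof -
    have s: "0 < sqrt s" "sqrt s < r" using that \<open>r > 0\<close> by (auto simp: real_less_lsqrt)
    have "S x - s *\<^sub>R x = T (T x - (- sqrt s) *\<^sub>R x) - sqrt s *\<^sub>R (T x - (- sqrt s) *\<^sub>R x)" for x
      using that by (simp add: S_def T.add T.scaleR scaleR_add_right)
    then show ?thesis
      using bounded_below_comp[OF bb[of "sqrt s"] bb[of "- sqrt s"]] s by simp
  qed
  have gap: "c * norm y \<le> norm (S y - c *\<^sub>R y)" for y
  proof (rule spectral_gap_bounded_below[OF symmetric_op_shift[OF S] c])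
    fix t :: real assume "\<bar>t\<bar> < c"
    then have "bounded_below (\<lambda>x. S x - (c + t) *\<^sub>R x)" by (intro bbS) (auto simp: c_def)
    then show "bounded_below (\<lambda>x. S x - c *\<^sub>R x - t *\<^sub>R x)" by (simp add: algebra_simps)
  qed
  have SS: "r\<^sup>2 * (S y \<bullet> y) \<le> (norm (S y))\<^sup>2" for y
  proof -
    have "(c * norm y)\<^sup>2 \<le> (norm (S y - c *\<^sub>R y))\<^sup>2" using gap c by (intro power_mono) auto
    also have "(norm (S y - c *\<^sub>R y))\<^sup>2 = (norm (S y))\<^sup>2 - 2 * c * (S y \<bullet> y) + (c * norm y)\<^sup>2"
      unfolding power_mult_distrib power2_norm_eq_inner
      by (simp add: inner_diff_left inner_diff_right inner_commute power2_eq_square algebra_simps)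
    finally show ?thesis by (simp add: c_def)
  qed
  \<comment> \<open>Cauchy-Schwarz for the form of S with the vectors z and \<open>S z\<close>,
    combined with \<open>SS\<close>, in which \<open>S z\<close> enters only through its
    norm.\<close>
  have range_ge: "r\<^sup>2 * (norm (S z))\<^sup>2 \<le> S (S z) \<bullet> S z" for z
  proof (cases "S z = 0")
    case False
    let ?n = "(norm (S z))\<^sup>2"
    have psd: "0 \<le> S w \<bullet> w" for w by (simp add: Sxx)
    have "?n\<^sup>2 \<le> (S z \<bullet> z) * (S (S z) \<bullet> S z)"
      using psd_Cauchy_Schwarz[OF S subspace_UNIV psd, of z "S z"] by (simp add: dot_square_norm)
    then have "r\<^sup>2 * ?n\<^sup>2 \<le> (r\<^sup>2 * (S z \<bullet> z)) * (S (S z) \<bullet> S z)"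
      using \<open>r > 0\<close> by (simp add: mult.assoc)
    also have "\<dots> \<le> ?n * (S (S z) \<bullet> S z)" by (intro mult_right_mono SS psd)
    finally have "?n * (r\<^sup>2 * ?n) \<le> ?n * (S (S z) \<bullet> S z)" by (simp add: power2_eq_square mult_ac)
    then show ?thesis using False by (simp add: mult_le_cancel_left)
  qed (simp add: S.zero)
  obtain b where b: "b > 0" "\<And>y. norm (S y) \<le> b * norm y"
    using symmetric_op_bound[OF S] by blast
  \<comment> \<open>With this step length \<alpha> |S y|^2 \<le> (S y, y), so on the range of S one
    step y \<mapsto> y - \<alpha> S y multiplies |y|^2 by at most 1 - \<alpha> r^2.\<close>
  define \<alpha> where "\<alpha> = 1 / b"
  have \<alpha>: "\<alpha> > 0" "\<alpha> * (norm (S y))\<^sup>2 \<le> S y \<bullet> y" for y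
    using psd_norm_bound[OF S subspace_UNIV _ _ _ b(2), of y] b(1)
    by (auto simp: \<alpha>_def Sxx field_simps)
  \<comment> \<open>The maximum covers the case of a negative 1 - \<alpha> r^2, which can occur, for
    instance for T = 0.\<close>
  define \<theta> where "\<theta> = sqrt (max 0 (1 - \<alpha> * r\<^sup>2))"
  have \<theta>: "0 \<le> \<theta>" "\<theta> < 1" using \<alpha>(1) \<open>r > 0\<close> by (auto simp: \<theta>_def)
  have contr: "norm (S z - \<alpha> *\<^sub>R S (S z)) \<le> \<theta> * norm (S z)" for z
  proof -
    let ?y = "S z"
    have "(norm (?y - \<alpha> *\<^sub>R S ?y))\<^sup>2 = (norm ?y)\<^sup>2 - 2 * \<alpha> * (S ?y \<bullet> ?y) + \<alpha> * (\<alpha> * (norm (S ?y))\<^sup>2)"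
      by (simp add: power2_norm_eq_inner inner_diff_left inner_diff_right inner_commute)
    also have "\<dots> \<le> (norm ?y)\<^sup>2 - 2 * \<alpha> * (S ?y \<bullet> ?y) + \<alpha> * (S ?y \<bullet> ?y)"
      using mult_left_mono[OF \<alpha>(2)[of ?y], of \<alpha>] \<alpha>(1) by auto
    also have "\<dots> \<le> (1 - \<alpha> * r\<^sup>2) * (norm ?y)\<^sup>2"
      using mult_left_mono[OF range_ge[of z], of \<alpha>] \<alpha>(1) by (simp add: algebra_simps)
    also have "\<dots> \<le> (max 0 (1 - \<alpha> * r\<^sup>2)) * (norm ?y)\<^sup>2" by (intro mult_right_mono) auto
    also have "\<dots> = (\<theta> * norm ?y)\<^sup>2" by (simp add: \<theta>_def power_mult_distrib)
    finally show ?thesis using \<theta>(1) by (simp add: power2_le_iff_abs_le)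
  qed
  \<comment> \<open>The iterates of \<open>1 - \<alpha> S\<close> converge geometrically to the projection of \<open>x\<close> onto the kernel.\<close>
  define v where "v = (\<lambda>k. ((\<lambda>y. y - \<alpha> *\<^sub>R S y) ^^ k) x)"
  have v0: "v 0 = x" and vSuc: "v (Suc k) = v k - \<alpha> *\<^sub>R S (v k)" for k by (auto simp: v_def)
  have dk: "norm (S (v k)) \<le> \<theta> ^ k * norm (S x)" for k
  proof (induction k)
    case (Suc k)
    have "norm (S (v (Suc k))) \<le> \<theta> * norm (S (v k))"
      using contr[of "v k"] by (simp add: vSuc S.diff S.scaleR)
    also have "\<dots> \<le> \<theta> * (\<theta> ^ k * norm (S x))" using Suc \<theta>(1) by (intro mult_left_mono) auto
    finally show ?case by (simp add: mult.assoc)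
  qed (simp add: v0)
  have sm: "summable (\<lambda>k. S (v k))"
  proof (rule summable_comparison_test')
    show "summable (\<lambda>k. \<theta> ^ k * norm (S x))"
      using \<theta> by (intro summable_mult2 summable_geometric) auto
  qed (rule dk)
  have vsum: "v k = x - \<alpha> *\<^sub>R (\<Sum>i<k. S (v i))" for k
  proof (induction k)
    case (Suc k)
    have "v (Suc k) = v k - \<alpha> *\<^sub>R S (v k)" by (rule vSuc)
    also have "\<dots> = (x - \<alpha> *\<^sub>R (\<Sum>i<k. S (v i))) - \<alpha> *\<^sub>R S (v k)"
      using Suc by (rule arg_cong)
    finally show ?case by (simp add: scaleR_add_right)
  qed (simp add: v0)
  define w where "w = x - \<alpha> *\<^sub>R (\<Sum>i. S (v i))"
  have lim: "v \<longlonglongrightarrow> w"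
  proof -
    have "(\<lambda>k. x - \<alpha> *\<^sub>R (\<Sum>i<k. S (v i))) \<longlonglongrightarrow> w"
      unfolding w_def by (intro tendsto_intros summable_LIMSEQ sm)
    moreover have "v = (\<lambda>k. x - \<alpha> *\<^sub>R (\<Sum>i<k. S (v i)))" using vsum by (rule ext)
    ultimately show ?thesis by (rule ssubst[rotated])
  qed
  have "(\<lambda>k. S (v k)) \<longlonglongrightarrow> S w" by (rule S.tendsto[OF lim])
  moreover have "(\<lambda>k. S (v k)) \<longlonglongrightarrow> 0" by (rule summable_LIMSEQ_zero[OF sm])
  ultimately have Sw: "S w = 0" by (rule LIMSEQ_unique)
  then have Tw: "T w = 0" using Sxx[of w] by simp
  \<comment> \<open>The limit w lies in the kernel. Each \<open>v k\<close> differs from x by an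
    element of the range of S, and both x and that range are orthogonal to w. In the limit w is
    orthogonal to itself.\<close>
  have "v k \<bullet> w = 0" for k
    by (subst vsum) (simp add: inner_diff_left inner_sum_left sym Sw perp[OF Tw])
  then have "(\<lambda>k. 0) \<longlonglongrightarrow> w \<bullet> w" using tendsto_inner[OF lim tendsto_const[of w]] by simp
  then have "w = 0" by (simp add: LIMSEQ_const_iff)
  then have lim': "(\<lambda>k. x - v k) \<longlonglongrightarrow> x" using tendsto_diff[OF tendsto_const[of x] lim] by simp
  \<comment> \<open>The vectors \<open>x - v k\<close> lie in the range of S and tend to x, so the
    estimate on the range carries over to x.\<close>
  have xv: "x - v k = S (\<alpha> *\<^sub>R (\<Sum>i<k. v i))" for k
    by (subst vsum) (simp add: S.scaleR S.sum)
  have "r\<^sup>2 * (norm x)\<^sup>2 \<le> S x \<bullet> x"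
  proof (rule LIMSEQ_le)
    show "(\<lambda>k. r\<^sup>2 * (norm (x - v k))\<^sup>2) \<longlonglongrightarrow> r\<^sup>2 * (norm x)\<^sup>2" by (intro tendsto_intros lim')
    show "(\<lambda>k. S (x - v k) \<bullet> (x - v k)) \<longlonglongrightarrow> S x \<bullet> x"
      by (intro tendsto_inner S.tendsto lim')
    show "\<exists>N. \<forall>k\<ge>N. r\<^sup>2 * (norm (x - v k))\<^sup>2 \<le> S (x - v k) \<bullet> (x - v k)"
      unfolding xv using range_ge by auto
  qed
  then show ?thesis by (simp add: Sxx)
qed

section \<open>Approximate eigenvectors from a form bound on an infinite-dimensional space\<close>

text \<open>One orthogonality condition lowers the dimension by at most one: if w in W is not
  orthogonal to f, then W is spanned by w together with the vectors of W orthogonal to f.\<close>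

lemma infinite_dim_meets_perp:
  fixes W :: "'a::real_inner set"
  assumes "finite F" "subspace W" "\<nexists>B. finite B \<and> W \<subseteq> span B"
  shows "\<exists>x\<in>W. norm x = 1 \<and> (\<forall>f\<in>F. x \<bullet> f = 0)"
  using assms
proof (induction F arbitrary: W rule: finite_induct)
  case empty
  have "\<not> W \<subseteq> span {}" using empty.prems by blast
  then obtain x where x: "x \<in> W" "x \<noteq> 0" by auto
  then show ?case
    using empty.prems by (intro bexI[of _ "x /\<^sub>R norm x"]) (auto simp: subspace_scale)
next
  case (insert f F)
  let ?W = "{x \<in> W. x \<bullet> f = 0}"
  have sub: "subspace ?W"
    using insert.prems(1) by (auto simp: subspace_def inner_add_left)
  have "\<nexists>B. finite B \<and> ?W \<subseteq> span B"
  proof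
    assume "\<exists>B. finite B \<and> ?W \<subseteq> span B"
    then obtain B where B: "finite B" "?W \<subseteq> span B" by blast
    show False
    proof (cases "\<exists>w\<in>W. w \<bullet> f \<noteq> 0")
      case True
      then obtain w where w: "w \<in> W" "w \<bullet> f \<noteq> 0" by blast
      have "W \<subseteq> span (insert w B)"
      proof
        fix x assume x: "x \<in> W"
        let ?c = "(x \<bullet> f) / (w \<bullet> f)"
        have "x - ?c *\<^sub>R w \<in> ?W"
          using x w insert.prems(1) by (auto simp: subspace_diff subspace_scale inner_diff_left)
        then have "x - ?c *\<^sub>R w \<in> span B" using B by blast
        then show "x \<in> span (insert w B)" by (auto simp: span_insert)
      qed
      then show False using insert.prems(2) B(1) by blast
    next
      case False
      then have "W \<subseteq> span B" using B by blast
      then show False using insert.prems(2) B(1) by blast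
    qed
  qed
  from insert.IH[OF sub this] show ?case by auto
qed

text \<open>The Weyl point is \<open>m = Inf\<^sub>F sup {(A x, x). \<parallel>x\<parallel> = 1, x \<bottom> F}\<close> over finite sets \<open>F\<close>.\<close>

theorem no_infinite_dim_lower_bound:
  fixes A :: "'a::{real_inner,banach} \<Rightarrow> 'a"
  assumes A: "symmetric_op A"
    and isol: "\<And>m. m > 0 \<Longrightarrow> \<exists>r>0. \<forall>s. 0 < \<bar>s - m\<bar> \<and> \<bar>s - m\<bar> < r \<longrightarrow> bounded_below (\<lambda>x. A x - s *\<^sub>R x)"
    and fin: "\<And>m. m > 0 \<Longrightarrow> \<exists>B. finite B \<and> {x. A x = m *\<^sub>R x} \<subseteq> span B"
    and W: "subspace W" "\<nexists>B. finite B \<and> W \<subseteq> span B"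
    and \<kappa>: "\<kappa> > 0" "\<And>x. x \<in> W \<Longrightarrow> \<kappa> * (norm x)\<^sup>2 \<le> A x \<bullet> x"
  shows False
proof -
  interpret A: bounded_linear A using A unfolding symmetric_op_def by auto
  have sym: "A x \<bullet> y = x \<bullet> A y" for x y using A unfolding symmetric_op_def by auto
  obtain b where b: "b > 0" "\<And>x. norm (A x) \<le> b * norm x"
    using symmetric_op_bound[OF A] by blast
  define U where "U = (\<lambda>F. {x::'a. norm x = 1 \<and> (\<forall>f\<in>F. x \<bullet> f = 0)})"
  define s where "s = (\<lambda>F. Sup ((\<lambda>x. A x \<bullet> x) ` U F))"
  have Axx: "A x \<bullet> x \<le> b" if "norm x = 1" for x
    using norm_cauchy_schwarz[of "A x" x] b(2)[of x] that by simp
  have bdd: "bdd_above ((\<lambda>x. A x \<bullet> x) ` U F)" for F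
    by (rule bdd_aboveI[of _ b]) (auto simp: U_def Axx)
  have le_s: "A x \<bullet> x \<le> s F" if "x \<in> U F" for x F
    unfolding s_def using that by (intro cSup_upper bdd) auto
  have UW: "\<exists>x\<in>W. x \<in> U F" if "finite F" for F
    using infinite_dim_meets_perp[OF that W] by (auto simp: U_def)
  have s_ge: "\<kappa> \<le> s F" if F: "finite F" for F
  proof -
    obtain x where x: "x \<in> W" "x \<in> U F" using UW[OF F] by blast
    then have "\<kappa> \<le> A x \<bullet> x" using \<kappa>(2)[of x] by (simp add: U_def)
    then show ?thesis using le_s[OF x(2)] by linarith
  qed
  define m where "m = Inf (s ` {F. finite F})"
  have bdds: "bdd_below (s ` {F. finite F})" by (rule bdd_belowI[of _ \<kappa>]) (auto simp: s_ge)
  have nes: "s ` {F. finite F} \<noteq> {}" by blast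
  have m_le: "m \<le> s F" if "finite F" for F
    unfolding m_def using that by (intro cInf_lower bdds) auto
  have "\<kappa> \<le> m" unfolding m_def by (intro cInf_greatest nes) (auto simp: s_ge)
  then have m0: "m > 0" using \<kappa>(1) by linarith
  obtain r where r: "r > 0"
    "\<And>s. 0 < \<bar>s - m\<bar> \<Longrightarrow> \<bar>s - m\<bar> < r \<Longrightarrow> bounded_below (\<lambda>x. A x - s *\<^sub>R x)"
    using isol[OF m0] by blast
  obtain B where B: "finite B" "{x. A x = m *\<^sub>R x} \<subseteq> span B" using fin[OF m0] by blast
  define T where "T = (\<lambda>x. A x - m *\<^sub>R x)"
  have T: "symmetric_op T" unfolding T_def by (rule symmetric_op_shift[OF A])
  \<comment> \<open>The eigenspace of m is contained in the span of B, so orthogonality to B is all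
    that \<open>isolated_point_gap\<close> asks of x.\<close>
  have gap: "r\<^sup>2 * (norm x)\<^sup>2 \<le> (norm (T x))\<^sup>2" if x: "\<And>f. f \<in> B \<Longrightarrow> x \<bullet> f = 0" for x
  proof (rule isolated_point_gap[OF T r(1)])
    fix s :: real assume "0 < \<bar>s\<bar>" "\<bar>s\<bar> < r"
    then have "bounded_below (\<lambda>x. A x - (m + s) *\<^sub>R x)" by (intro r(2)) auto
    then show "bounded_below (\<lambda>x. T x - s *\<^sub>R x)" by (simp add: T_def algebra_simps)
  next
    fix y assume "T y = 0"
    then have "y \<in> span B" using B by (auto simp: T_def)
    then show "x \<bullet> y = 0"
      by (induction rule: span_induct_alt) (auto simp: inner_add_right x)
  qed
  \<comment> \<open>A near-maximiser of the form on the complement of a suitable finite set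
    satisfies (A - m) x = O(sqrt \<epsilon>), whereas the gap keeps the norm of (A - m) x above r.
    Letting \<epsilon> tend to 0 gives the contradiction.\<close>
  have small: "r \<le> sqrt (2 * \<epsilon> * (m + 1 + b)) + \<epsilon>" if \<epsilon>: "0 < \<epsilon>" "\<epsilon> < 1" for \<epsilon>
  proof -
    have "Inf (s ` {F. finite F}) < m + \<epsilon>" using \<epsilon> by (simp add: m_def)
    then obtain F0 where F0: "finite F0" "s F0 < m + \<epsilon>"
      using cInf_less_iff[OF nes bdds] by auto
    define F1 where "F1 = F0 \<union> A ` F0 \<union> B"
    have F1: "finite F1" using F0 B by (auto simp: F1_def)
    have "m - \<epsilon> < s F1" using m_le[OF F1] \<epsilon> by linarith
    moreover have "(\<lambda>x. A x \<bullet> x) ` U F1 \<noteq> {}" using UW[OF F1] by blast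
    ultimately obtain x where x: "x \<in> U F1" "m - \<epsilon> < A x \<bullet> x"
      unfolding s_def using less_cSup_iff[OF _ bdd] by auto
    define V where "V = {y. \<forall>f\<in>F0. y \<bullet> f = 0}"
    have V: "subspace V" by (auto simp: V_def subspace_def inner_add_left)
    \<comment> \<open>Positive on V because \<open>s F0 < m + \<epsilon>\<close>, while (G x, x) < 2
      \<epsilon> because x nearly attains the supremum, which is at least m. So
      \<open>psd_norm_bound\<close> makes \<open>G x\<close> small.\<close>
    define G where "G = (\<lambda>y. (m + \<epsilon>) *\<^sub>R y - A y)"
    have G: "symmetric_op G"
      using symmetric_op_uminus[OF symmetric_op_shift[OF A, of "m + \<epsilon>"]] by (simp add: G_def)
    have nx: "norm x = 1" and xV: "x \<in> V" using x(1) by (auto simp: U_def V_def F1_def)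
    have GxV: "G x \<in> V"
      using x(1) by (auto simp: U_def V_def F1_def G_def inner_diff_left sym)
    have psd: "0 \<le> G z \<bullet> z" if z: "z \<in> V" for z
    proof (cases "z = 0")
      case False
      then have "z /\<^sub>R norm z \<in> U F0" using z by (auto simp: U_def V_def)
      from le_s[OF this] F0(2) have "A (z /\<^sub>R norm z) \<bullet> (z /\<^sub>R norm z) \<le> m + \<epsilon>" by linarith
      then show ?thesis using False
        by (simp add: G_def A.scaleR inner_diff_left inner_add_left field_simps dot_square_norm power2_eq_square)
    qed (simp add: G_def A.zero)
    have Gb: "norm (G z) \<le> (m + 1 + b) * norm z" for z
    proof -
      have "norm (G z) \<le> norm ((m + \<epsilon>) *\<^sub>R z) + norm (A z)" unfolding G_def by (rule norm_triangle_ineq4)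
      also have "\<dots> \<le> (m + 1) * norm z + b * norm z"
        using \<epsilon> m0 b(2)[of z] by (auto intro!: add_mono mult_right_mono)
      finally show ?thesis by (simp add: algebra_simps)
    qed
    have "(norm (G x))\<^sup>2 \<le> (m + 1 + b) * (G x \<bullet> x)"
      by (rule psd_norm_bound[OF G V psd xV GxV Gb])
    also have "\<dots> \<le> (m + 1 + b) * (2 * \<epsilon>)"
      using x(2) nx m0 b(1)
      by (intro mult_left_mono) (auto simp: G_def inner_diff_left dot_square_norm)
    finally have "norm (G x) \<le> sqrt (2 * \<epsilon> * (m + 1 + b))"
      by (intro real_le_rsqrt) (simp add: mult_ac)
    moreover have "norm (T x) \<le> norm (G x) + \<epsilon>"
    proof -
      have "T x = \<epsilon> *\<^sub>R x - G x" by (simp add: T_def G_def algebra_simps)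
      then show ?thesis using norm_triangle_ineq4[of "\<epsilon> *\<^sub>R x" "G x"] nx \<epsilon> by simp
    qed
    moreover have "r \<le> norm (T x)"
    proof -
      have "r\<^sup>2 * (norm x)\<^sup>2 \<le> (norm (T x))\<^sup>2"
        using x(1) by (intro gap) (auto simp: U_def F1_def)
      then show ?thesis using nx r(1) by (simp add: power2_le_iff_abs_le)
    qed
    ultimately show ?thesis by linarith
  qed
  have "((\<lambda>\<epsilon>. sqrt (2 * \<epsilon> * (m + 1 + b)) + \<epsilon>) \<longlongrightarrow> sqrt (2 * 0 * (m + 1 + b)) + 0) (at_right 0)"
    by (intro tendsto_intros)
  moreover have "eventually (\<lambda>\<epsilon>. r \<le> sqrt (2 * \<epsilon> * (m + 1 + b)) + \<epsilon>) (at_right 0)"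
    using small by (auto simp: eventually_at_right_field intro!: exI[of _ 1])
  ultimately have "r \<le> sqrt (2 * 0 * (m + 1 + b)) + 0"
    by (intro tendsto_lowerbound) auto
  then show False using r(1) by simp
qed


section \<open>The Hilbert space \<open>L\<^sup>2(0,\<infinity>)\<close>\<close>

lemma L2_zero [simp]: "(\<lambda>_. 0) \<in> L2"
  by (simp add: L2_def)

lemma borel_measurable_cnj [measurable]: "cnj \<in> borel_measurable borel"
  by (intro borel_measurable_continuous_onI continuous_intros)

lemma L2_add:
  assumes "f \<in> L2" "g \<in> L2"
  shows "(\<lambda>x. f x + g x) \<in> L2"
proof -
  have [measurable]: "f \<in> borel_measurable half_line" "g \<in> borel_measurable half_line"
    using assms by (auto simp: L2_def)
  have "integrable half_line (\<lambda>x. (cmod (f x + g x))\<^sup>2)"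
  proof (rule Bochner_Integration.integrable_bound)
    show "integrable half_line (\<lambda>x. 2 * (cmod (f x))\<^sup>2 + 2 * (cmod (g x))\<^sup>2)"
      using assms by (auto simp: L2_def)
    have "(cmod (a + b))\<^sup>2 \<le> 2 * (cmod a)\<^sup>2 + 2 * (cmod b)\<^sup>2" for a b
    proof -
      have "(cmod (a + b))\<^sup>2 \<le> (cmod a + cmod b)\<^sup>2" by (intro power_mono norm_triangle_ineq) auto
      also have "\<dots> \<le> 2 * (cmod a)\<^sup>2 + 2 * (cmod b)\<^sup>2"
        using sum_squares_bound[of "cmod a" "cmod b"] by (simp add: power2_sum)
      finally show ?thesis .
    qed
    then show "AE x in half_line. norm ((cmod (f x + g x))\<^sup>2)
        \<le> norm (2 * (cmod (f x))\<^sup>2 + 2 * (cmod (g x))\<^sup>2)"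
      by (intro AE_I2) (auto intro!: order_trans[OF _ abs_ge_self])
  qed measurable
  then show ?thesis by (simp add: L2_def)
qed

lemma L2_cmult:
  assumes "f \<in> L2"
  shows "(\<lambda>x. c * f x) \<in> L2"
  using assms by (auto simp: L2_def norm_mult power_mult_distrib)

lemma L2_uminus: "f \<in> L2 \<Longrightarrow> (\<lambda>x. - f x) \<in> L2"
  using L2_cmult[of f "- 1"] by simp

lemma L2_diff: "f \<in> L2 \<Longrightarrow> g \<in> L2 \<Longrightarrow> (\<lambda>x. f x - g x) \<in> L2"
  using L2_add[OF _ L2_uminus, of f g] by simp

lemma L2_sum:
  assumes "\<And>i. i \<in> I \<Longrightarrow> f i \<in> L2"
  shows "(\<lambda>x. \<Sum>i\<in>I. f i x) \<in> L2"
  using assms by (induction I rule: infinite_finite_induct) (auto intro: L2_add)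

lemma L2_inner_integrable:
  assumes "f \<in> L2" "g \<in> L2"
  shows "integrable half_line (\<lambda>x. f x * cnj (g x))"
proof (rule Bochner_Integration.integrable_bound)
  have [measurable]: "f \<in> borel_measurable half_line" "g \<in> borel_measurable half_line"
    using assms by (auto simp: L2_def)
  show "integrable half_line (\<lambda>x. (cmod (f x))\<^sup>2 + (cmod (g x))\<^sup>2)"
    using assms by (auto simp: L2_def)
  show "(\<lambda>x. f x * cnj (g x)) \<in> borel_measurable half_line" by measurable
  have "a * b \<le> a\<^sup>2 + b\<^sup>2" if "a \<ge> 0" "b \<ge> 0" for a b :: real
    using sum_squares_bound[of a b] mult_nonneg_nonneg[OF that] by linarith
  then show "AE x in half_line. norm (f x * cnj (g x)) \<le> norm ((cmod (f x))\<^sup>2 + (cmod (g x))\<^sup>2)"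
    by (intro AE_I2) (auto simp: norm_mult)
qed

lemma L2_inner_add_left:
  assumes "f \<in> L2" "g \<in> L2" "h \<in> L2"
  shows "L2_inner (\<lambda>x. f x + g x) h = L2_inner f h + L2_inner g h"
  using L2_inner_integrable[OF assms(1,3)] L2_inner_integrable[OF assms(2,3)]
  by (simp add: L2_inner_def distrib_right)

lemma L2_inner_cmult_left: "L2_inner (\<lambda>x. c * f x) g = c * L2_inner f g"
  by (simp add: L2_inner_def mult.assoc)

lemma L2_inner_commute: "L2_inner f g = cnj (L2_inner g f)"
proof -
  have "cnj (L2_inner g f) = (LINT x|half_line. cnj (g x * cnj (f x)))"
    unfolding L2_inner_def by (rule Bochner_Integration.integral_cnj[symmetric])
  then show ?thesis by (simp add: L2_inner_def mult.commute)
qed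

lemma L2_inner_AE_cong:
  assumes "f \<in> L2" "g \<in> L2" "f' \<in> L2" "g' \<in> L2"
    and "AE x in half_line. f x = f' x" "AE x in half_line. g x = g' x"
  shows "L2_inner f g = L2_inner f' g'"
  unfolding L2_inner_def
proof (rule integral_cong_AE)
  have [measurable]: "f \<in> borel_measurable half_line" "g \<in> borel_measurable half_line"
    "f' \<in> borel_measurable half_line" "g' \<in> borel_measurable half_line"
    using assms by (auto simp: L2_def)
  show "(\<lambda>x. f x * cnj (g x)) \<in> borel_measurable half_line"
    "(\<lambda>x. f' x * cnj (g' x)) \<in> borel_measurable half_line" by measurable
  show "AE x in half_line. f x * cnj (g x) = f' x * cnj (g' x)"
    using assms(5,6) by eventually_elim simp
qed

lemma L2_inner_self: "L2_inner f f = complex_of_real ((L2_norm f)\<^sup>2)"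
proof -
  have "0 \<le> (LINT x|half_line. (cmod (f x))\<^sup>2)" by simp
  then show ?thesis
    unfolding L2_inner_def L2_norm_def
    by (simp add: complex_norm_square[symmetric] del: of_real_power flip: integral_complex_of_real)
qed

\<comment> \<open>Square integrable functions modulo equality almost everywhere. The relation is
  partial, since functions outside \<open>L2\<close> have no class. The type becomes a real Hilbert
  space with the real part of \<open>L2_inner\<close> as scalar product: the norm is the usual one,
  and only real spectral parameters are needed.\<close>
quotient_type l2 = "real \<Rightarrow> complex" /
  partial: "\<lambda>f g. f \<in> L2 \<and> g \<in> L2 \<and> (AE x in half_line. f x = g x)"
  morphisms rep_l2 mk_l2
proof (rule part_equivpI)
  show "\<exists>f. f \<in> L2 \<and> f \<in> L2 \<and> (AE x in half_line. f x = f x)"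
    by (rule exI[of _ "\<lambda>_. 0"]) simp
  show "symp (\<lambda>f g. f \<in> L2 \<and> g \<in> L2 \<and> (AE x in half_line. f x = g x))"
    by (intro sympI) auto
  show "transp (\<lambda>f g. f \<in> L2 \<and> g \<in> L2 \<and> (AE x in half_line. f x = g x))"
    by (intro transpI) auto
qed

instantiation l2 :: real_inner
begin

lift_definition zero_l2 :: l2 is "\<lambda>_. 0" by simp

lift_definition plus_l2 :: "l2 \<Rightarrow> l2 \<Rightarrow> l2" is "\<lambda>f g x. f x + g x"
  by (auto intro: L2_add)

lift_definition uminus_l2 :: "l2 \<Rightarrow> l2" is "\<lambda>f x. - f x"
  by (auto intro: L2_uminus)

lift_definition minus_l2 :: "l2 \<Rightarrow> l2 \<Rightarrow> l2" is "\<lambda>f g x. f x - g x"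
  by (auto intro: L2_diff)

lift_definition scaleR_l2 :: "real \<Rightarrow> l2 \<Rightarrow> l2" is "\<lambda>r f x. complex_of_real r * f x"
  by (auto intro: L2_cmult)

lift_definition inner_l2 :: "l2 \<Rightarrow> l2 \<Rightarrow> real" is "\<lambda>f g. Re (L2_inner f g)"
  using L2_inner_AE_cong by metis

definition norm_l2 :: "l2 \<Rightarrow> real" where "norm_l2 x = sqrt (x \<bullet> x)"

definition dist_l2 :: "l2 \<Rightarrow> l2 \<Rightarrow> real" where "dist_l2 x y = norm (x - y)"

definition sgn_l2 :: "l2 \<Rightarrow> l2" where "sgn_l2 x = scaleR (inverse (norm x)) x"

definition uniformity_l2 :: "(l2 \<times> l2) filter" where
  "uniformity_l2 = (INF e\<in>{0<..}. principal {(x, y). dist x y < e})"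

definition open_l2 :: "l2 set \<Rightarrow> bool" where
  "open_l2 U \<longleftrightarrow> (\<forall>x\<in>U. \<forall>\<^sub>F (x', y) in uniformity. x' = x \<longrightarrow> y \<in> U)"

instance
proof
  fix a b c :: l2 and r s :: real
  show "dist a b = norm (a - b)" by (rule dist_l2_def)
  show "sgn a = inverse (norm a) *\<^sub>R a" by (rule sgn_l2_def)
  show "uniformity = (INF e\<in>{0<..}. principal {(x::l2, y). dist x y < e})" by (rule uniformity_l2_def)
  show "open U \<longleftrightarrow> (\<forall>x\<in>U. \<forall>\<^sub>F (x', y) in uniformity. x' = x \<longrightarrow> y \<in> U)" for U :: "l2 set"
    by (rule open_l2_def)
  show "norm a = sqrt (a \<bullet> a)" by (rule norm_l2_def)
  show "a + b + c = a + (b + c)" by transfer (auto intro: L2_add simp: add.assoc)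
  show "a + b = b + a" by transfer (auto intro: L2_add simp: add.commute)
  show "0 + a = a" by transfer auto
  show "- a + a = 0" by transfer auto
  show "a - b = a + - b" by transfer (auto intro: L2_diff L2_add L2_uminus)
  show "r *\<^sub>R (a + b) = r *\<^sub>R a + r *\<^sub>R b"
    by transfer (auto intro!: L2_cmult L2_add simp: distrib_left)
  show "(r + s) *\<^sub>R a = r *\<^sub>R a + s *\<^sub>R a"
    by transfer (auto intro!: L2_cmult L2_add simp: distrib_right simp del: of_real_add simp: of_real_add)
  show "r *\<^sub>R s *\<^sub>R a = (r * s) *\<^sub>R a"
    by transfer (auto intro!: L2_cmult simp: mult.assoc)
  show "1 *\<^sub>R a = a" by transfer auto
  show "a \<bullet> b = b \<bullet> a" by transfer (subst L2_inner_commute, simp)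
  show "(a + b) \<bullet> c = a \<bullet> c + b \<bullet> c" by transfer (simp add: L2_inner_add_left)
  show "(r *\<^sub>R a) \<bullet> b = r * (a \<bullet> b)" by transfer (simp add: L2_inner_cmult_left)
  show "0 \<le> a \<bullet> a" by transfer (simp add: L2_inner_self)
  show "a \<bullet> a = 0 \<longleftrightarrow> a = 0"
  proof transfer
    fix f assume f: "f \<in> L2 \<and> f \<in> L2 \<and> (AE x in half_line. f x = f x)"
    have "Re (L2_inner f f) = (LINT x|half_line. (cmod (f x))\<^sup>2)"
      by (simp add: L2_inner_self L2_norm_def)
    also have "\<dots> = 0 \<longleftrightarrow> (AE x in half_line. (cmod (f x))\<^sup>2 = 0)"
      using f by (intro integral_nonneg_eq_0_iff_AE) (auto simp: L2_def)
    finally show "(Re (L2_inner f f) = 0) = (f \<in> L2 \<and> (\<lambda>_. 0) \<in> L2 \<and> (AE x in half_line. f x = 0))"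
      using f by simp
  qed
qed

end

lemma mk_l2_add: "f \<in> L2 \<Longrightarrow> g \<in> L2 \<Longrightarrow> mk_l2 (\<lambda>x. f x + g x) = mk_l2 f + mk_l2 g"
  by (simp add: plus_l2.abs_eq)

lemma mk_l2_diff: "f \<in> L2 \<Longrightarrow> g \<in> L2 \<Longrightarrow> mk_l2 (\<lambda>x. f x - g x) = mk_l2 f - mk_l2 g"
  by (simp add: minus_l2.abs_eq)

lemma mk_l2_scaleR: "f \<in> L2 \<Longrightarrow> mk_l2 (\<lambda>x. complex_of_real r * f x) = r *\<^sub>R mk_l2 f"
  by (simp add: scaleR_l2.abs_eq)

lemma mk_l2_zero: "mk_l2 (\<lambda>_. 0) = 0"
  by (simp add: zero_l2_def)

lemma mk_l2_sum:
  assumes "\<And>i. i \<in> I \<Longrightarrow> f i \<in> L2"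
  shows "mk_l2 (\<lambda>x. \<Sum>i\<in>I. f i x) = (\<Sum>i\<in>I. mk_l2 (f i))"
  using assms
  by (induction I rule: infinite_finite_induct) (auto simp: mk_l2_zero mk_l2_add L2_sum)

lemma mk_l2_inner: "f \<in> L2 \<Longrightarrow> g \<in> L2 \<Longrightarrow> mk_l2 f \<bullet> mk_l2 g = Re (L2_inner f g)"
  by (simp add: inner_l2.abs_eq)

lemma mk_l2_norm: "f \<in> L2 \<Longrightarrow> norm (mk_l2 f) = L2_norm f"
  by (simp add: norm_eq_sqrt_inner mk_l2_inner L2_inner_self L2_norm_def)

lemma mk_l2_eq_iff: "f \<in> L2 \<Longrightarrow> g \<in> L2 \<Longrightarrow> mk_l2 f = mk_l2 g \<longleftrightarrow> (AE x in half_line. f x = g x)"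
  using Quotient_rel[OF Quotient_l2, of f g] by auto

lemma rep_l2_L2: "rep_l2 x \<in> L2"
  using Quotient_rep_reflp[OF Quotient_l2, of x] by simp

lemma mk_rep_l2: "mk_l2 (rep_l2 x) = x"
  by (rule Quotient_abs_rep[OF Quotient_l2])

lemma L2_norm_nonneg: "0 \<le> L2_norm f"
  by (simp add: L2_norm_def)

lemma nn_integral_L2_norm:
  assumes "f \<in> L2"
  shows "(\<integral>\<^sup>+x. ennreal ((cmod (f x))\<^sup>2) \<partial>half_line) = ennreal ((L2_norm f)\<^sup>2)"
  using assms by (subst nn_integral_eq_integral) (auto simp: L2_def L2_norm_def)

text \<open>Riesz-Fischer for a sequence that is Cauchy at rate 2^-n: the increments are summable
  almost everywhere, and Fatou's lemma transfers the Cauchy bounds to the pointwise limit.\<close>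

lemma L2_limit:
  fixes f :: "nat \<Rightarrow> real \<Rightarrow> complex"
  assumes L2: "\<And>n. f n \<in> L2"
    and cauchy: "\<And>n m k. n \<le> m \<Longrightarrow> n \<le> k \<Longrightarrow> L2_norm (\<lambda>x. f m x - f k x) \<le> (1/2) ^ n"
  obtains g where "g \<in> L2" "\<And>n. L2_norm (\<lambda>x. g x - f n x) \<le> (1/2) ^ n"
proof -
  have [measurable]: "f n \<in> borel_measurable half_line" for n using L2 by (simp add: L2_def)
  \<comment> \<open>The weight 2^n lies between what integrability and pointwise decay need: the
    integrals of \<open>d n\<close> are still at most 2^-n, and finiteness of the sum forces
    increments of order 2^(-n/2).\<close>
  define d where "d = (\<lambda>n x. ennreal (2 ^ n * (cmod (f (Suc n) x - f n x))\<^sup>2))"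
  have [measurable]: "d n \<in> borel_measurable half_line" for n unfolding d_def by measurable
  have sq: "(\<integral>\<^sup>+x. ennreal ((cmod (f m x - f k x))\<^sup>2) \<partial>half_line) \<le> ennreal ((1/4) ^ n)"
    if "n \<le> m" "n \<le> k" for n m k
  proof -
    have "(L2_norm (\<lambda>x. f m x - f k x))\<^sup>2 \<le> ((1/2) ^ n)\<^sup>2"
      using cauchy[OF that] by (intro power_mono) (auto simp: L2_norm_nonneg)
    also have "((1/2::real) ^ n)\<^sup>2 = (1/4) ^ n"
      by (simp add: power2_eq_square flip: power_mult_distrib)
    finally show ?thesis by (simp add: nn_integral_L2_norm L2_diff L2 ennreal_leI)
  qed
  have d_le: "(\<integral>\<^sup>+x. d n x \<partial>half_line) \<le> ennreal ((1/2) ^ n)" for n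
  proof -
    have "(\<integral>\<^sup>+x. d n x \<partial>half_line)
        = ennreal (2 ^ n) * (\<integral>\<^sup>+x. ennreal ((cmod (f (Suc n) x - f n x))\<^sup>2) \<partial>half_line)"
      unfolding d_def by (subst nn_integral_cmult[symmetric]) (auto simp: ennreal_mult)
    also have "\<dots> \<le> ennreal (2 ^ n) * ennreal ((1/4) ^ n)"
      by (intro mult_left_mono sq) auto
    also have "\<dots> = ennreal ((1/2) ^ n)"
      by (simp flip: ennreal_mult power_mult_distrib)
    finally show ?thesis .
  qed
  have "(\<integral>\<^sup>+x. (\<Sum>n. d n x) \<partial>half_line) = (\<Sum>n. \<integral>\<^sup>+x. d n x \<partial>half_line)"
    by (rule nn_integral_suminf) measurable
  also have "\<dots> \<le> (\<Sum>n. ennreal ((1/2) ^ n))" by (intro suminf_le d_le) auto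
  also have "\<dots> = ennreal (\<Sum>n. (1/2) ^ n)"
    by (rule suminf_ennreal2) (auto intro: summable_geometric)
  finally have "(\<integral>\<^sup>+x. (\<Sum>n. d n x) \<partial>half_line) \<noteq> \<infinity>" by (auto simp: top_unique)
  then have fin: "AE x in half_line. (\<Sum>n. d n x) \<noteq> \<infinity>"
    by (intro nn_integral_PInf_AE) auto
  have conv: "AE x in half_line. convergent (\<lambda>n. f n x)"
    using fin
  proof eventually_elim
    fix x assume x: "(\<Sum>n. d n x) \<noteq> \<infinity>"
    then have "summable (\<lambda>n. 2 ^ n * (cmod (f (Suc n) x - f n x))\<^sup>2)"
      unfolding d_def by (intro summable_suminf_not_top) (auto simp: infinity_ennreal_def)
    then have "Bseq (\<lambda>n. 2 ^ n * (cmod (f (Suc n) x - f n x))\<^sup>2)"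
      by (intro convergent_imp_Bseq) (auto dest: summable_LIMSEQ_zero simp: convergent_def)
    then obtain K where K: "K > 0" "\<And>n. 2 ^ n * (cmod (f (Suc n) x - f n x))\<^sup>2 \<le> K"
      by (auto elim!: BseqE)
    have le: "cmod (f (Suc n) x - f n x) \<le> sqrt K * (sqrt (1/2)) ^ n" for n
    proof (rule power2_le_imp_le)
      have "(cmod (f (Suc n) x - f n x))\<^sup>2 \<le> K * (1/2) ^ n"
        using K(2)[of n] by (simp add: field_simps)
      also have "\<dots> = (sqrt K * (sqrt (1/2)) ^ n)\<^sup>2"
      proof -
        have "(sqrt (1/2) ^ n)\<^sup>2 = ((sqrt (1/2))\<^sup>2) ^ n"
          by (simp only: power_mult[symmetric] mult.commute)
        then show ?thesis using K(1) by (simp add: power_mult_distrib)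
      qed
      finally show "(cmod (f (Suc n) x - f n x))\<^sup>2 \<le> (sqrt K * (sqrt (1/2)) ^ n)\<^sup>2" .
    qed (use K in simp)
    have "summable (\<lambda>n. f (Suc n) x - f n x)"
    proof (rule summable_comparison_test')
      show "summable (\<lambda>n. sqrt K * (sqrt (1/2)) ^ n)"
        by (intro summable_mult summable_geometric) simp
    qed (rule le)
    then have "convergent (\<lambda>n. \<Sum>i<n. f (Suc i) x - f i x)" by (simp add: summable_iff_convergent)
    then have "convergent (\<lambda>n. f n x - f 0 x)" by (simp only: sum_lessThan_telescope[of "\<lambda>n. f n x"])
    then show "convergent (\<lambda>n. f n x)" by (simp add: convergent_diff_const_right_iff)
  qed
  \<comment> \<open>The value 0 off the set of convergence, a measurable set, makes g measurable
    everywhere.\<close>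
  define g where "g = (\<lambda>x. if Cauchy (\<lambda>n. f n x) then lim (\<lambda>n. f n x) else 0)"
  have [measurable]: "g \<in> borel_measurable half_line"
    unfolding g_def by measurable
  have lim: "AE x in half_line. (\<lambda>n. f n x) \<longlonglongrightarrow> g x"
    using conv by eventually_elim (auto simp: g_def convergent_LIMSEQ_iff Cauchy_convergent_iff)
  have gle: "(\<integral>\<^sup>+x. ennreal ((cmod (g x - f n x))\<^sup>2) \<partial>half_line) \<le> ennreal ((1/4) ^ n)" for n
  proof -
    have "(\<integral>\<^sup>+x. ennreal ((cmod (g x - f n x))\<^sup>2) \<partial>half_line)
        = (\<integral>\<^sup>+x. liminf (\<lambda>m. ennreal ((cmod (f m x - f n x))\<^sup>2)) \<partial>half_line)"
    proof (rule nn_integral_cong_AE)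
      show "AE x in half_line. ennreal ((cmod (g x - f n x))\<^sup>2)
          = liminf (\<lambda>m. ennreal ((cmod (f m x - f n x))\<^sup>2))"
        using lim
      proof eventually_elim
        fix x assume "(\<lambda>m. f m x) \<longlonglongrightarrow> g x"
        then have "(\<lambda>m. ennreal ((cmod (f m x - f n x))\<^sup>2)) \<longlonglongrightarrow> ennreal ((cmod (g x - f n x))\<^sup>2)"
          by (intro tendsto_intros tendsto_ennrealI)
        then show "ennreal ((cmod (g x - f n x))\<^sup>2) = liminf (\<lambda>m. ennreal ((cmod (f m x - f n x))\<^sup>2))"
          by (rule lim_imp_Liminf[symmetric, rotated]) simp
      qed
    qed
    also have "\<dots> \<le> liminf (\<lambda>m. \<integral>\<^sup>+x. ennreal ((cmod (f m x - f n x))\<^sup>2) \<partial>half_line)"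
      by (rule nn_integral_liminf) measurable
    also have "\<dots> \<le> ennreal ((1/4) ^ n)"
    proof (rule Liminf_le)
      show "\<forall>\<^sub>F m in sequentially. (\<integral>\<^sup>+x. ennreal ((cmod (f m x - f n x))\<^sup>2) \<partial>half_line) \<le> ennreal ((1/4) ^ n)"
        using eventually_ge_at_top[of n] by eventually_elim (rule sq; simp)
    qed simp
    finally show ?thesis .
  qed
  have "integrable half_line (\<lambda>x. (cmod (g x - f 0 x))\<^sup>2)"
    using gle[of 0] by (intro integrableI_bounded) (auto simp: top_unique less_top[symmetric])
  then have "(\<lambda>x. g x - f 0 x) \<in> L2" by (simp add: L2_def)
  from L2_add[OF this L2[of 0]] have g: "g \<in> L2" by simp
  have "L2_norm (\<lambda>x. g x - f n x) \<le> (1/2) ^ n" for n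
  proof (rule power2_le_imp_le)
    have "ennreal ((L2_norm (\<lambda>x. g x - f n x))\<^sup>2) \<le> ennreal ((1/4) ^ n)"
      using gle[of n] by (simp add: nn_integral_L2_norm L2_diff L2 g)
    then have "(L2_norm (\<lambda>x. g x - f n x))\<^sup>2 \<le> (1/4) ^ n" by (simp add: ennreal_le_iff)
    also have "(1/4) ^ n = ((1/2::real) ^ n)\<^sup>2"
      by (simp add: power2_eq_square flip: power_mult_distrib)
    finally show "(L2_norm (\<lambda>x. g x - f n x))\<^sup>2 \<le> ((1/2) ^ n)\<^sup>2" .
  qed simp
  then show thesis using that g by blast
qed

instance l2 :: banach
proof
  fix X :: "nat \<Rightarrow> l2"
  assume X: "Cauchy X"
  have "\<exists>N. \<forall>i\<ge>N. \<forall>j\<ge>N. norm (X i - X j) < (1/2) ^ n" for n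
    using CauchyD[OF X, of "(1/2) ^ n"] by auto
  then obtain N where N: "\<And>n i j. i \<ge> N n \<Longrightarrow> j \<ge> N n \<Longrightarrow> norm (X i - X j) < (1/2) ^ n"
    by metis
  \<comment> \<open>The sum of the thresholds dominates each earlier one, so the subsequence has the
    rate that \<open>L2_limit\<close> asks for.\<close>
  define \<sigma> where "\<sigma> = (\<lambda>n. \<Sum>k\<le>n. N k)"
  have \<sigma>: "N n \<le> \<sigma> m" if "n \<le> m" for n m
    unfolding \<sigma>_def using that by (intro member_le_sum) auto
  obtain g where g: "g \<in> L2" "\<And>n. L2_norm (\<lambda>x. g x - rep_l2 (X (\<sigma> n)) x) \<le> (1/2) ^ n"
  proof (rule L2_limit[of "\<lambda>n. rep_l2 (X (\<sigma> n))"])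
    fix n m k :: nat assume "n \<le> m" "n \<le> k"
    then have "norm (X (\<sigma> m) - X (\<sigma> k)) < (1/2) ^ n" by (intro N \<sigma>)
    then show "L2_norm (\<lambda>x. rep_l2 (X (\<sigma> m)) x - rep_l2 (X (\<sigma> k)) x) \<le> (1/2) ^ n"
      by (simp add: mk_l2_norm[symmetric] L2_diff rep_l2_L2 mk_l2_diff mk_rep_l2)
  qed (auto simp: rep_l2_L2)
  have dist: "norm (mk_l2 g - X (\<sigma> n)) \<le> (1/2) ^ n" for n
    using g(2)[of n] by (simp add: mk_l2_norm[symmetric] L2_diff g(1) rep_l2_L2 mk_l2_diff mk_rep_l2)
  have close: "norm (X i - mk_l2 g) < 2 * (1/2) ^ n" if "i \<ge> N n" for i n
  proof -
    have "norm (X i - mk_l2 g) \<le> norm (X i - X (\<sigma> n)) + norm (mk_l2 g - X (\<sigma> n))"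
      using norm_triangle_ineq4[of "X i - X (\<sigma> n)" "mk_l2 g - X (\<sigma> n)"] by simp
    also have "\<dots> < (1/2) ^ n + (1/2) ^ n"
      using N[OF that \<sigma>[of n n]] dist[of n] by (intro add_less_le_mono) auto
    finally show ?thesis by simp
  qed
  have "X \<longlonglongrightarrow> mk_l2 g"
  proof (rule LIMSEQ_I)
    fix r :: real assume "r > 0"
    then obtain n where "(1/2) ^ n < r / 2" using real_arch_pow_inv[of "r / 2" "1/2"] by auto
    then show "\<exists>no. \<forall>i\<ge>no. norm (X i - mk_l2 g) < r"
      using close[of n] by (intro exI[of _ "N n"]) fastforce
  qed
  then show "convergent X" by (auto simp: convergent_def)
qed


section \<open>Self-adjoint operators with discrete spectrum\<close>

context
  fixes H :: l2_operator
  assumes H: "self_adjoint H"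
begin

text \<open>Read from right to left this is a criterion for membership in H. The condition on the
  right is preserved by sums, scalar multiples and changes on null sets, which is how these closure
  properties of H are obtained.\<close>

lemma self_adjoint_graph_iff:
  "(g, h) \<in> H \<longleftrightarrow> g \<in> L2 \<and> h \<in> L2 \<and> (\<forall>(f, k)\<in>H. L2_inner k g = L2_inner f h)"
proof -
  have "adjoint_operator H = H" using H by (simp add: self_adjoint_def)
  then show ?thesis by (auto simp: adjoint_operator_def set_eq_iff)
qed

lemma self_adjoint_symmetric:
  "(f, k) \<in> H \<Longrightarrow> (g, h) \<in> H \<Longrightarrow> L2_inner k g = L2_inner f h"
  using self_adjoint_graph_iff[of g h] by blast

lemma self_adjoint_L2: "(f, k) \<in> H \<Longrightarrow> f \<in> L2 \<and> k \<in> L2"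
  using self_adjoint_graph_iff[of f k] by blast

lemma self_adjoint_add:
  assumes "(f, k) \<in> H" "(g, h) \<in> H"
  shows "(\<lambda>x. f x + g x, \<lambda>x. k x + h x) \<in> H"
proof -
  have L2: "f \<in> L2" "k \<in> L2" "g \<in> L2" "h \<in> L2" using assms self_adjoint_L2 by auto
  have add_right: "L2_inner a (\<lambda>x. b x + c x) = L2_inner a b + L2_inner a c"
    if "a \<in> L2" "b \<in> L2" "c \<in> L2" for a b c
    using L2_inner_add_left[OF that(2,3,1)] L2_inner_commute[of a] by simp
  have "L2_inner b (\<lambda>x. f x + g x) = L2_inner a (\<lambda>x. k x + h x)" if ab: "(a, b) \<in> H" for a b
    using self_adjoint_symmetric[OF ab assms(1)] self_adjoint_symmetric[OF ab assms(2)] self_adjoint_L2[OF ab] L2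
    by (simp add: add_right)
  then show ?thesis
    unfolding self_adjoint_graph_iff[of "\<lambda>x. f x + g x"] using L2 by (auto intro: L2_add)
qed

lemma self_adjoint_cmult:
  assumes "(f, k) \<in> H"
  shows "(\<lambda>x. c * f x, \<lambda>x. c * k x) \<in> H"
proof -
  have L2: "f \<in> L2" "k \<in> L2" using assms self_adjoint_L2 by auto
  have "L2_inner a (\<lambda>x. c * b x) = cnj c * L2_inner a b" for a b
    using L2_inner_cmult_left[of c b a] L2_inner_commute[of a] by simp
  then have "L2_inner b (\<lambda>x. c * f x) = L2_inner a (\<lambda>x. c * k x)" if "(a, b) \<in> H" for a b
    using self_adjoint_symmetric[OF that assms] by simp
  then show ?thesis
    unfolding self_adjoint_graph_iff[of "\<lambda>x. c * f x"] using L2 by (auto intro: L2_cmult)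
qed

lemma self_adjoint_AE_cong:
  assumes "(f, k) \<in> H" "f' \<in> L2" "k' \<in> L2"
    and "AE x in half_line. f x = f' x" "AE x in half_line. k x = k' x"
  shows "(f', k') \<in> H"
proof -
  have "L2_inner b f' = L2_inner a k'" if ab: "(a, b) \<in> H" for a b
    using self_adjoint_symmetric[OF ab assms(1)] self_adjoint_L2[OF ab] self_adjoint_L2[OF assms(1)]
      assms(2-) L2_inner_AE_cong[of b f b f'] L2_inner_AE_cong[of a k a k'] by simp
  then show ?thesis
    unfolding self_adjoint_graph_iff[of f'] using assms by auto
qed

text \<open>H as an operator on classes. Because H is invariant under changes on null sets, a pair
  of representatives is in H exactly when the pair of its classes is in this set.\<close>

definition l2_graph :: "(l2 \<times> l2) set" where
  "l2_graph = {(mk_l2 f, mk_l2 k) | f k. (f, k) \<in> H}"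

lemma l2_graph_mk: "f \<in> L2 \<Longrightarrow> k \<in> L2 \<Longrightarrow> (mk_l2 f, mk_l2 k) \<in> l2_graph \<longleftrightarrow> (f, k) \<in> H"
proof
  assume L2: "f \<in> L2" "k \<in> L2" and "(mk_l2 f, mk_l2 k) \<in> l2_graph"
  then obtain g h where gh: "mk_l2 f = mk_l2 g" "mk_l2 k = mk_l2 h" "(g, h) \<in> H"
    unfolding l2_graph_def by blast
  then have "g \<in> L2" "h \<in> L2" using self_adjoint_L2 by auto
  then have "AE x in half_line. g x = f x" "AE x in half_line. h x = k x"
    using gh(1,2) L2 by (metis mk_l2_eq_iff)+
  then show "(f, k) \<in> H" using gh(3) L2 by (rule self_adjoint_AE_cong[rotated 3])
next
  assume "(f, k) \<in> H"
  then show "(mk_l2 f, mk_l2 k) \<in> l2_graph" unfolding l2_graph_def by blast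
qed

lemma l2_graphE:
  assumes "(F, K) \<in> l2_graph"
  obtains f k where "F = mk_l2 f" "K = mk_l2 k" "(f, k) \<in> H" "f \<in> L2" "k \<in> L2"
  using assms self_adjoint_L2 unfolding l2_graph_def by blast

lemma l2_graph_add: "(F, K) \<in> l2_graph \<Longrightarrow> (F', K') \<in> l2_graph \<Longrightarrow> (F + F', K + K') \<in> l2_graph"
  by (elim l2_graphE) (simp add: mk_l2_add[symmetric] l2_graph_mk L2_add self_adjoint_add)

lemma l2_graph_scaleR: "(F, K) \<in> l2_graph \<Longrightarrow> (r *\<^sub>R F, r *\<^sub>R K) \<in> l2_graph"
  by (elim l2_graphE) (simp add: mk_l2_scaleR[symmetric] l2_graph_mk L2_cmult self_adjoint_cmult)

lemma l2_graph_symmetric: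
  "(F, K) \<in> l2_graph \<Longrightarrow> (F', K') \<in> l2_graph \<Longrightarrow> K \<bullet> F' = F \<bullet> K'"
  by (elim l2_graphE) (simp add: mk_l2_inner self_adjoint_symmetric)

lemma l2_graph_resolvent_onto:
  assumes "complex_of_real z \<in> resolvent_set H"
  shows "\<exists>F K. (F, K) \<in> l2_graph \<and> K - z *\<^sub>R F = Y"
proof -
  obtain f k where fk: "(f, k) \<in> H" "AE x in half_line. k x - complex_of_real z * f x = rep_l2 Y x"
    using assms rep_l2_L2[of Y] unfolding resolvent_set_def by blast
  have L2: "f \<in> L2" "k \<in> L2" using self_adjoint_L2[OF fk(1)] by auto
  have "mk_l2 k - z *\<^sub>R mk_l2 f = mk_l2 (\<lambda>x. k x - complex_of_real z * f x)"
    using L2 by (simp add: mk_l2_diff mk_l2_scaleR L2_cmult)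
  also have "\<dots> = Y"
    using fk(2) L2 mk_l2_eq_iff[of "\<lambda>x. k x - complex_of_real z * f x" "rep_l2 Y"]
    by (simp add: rep_l2_L2 mk_rep_l2 L2_diff L2_cmult)
  finally show ?thesis using l2_graph_mk[OF L2] fk(1) by blast
qed

lemma l2_graph_resolvent_bound:
  assumes "complex_of_real z \<in> resolvent_set H"
  shows "\<exists>C\<ge>0. \<forall>(F, K)\<in>l2_graph. norm F \<le> C * norm (K - z *\<^sub>R F)"
proof -
  obtain C where C: "\<And>f k. (f, k) \<in> H \<Longrightarrow> L2_norm f \<le> C * L2_norm (\<lambda>x. k x - complex_of_real z * f x)"
    using assms unfolding resolvent_set_def by blast
  have "norm F \<le> max C 0 * norm (K - z *\<^sub>R F)" if "(F, K) \<in> l2_graph" for F K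
    using that
  proof (rule l2_graphE)
    fix f k assume *: "F = mk_l2 f" "K = mk_l2 k" "(f, k) \<in> H" "f \<in> L2" "k \<in> L2"
    have "norm F \<le> C * norm (K - z *\<^sub>R F)"
      using C[OF *(3)] *(4,5)
      by (simp add: *(1,2) mk_l2_norm[symmetric] mk_l2_diff mk_l2_scaleR L2_cmult L2_diff)
    also have "\<dots> \<le> max C 0 * norm (K - z *\<^sub>R F)" by (intro mult_right_mono) auto
    finally show ?thesis .
  qed
  then show ?thesis by (intro exI[of _ "max C 0"]) auto
qed

text \<open>The two orthogonality relations make the form of H diagonal on the span of the
  \<open>f n\<close>, so the bound K on single vectors holds on the whole span. The span is
  infinite-dimensional, and the bound turns into a positive lower bound for the form of the inverse
  A.\<close>

theorem discrete_spectrum_orthogonal_sequence: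
  fixes f h :: "nat \<Rightarrow> real \<Rightarrow> complex"
  assumes bdd: "lower_semibounded H" and disc: "discrete_spectrum H"
    and fh: "\<And>n. (f n, h n) \<in> H" and pos: "\<And>n. L2_norm (f n) > 0"
    and orth: "\<And>n m. n \<noteq> m \<Longrightarrow> L2_inner (f n) (f m) = 0"
      "\<And>n m. n \<noteq> m \<Longrightarrow> L2_inner (h n) (f m) = 0"
    and K: "\<And>n. Re (L2_inner (h n) (f n)) \<le> K * (L2_norm (f n))\<^sup>2"
  shows False
proof -
  obtain \<gamma> where "\<And>f k. (f, k) \<in> H \<Longrightarrow> Re (L2_inner k f) \<ge> \<gamma> * (L2_norm f)\<^sup>2"
    using bdd unfolding lower_semibounded_def by blast
  then have \<gamma>: "\<gamma> * (norm F)\<^sup>2 \<le> k \<bullet> F" if "(F, k) \<in> l2_graph" for F k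
    using that by (elim l2_graphE) (simp add: mk_l2_inner mk_l2_norm)
  \<comment> \<open>Strictly below the lower bound \<gamma>, so \<mu> cannot be an eigenvalue. As
    every spectral point is an eigenvalue, \<mu> is in the resolvent set.\<close>
  define \<mu> where "\<mu> = \<gamma> - 1"
  have eig: "\<exists>F. F \<noteq> 0 \<and> (F, z *\<^sub>R F) \<in> l2_graph"
    if z: "complex_of_real z \<notin> resolvent_set H" for z
  proof -
    have "is_eigenvalue H (complex_of_real z)"
      using disc z unfolding discrete_spectrum_def operator_spectrum_def by auto
    then obtain f where f: "(f, \<lambda>x. complex_of_real z * f x) \<in> H" "\<not> (AE x in half_line. f x = 0)"
      unfolding is_eigenvalue_def eigenspace_def by auto
    have L2: "f \<in> L2" using self_adjoint_L2[OF f(1)] by auto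
    have "mk_l2 f \<noteq> 0" using f(2) L2 mk_l2_eq_iff[of f "\<lambda>_. 0"] by (simp add: mk_l2_zero)
    moreover have "(mk_l2 f, z *\<^sub>R mk_l2 f) \<in> l2_graph"
      using f L2 by (simp add: mk_l2_scaleR[symmetric] l2_graph_mk L2_cmult)
    ultimately show ?thesis by blast
  qed
  have res: "complex_of_real \<mu> \<in> resolvent_set H"
  proof (rule ccontr)
    assume "\<not> ?thesis"
    then obtain F where F: "F \<noteq> 0" "(F, \<mu> *\<^sub>R F) \<in> l2_graph" using eig by blast
    have "\<gamma> * (norm F)\<^sup>2 \<le> \<mu> * (norm F)\<^sup>2" using \<gamma>[OF F(2)] by (simp add: dot_square_norm)
    then show False using F(1) by (simp add: \<mu>_def)
  qed
  obtain C where C: "C \<ge> 0" "\<And>F K. (F, K) \<in> l2_graph \<Longrightarrow> norm F \<le> C * norm (K - \<mu> *\<^sub>R F)"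
    using l2_graph_resolvent_bound[OF res] by blast
  have "\<exists>F. (F, Y + \<mu> *\<^sub>R F) \<in> l2_graph" for Y
  proof -
    obtain F k where "(F, k) \<in> l2_graph" "k - \<mu> *\<^sub>R F = Y"
      using l2_graph_resolvent_onto[OF res] by blast
    then have "(F, Y + \<mu> *\<^sub>R F) \<in> l2_graph" by auto
    then show ?thesis by blast
  qed
  then obtain A where A: "\<And>Y. (A Y, Y + \<mu> *\<^sub>R A Y) \<in> l2_graph" by metis
  have uniq: "F = A Y" if "(F, Y + \<mu> *\<^sub>R F) \<in> l2_graph" for F Y
  proof -
    have "(F + (- 1) *\<^sub>R A Y, (Y + \<mu> *\<^sub>R F) + (- 1) *\<^sub>R (Y + \<mu> *\<^sub>R A Y)) \<in> l2_graph"
      by (intro l2_graph_add l2_graph_scaleR that A)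
    from C(2)[OF this] show ?thesis by (simp add: algebra_simps)
  qed
  have A_graph: "A (k - \<mu> *\<^sub>R F) = F" if "(F, k) \<in> l2_graph" for F k
    using that by (intro uniq[symmetric]) simp
  have linA: "bounded_linear A"
  proof (rule bounded_linear_intro)
    show "A (X + Y) = A X + A Y" for X Y
      using l2_graph_add[OF A[of X] A[of Y]]
      by (intro uniq[symmetric]) (simp add: algebra_simps)
    show "A (r *\<^sub>R X) = r *\<^sub>R A X" for r X
      using l2_graph_scaleR[OF A[of X], of r]
      by (intro uniq[symmetric]) (simp add: algebra_simps)
    show "norm (A X) \<le> norm X * C" for X
      using C(2)[OF A[of X]] by (simp add: mult.commute)
  qed
  then interpret A: bounded_linear A .
  have sym: "symmetric_op A"
    unfolding symmetric_op_def
  proof (intro conjI allI linA)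
    fix X Y
    show "A X \<bullet> Y = X \<bullet> A Y"
      using l2_graph_symmetric[OF A[of X] A[of Y]] by (simp add: inner_add_left inner_add_right)
  qed
  \<comment> \<open>With F = A Y one has Y = (H - \<mu>) F, and H - \<mu> \<ge> 1, so (A Y, Y) is at
    least |F|^2.\<close>
  have psd: "0 \<le> A Y \<bullet> Y" for Y
  proof -
    have "(norm (A Y))\<^sup>2 \<le> A Y \<bullet> Y"
      using \<gamma>[OF A[of Y]]
      by (simp add: inner_add_left dot_square_norm \<mu>_def inner_commute algebra_simps)
    then show ?thesis by (rule order_trans[rotated]) simp
  qed
  \<comment> \<open>The value s for A corresponds to \<mu> + 1/s for H: applying H - (\<mu> + 1/s)
    to \<open>A Y\<close> gives -(1/s) (A Y - s Y). The resolvent bound D then controls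
    \<open>A Y\<close>, and s Y = A Y - R controls Y by the residual R.\<close>
  have bb: "bounded_below (\<lambda>x. A x - s *\<^sub>R x)"
    if s: "s \<noteq> 0" and z: "complex_of_real (\<mu> + 1 / s) \<in> resolvent_set H" for s
  proof -
    obtain D where D: "D \<ge> 0" "\<And>F K. (F, K) \<in> l2_graph \<Longrightarrow> norm F \<le> D * norm (K - (\<mu> + 1 / s) *\<^sub>R F)"
      using l2_graph_resolvent_bound[OF z] by blast
    define \<kappa> where "\<kappa> = \<bar>s\<bar> / (D / \<bar>s\<bar> + 1)"
    have dpos: "D / \<bar>s\<bar> + 1 > 0" using D(1) by (intro add_nonneg_pos) auto
    have "\<kappa> * norm Y \<le> norm (A Y - s *\<^sub>R Y)" for Y
    proof -
      let ?R = "A Y - s *\<^sub>R Y"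
      have "Y + \<mu> *\<^sub>R A Y - (\<mu> + 1 / s) *\<^sub>R A Y = (- 1 / s) *\<^sub>R ?R"
        using s by (simp add: algebra_simps)
      then have "norm (A Y) \<le> D / \<bar>s\<bar> * norm ?R" using D(2)[OF A[of Y]] by simp
      moreover have "norm (s *\<^sub>R Y) \<le> norm (A Y) + norm ?R"
        using norm_triangle_ineq4[of "A Y" ?R] by simp
      ultimately have "\<bar>s\<bar> * norm Y \<le> (D / \<bar>s\<bar> + 1) * norm ?R" by (simp add: distrib_right)
      then show ?thesis using dpos by (simp add: \<kappa>_def field_simps)
    qed
    moreover have "\<kappa> > 0" using s dpos by (simp add: \<kappa>_def)
    ultimately show ?thesis unfolding bounded_below_def by blast
  qed
  define G where "G = (\<lambda>n. mk_l2 (f n))"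
  define Y where "Y = (\<lambda>n. mk_l2 (h n) - \<mu> *\<^sub>R G n)"
  have fL2: "f n \<in> L2" and hL2: "h n \<in> L2" for n using self_adjoint_L2[OF fh] by auto
  have AY: "A (Y n) = G n" for n
    unfolding Y_def G_def using fh fL2 hL2 by (intro A_graph) (simp add: l2_graph_mk)
  have G0: "G n \<noteq> 0" for n using pos[of n] by (auto simp: G_def mk_l2_norm[symmetric] fL2)
  have GG: "G n \<bullet> G m = 0" if "n \<noteq> m" for n m
    using orth(1)[OF that] by (simp add: G_def mk_l2_inner fL2)
  have YG: "Y n \<bullet> G m = 0" if "n \<noteq> m" for n m
    using orth(2)[OF that] GG[OF that] by (simp add: Y_def inner_diff_left) (simp add: G_def mk_l2_inner fL2 hL2)
  \<comment> \<open>An upper bound for the form of H - \<mu> on the span; the maximum ensures that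
    1/L is a positive lower bound for A.\<close>
  define L where "L = max 1 (K - \<mu>)"
  have L: "L > 0" by (simp add: L_def)
  have YGn: "Y n \<bullet> G n \<le> L * (norm (G n))\<^sup>2" for n
  proof -
    have "Y n \<bullet> G n \<le> (K - \<mu>) * (norm (G n))\<^sup>2"
      using K[of n]
      by (simp add: Y_def inner_diff_left dot_square_norm left_diff_distrib)
         (simp add: G_def mk_l2_inner mk_l2_norm fL2 hL2)
    also have "\<dots> \<le> L * (norm (G n))\<^sup>2" by (intro mult_right_mono) (auto simp: L_def)
    finally show ?thesis .
  qed
  have injG: "inj G"
  proof (rule injI)
    fix n m assume "G n = G m"
    then show "n = m" using GG[of n m] G0[of n] by auto
  qed
  show False
  proof (rule no_infinite_dim_lower_bound[OF sym])
    fix m :: real assume m: "m > 0"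
    define z where "z = \<mu> + 1 / m"
    show "\<exists>r>0. \<forall>s. 0 < \<bar>s - m\<bar> \<and> \<bar>s - m\<bar> < r \<longrightarrow> bounded_below (\<lambda>x. A x - s *\<^sub>R x)"
    proof (cases "complex_of_real z \<in> resolvent_set H")
      case True
      then obtain \<kappa> where \<kappa>: "\<kappa> > 0" "\<And>x. \<kappa> * norm x \<le> norm (A x - m *\<^sub>R x)"
        using bb[of m] m unfolding z_def bounded_below_def by auto
      \<comment> \<open>A lower bound \<kappa> for A - m leaves \<kappa> - |s - m| for A -
        s.\<close>
      have "bounded_below (\<lambda>x. A x - s *\<^sub>R x)" if "\<bar>s - m\<bar> < \<kappa>" for s
      proof -
        have "(\<kappa> - \<bar>s - m\<bar>) * norm x \<le> norm (A x - s *\<^sub>R x)" for x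
        proof -
          have "A x - m *\<^sub>R x = (A x - s *\<^sub>R x) + (s - m) *\<^sub>R x" by (simp add: algebra_simps)
          then have "norm (A x - m *\<^sub>R x) \<le> norm (A x - s *\<^sub>R x) + \<bar>s - m\<bar> * norm x"
            using norm_triangle_ineq[of "A x - s *\<^sub>R x" "(s - m) *\<^sub>R x"]
            by (simp only: norm_scaleR)
          then show ?thesis using \<kappa>(2)[of x] by (simp add: left_diff_distrib)
        qed
        then show ?thesis unfolding bounded_below_def using that by (intro exI[of _ "\<kappa> - \<bar>s - m\<bar>"]) auto
      qed
      then show ?thesis using \<kappa>(1) by blast
    next
      case False
      then have "complex_of_real z isolated_in operator_spectrum H"
        using disc unfolding discrete_spectrum_def operator_spectrum_def by auto
      then obtain T where T: "open T" "T \<inter> operator_spectrum H = {complex_of_real z}"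
        unfolding isolated_in_def by blast
      \<comment> \<open>For s near m but different from m, the point \<mu> + 1/s lies in the
        isolating neighbourhood T and differs from z, so it belongs to the resolvent set.\<close>
      have "((\<lambda>s. complex_of_real (\<mu> + 1 / s)) \<longlongrightarrow> complex_of_real z) (at m)"
        unfolding z_def using m by (intro tendsto_intros) auto
      then have "\<forall>\<^sub>F s in at m. complex_of_real (\<mu> + 1 / s) \<in> T"
        using T by (intro topological_tendstoD) auto
      moreover have "\<forall>\<^sub>F s in at m. s > 0"
        using m by (intro order_tendstoD) (auto intro: tendsto_ident_at)
      ultimately have "\<forall>\<^sub>F s in at m. bounded_below (\<lambda>x. A x - s *\<^sub>R x)"
        using eventually_neq_at_within[of m m UNIV]
      proof eventually_elim
        case (elim s)
        then have "complex_of_real (\<mu> + 1 / s) \<noteq> complex_of_real z" using m by (auto simp: z_def)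
        then have "complex_of_real (\<mu> + 1 / s) \<notin> operator_spectrum H" using elim T by blast
        then show ?case using elim by (intro bb) (auto simp: operator_spectrum_def)
      qed
      then show ?thesis by (auto simp: eventually_at dist_real_def)
    qed
    show "\<exists>B. finite B \<and> {x. A x = m *\<^sub>R x} \<subseteq> span B"
    proof (cases "complex_of_real z \<in> resolvent_set H")
      case True
      then obtain \<kappa> where \<kappa>: "\<kappa> > 0" "\<And>x. \<kappa> * norm x \<le> norm (A x - m *\<^sub>R x)"
        using bb[of m] m unfolding z_def bounded_below_def by auto
      have "x = 0" if "A x = m *\<^sub>R x" for x
      proof -
        have "\<kappa> * norm x \<le> 0" using \<kappa>(2)[of x] that by simp
        then have "norm x \<le> 0" using \<kappa>(1) by (simp add: mult_le_0_iff)
        then show ?thesis by simp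
      qed
      then show ?thesis by (intro exI[of _ "{}"]) auto
    next
      case False
      then have "finite_multiplicity H (complex_of_real z)"
        using disc unfolding discrete_spectrum_def operator_spectrum_def by blast
      then obtain B where B: "finite B" "B \<subseteq> eigenspace H (complex_of_real z)"
        and Bspan: "\<forall>g\<in>eigenspace H (complex_of_real z). \<exists>c. AE x in half_line. g x = (\<Sum>b\<in>B. c b * b x)"
        unfolding finite_multiplicity_def by (elim exE conjE)
      have BL2: "b \<in> L2" if "b \<in> B" for b
        using B(2) that self_adjoint_L2 unfolding eigenspace_def by blast
      \<comment> \<open>Multiplicity is counted over the complex numbers, whereas
        \<open>span\<close> is real; adjoining the multiples by \<open>\<i>\<close> makes the real
        span contain the complex one.\<close>
      define B' where "B' = mk_l2 ` B \<union> (\<lambda>b. mk_l2 (\<lambda>x. \<i> * b x)) ` B"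
      have "x \<in> span B'" if x: "A x = m *\<^sub>R x" for x
      proof -
        have "(m *\<^sub>R x, x + \<mu> *\<^sub>R m *\<^sub>R x) \<in> l2_graph" using A[of x] x by simp
        from l2_graph_scaleR[OF this, of "1 / m"] have "(x, z *\<^sub>R x) \<in> l2_graph"
          using m by (simp add: z_def algebra_simps)
        then obtain g where g: "x = mk_l2 g" "g \<in> L2" "(mk_l2 g, z *\<^sub>R mk_l2 g) \<in> l2_graph"
          by (metis l2_graphE)
        have "(g, \<lambda>x. complex_of_real z * g x) \<in> H"
          using g(2,3) by (simp add: mk_l2_scaleR[symmetric] l2_graph_mk L2_cmult)
        then have "g \<in> eigenspace H (complex_of_real z)" by (simp add: eigenspace_def)
        from bspec[OF Bspan this]
        obtain c where c: "AE x in half_line. g x = (\<Sum>b\<in>B. c b * b x)" by (elim exE)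
        have "x = mk_l2 (\<lambda>x. \<Sum>b\<in>B. c b * b x)"
          using c g(1,2) by (simp add: mk_l2_eq_iff L2_sum L2_cmult BL2)
        also have "\<dots> = (\<Sum>b\<in>B. mk_l2 (\<lambda>x. c b * b x))"
          by (rule mk_l2_sum) (simp add: L2_cmult BL2)
        also have "\<dots> \<in> span B'"
        proof (rule span_sum)
          fix b assume b: "b \<in> B"
          have "(\<lambda>x. c b * b x) = (\<lambda>x. of_real (Re (c b)) * b x + of_real (Im (c b)) * (\<i> * b x))"
            by (rule ext) (subst complex_eq[of "c b"], simp add: algebra_simps)
          then have "mk_l2 (\<lambda>x. c b * b x)
              = Re (c b) *\<^sub>R mk_l2 b + Im (c b) *\<^sub>R mk_l2 (\<lambda>x. \<i> * b x)"
            using BL2[OF b] by (simp only: mk_l2_add mk_l2_scaleR L2_cmult)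
          moreover have "mk_l2 b \<in> B'" "mk_l2 (\<lambda>x. \<i> * b x) \<in> B'"
            using b by (auto simp: B'_def)
          ultimately show "mk_l2 (\<lambda>x. c b * b x) \<in> span B'"
            by (simp only: span_add span_scale span_base)
        qed
        finally show ?thesis .
      qed
      then show ?thesis using B(1) by (intro exI[of _ B']) (auto simp: B'_def)
    qed
  next
    show "subspace (span (range G))" by (rule subspace_span)
    have "independent (range G)"
    proof (rule pairwise_orthogonal_independent)
      show "pairwise orthogonal (range G)"
      proof (rule pairwiseI)
        fix a b assume "a \<in> range G" "b \<in> range G" "a \<noteq> b"
        then obtain n m where "a = G n" "b = G m" "n \<noteq> m" by blast
        then show "orthogonal a b" using GG[of n m] by (simp add: orthogonal_def)
      qed
      show "0 \<notin> range G"
      proof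
        assume "0 \<in> range G"
        then obtain n where "G n = 0" by (elim rangeE) simp
        then show False using G0[of n] by simp
      qed
    qed
    moreover have "infinite (range G)" using injG by (simp add: range_inj_infinite)
    ultimately show "\<nexists>B. finite B \<and> span (range G) \<subseteq> span B"
      using independent_span_bound[of _ "range G"] span_superset[of "range G"] by blast
    show "1 / L > 0" using L by simp
    fix x assume "x \<in> span (range G)"
    then obtain t r where t: "finite t" "t \<subseteq> range G" "x = (\<Sum>a\<in>t. r a *\<^sub>R a)"
      unfolding span_explicit by blast
    obtain I where I: "finite I" "t = G ` I"
      using finite_subset_image[OF t(1,2)] by blast
    define c where "c = (\<lambda>n. r (G n))"
    have x: "x = (\<Sum>n\<in>I. c n *\<^sub>R G n)"
      unfolding t(3) I(2) c_def using injG by (subst sum.reindex) (auto simp: inj_on_def)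
    \<comment> \<open>This is (H - \<mu>) x, so \<open>y \<bullet> x\<close> is the form of H -
      \<mu> at x, a weighted sum of the squares of the coefficients.\<close>
    define y where "y = (\<Sum>n\<in>I. c n *\<^sub>R Y n)"
    have Ay: "A y = x" by (simp add: x y_def A.sum A.scaleR AY)
    have diag: "(\<Sum>n\<in>I. c n *\<^sub>R U n) \<bullet> x = (\<Sum>n\<in>I. (c n)\<^sup>2 * (U n \<bullet> G n))"
      if U: "\<And>n m. n \<noteq> m \<Longrightarrow> U n \<bullet> G m = 0" for U
    proof -
      have Ux: "U n \<bullet> x = c n * (U n \<bullet> G n)" if n: "n \<in> I" for n
      proof -
        have "U n \<bullet> x = (\<Sum>m\<in>I. c m * (U n \<bullet> G m))" by (simp add: x inner_sum_right)
        also have "\<dots> = (\<Sum>m\<in>I. if m = n then c n * (U n \<bullet> G n) else 0)"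
          by (intro sum.cong refl) (auto simp: U)
        finally show ?thesis using I(1) n by simp
      qed
      have "(\<Sum>n\<in>I. c n *\<^sub>R U n) \<bullet> x = (\<Sum>n\<in>I. c n * (U n \<bullet> x))"
        by (simp add: inner_sum_left)
      then show ?thesis by (simp add: Ux power2_eq_square mult.assoc)
    qed
    have "y \<bullet> x = (\<Sum>n\<in>I. (c n)\<^sup>2 * (Y n \<bullet> G n))" unfolding y_def by (rule diag[OF YG])
    also have "\<dots> \<le> (\<Sum>n\<in>I. (c n)\<^sup>2 * (L * (norm (G n))\<^sup>2))" by (intro sum_mono mult_left_mono YGn) auto
    also have "\<dots> = L * (\<Sum>n\<in>I. (c n)\<^sup>2 * (G n \<bullet> G n))"
      by (simp add: sum_distrib_left dot_square_norm mult_ac)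
    also have "(\<Sum>n\<in>I. (c n)\<^sup>2 * (G n \<bullet> G n)) = (norm x)\<^sup>2"
      using diag[of G] GG by (simp add: x[symmetric] dot_square_norm)
    finally have yx: "y \<bullet> x \<le> L * (norm x)\<^sup>2" .
    \<comment> \<open>With A y = x, Cauchy-Schwarz for the form of A gives N^2 = (A y, x)^2 \<le> (A
      y, y) (A x, x) \<le> L N (A x, x), and N is cancelled.\<close>
    define N where "N = (norm x)\<^sup>2"
    have "N\<^sup>2 \<le> (A y \<bullet> y) * (A x \<bullet> x)"
      using psd_Cauchy_Schwarz[OF sym subspace_UNIV psd, of y x] by (simp add: Ay dot_square_norm N_def)
    also have "\<dots> \<le> (L * N) * (A x \<bullet> x)"
      using yx by (intro mult_right_mono psd) (simp add: Ay inner_commute N_def)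
    finally have "N * N \<le> (L * (A x \<bullet> x)) * N" by (simp add: power2_eq_square mult_ac)
    moreover have "N \<ge> 0" by (simp add: N_def)
    ultimately have "N \<le> L * (A x \<bullet> x)"
      using L psd[of x] by (cases "N = 0") (auto simp: mult_le_cancel_right)
    then show "1 / L * (norm x)\<^sup>2 \<le> A x \<bullet> x" using L by (simp add: N_def field_simps)
  qed
qed

end


section \<open>Distribution functions on the half-line\<close>

text \<open>Covers both \<open>lborel\<close>, whose space is the whole line, and measures whose
  space is (0,\<infinity>). The axioms therefore speak of Borel subsets of the half-line and of
  measurability of the identity, not of the sigma-algebra itself.\<close>

locale half_line_radon = sigma_finite_measure \<mu> for \<mu> :: "real measure" +
  assumes id_measurable: "(\<lambda>x. x) \<in> borel_measurable \<mu>"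
    and sets_half_line: "A \<in> sets borel \<Longrightarrow> A \<subseteq> {0<..} \<Longrightarrow> A \<in> sets \<mu>"
    and finite_interval: "emeasure \<mu> {0<..<c} < \<infinity>"
begin

lemma borel_measurable_half_line: "u \<in> borel_measurable borel \<Longrightarrow> u \<in> borel_measurable \<mu>"
  by (rule measurable_compose[OF id_measurable])

lemma finite_emeasure: "A \<subseteq> {0<..<c} \<Longrightarrow> emeasure \<mu> A < \<infinity>"
  by (rule le_less_trans[OF emeasure_mono finite_interval]) (auto intro!: sets_half_line)

lemma set_integrable_bounded:
  fixes u :: "real \<Rightarrow> 'b::{banach, second_countable_topology}"
  assumes "u \<in> borel_measurable borel" "\<And>x. x \<in> A \<Longrightarrow> norm (u x) \<le> B"
    and "A \<in> sets borel" "A \<subseteq> {0<..<c}"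
  shows "set_integrable \<mu> A u"
proof -
  have A: "A \<in> sets \<mu>" using assms by (intro sets_half_line) auto
  show ?thesis
    unfolding set_integrable_def
    using assms A finite_emeasure[of A c] borel_measurable_half_line[OF assms(1)]
    by (intro integrableI_bounded_set_indicator[where B=B]) auto
qed

lemma set_integral_bound:
  fixes u :: "real \<Rightarrow> real"
  assumes "u \<in> borel_measurable borel" "\<And>x. x \<in> A \<Longrightarrow> \<bar>u x\<bar> \<le> B"
    and A: "A \<in> sets borel" "A \<subseteq> {0<..<c}"
  shows "\<bar>LINT t:A|\<mu>. u t\<bar> \<le> B * measure \<mu> A"
proof -
  have int: "set_integrable \<mu> A u" using assms by (intro set_integrable_bounded) auto
  have "A \<in> sets \<mu>" using A by (intro sets_half_line) auto
  then have "set_integrable \<mu> A (\<lambda>_. B)" "(LINT t:A|\<mu>. B) = B * measure \<mu> A"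
    using finite_emeasure[OF A(2)] by (auto simp: set_integrable_def set_lebesgue_integral_def)
  moreover have "\<bar>LINT t:A|\<mu>. u t\<bar> \<le> (LINT t:A|\<mu>. \<bar>u t\<bar>)"
    using set_integral_norm_bound[OF int] by simp
  moreover have "(LINT t:A|\<mu>. \<bar>u t\<bar>) \<le> (LINT t:A|\<mu>. B)"
    using assms(2) int calculation(1) by (intro set_integral_mono) (auto intro: set_integrable_abs)
  ultimately show ?thesis by linarith
qed

text \<open>The primitive of u with respect to \<mu>. The open right end makes it left continuous
  and its increments integrals over [a,b), matching the convention for
  \<open>has_quasi_derivative\<close>; for x \<le> 0 its value is 0.\<close>

definition distf :: "(real \<Rightarrow> real) \<Rightarrow> real \<Rightarrow> real" where
  "distf u x = (LINT t:{0<..<x}|\<mu>. u t)"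

lemma distf_diff:
  assumes u: "u \<in> borel_measurable borel" "\<And>x. \<bar>u x\<bar> \<le> B" and ab: "0 < a" "a \<le> b"
  shows "distf u b - distf u a = (LINT t:{a..<b}|\<mu>. u t)"
proof -
  have eq: "{0<..<b} = {0<..<a} \<union> {a..<b}" using ab by auto
  have "distf u b = distf u a + (LINT t:{a..<b}|\<mu>. u t)"
    unfolding distf_def eq
    using u ab by (intro set_integral_Un set_integrable_bounded[where B=B and c=b]) auto
  then show ?thesis by simp
qed

lemma distf_add:
  assumes "u \<in> borel_measurable borel" "\<And>x. \<bar>u x\<bar> \<le> B"
    and "v \<in> borel_measurable borel" "\<And>x. \<bar>v x\<bar> \<le> B'"
  shows "distf (\<lambda>x. u x + v x) b = distf u b + distf v b"
  unfolding distf_def using assms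
  by (intro set_integral_add set_integrable_bounded[where c=b] subset_refl) auto

lemma distf_cmult: "distf (\<lambda>x. c * u x) b = c * distf u b"
  unfolding distf_def by simp

lemma distf_bound:
  assumes "u \<in> borel_measurable borel" "\<And>x. \<bar>u x\<bar> \<le> B" "x \<le> c"
  shows "\<bar>distf u x\<bar> \<le> B * measure \<mu> {0<..<c}"
proof -
  have "\<bar>distf u x\<bar> \<le> B * measure \<mu> {0<..<x}"
    unfolding distf_def using assms by (intro set_integral_bound) auto
  also have "\<dots> \<le> B * measure \<mu> {0<..<c}"
  proof (intro mult_left_mono measure_mono_fmeasurable)
    show "0 \<le> B" using assms(2)[of 0] by linarith
    show "{0<..<c} \<in> fmeasurable \<mu>"
      using finite_interval[of c] by (intro fmeasurableI sets_half_line) auto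
    show "{0<..<x} \<in> sets \<mu>" by (rule sets_half_line) auto
  qed (use assms in auto)
  finally show ?thesis .
qed

lemma distf_const_right:
  assumes u: "u \<in> borel_measurable borel" "\<And>x. \<bar>u x\<bar> \<le> B" and b: "0 < b" "b \<le> x"
    and "\<And>t. t \<ge> b \<Longrightarrow> u t = 0"
  shows "distf u x = distf u b"
proof -
  have "(LINT t:{b..<x}|\<mu>. u t) = (LINT t:{b..<x}|\<mu>. 0)"
    using assms by (intro set_lebesgue_integral_cong sets_half_line) auto
  then show ?thesis using distf_diff[OF u b] by simp
qed

lemma distf_zero_left:
  assumes "x \<le> a" "\<And>t. t \<le> a \<Longrightarrow> u t = 0"
  shows "distf u x = 0"
proof -
  have "distf u x = (LINT t:{0<..<x}|\<mu>. 0)"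
    unfolding distf_def using assms by (intro set_lebesgue_integral_cong sets_half_line) auto
  then show ?thesis by simp
qed

lemma distf_measurable:
  assumes [measurable]: "u \<in> borel_measurable borel"
  shows "distf u \<in> borel_measurable borel"
proof -
  note id_measurable [measurable]
  have [measurable]: "u \<in> borel_measurable \<mu>" by (rule borel_measurable_half_line) simp
  have "(\<lambda>x. LINT t|\<mu>. (if 0 < t \<and> t < x then u t else 0)) \<in> borel_measurable borel"
    by measurable
  moreover have "distf u = (\<lambda>x. LINT t|\<mu>. (if 0 < t \<and> t < x then u t else 0))"
    unfolding distf_def set_lebesgue_integral_def
    by (intro ext Bochner_Integration.integral_cong) (auto simp: indicator_def)
  ultimately show ?thesis by simp
qed

text \<open>When S n increases strictly below x to x, the indicators of (0, S n) converge to that of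
  (0, x) at every point, also at x itself, so an atom at x does no harm. Dominated convergence
  applies.\<close>

lemma distf_left_continuous:
  assumes u: "u \<in> borel_measurable borel" "\<And>x. \<bar>u x\<bar> \<le> B" and "x > 0"
  shows "continuous (at_left x) (distf u)"
  unfolding continuous_within
proof (rule tendsto_at_left_sequentially[of 0])
  have [measurable]: "u \<in> borel_measurable \<mu>" by (rule borel_measurable_half_line) (rule u)
  have [measurable]: "{0<..<y} \<in> sets \<mu>" for y by (rule sets_half_line) auto
  fix S :: "nat \<Rightarrow> real"
  assume S: "\<And>n. S n < x" "\<And>n. 0 < S n" "incseq S" "S \<longlonglongrightarrow> x"
  show "(\<lambda>n. distf u (S n)) \<longlonglongrightarrow> distf u x"
    unfolding distf_def set_lebesgue_integral_def
  proof (rule integral_dominated_convergence)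
    show "integrable \<mu> (\<lambda>t. indicator {0<..<x} t *\<^sub>R B)"
      using finite_interval[of x] by (intro integrable_scaleR_left integrable_real_indicator) auto
    show "AE t in \<mu>. (\<lambda>n. indicator {0<..<S n} t *\<^sub>R u t) \<longlonglongrightarrow> indicator {0<..<x} t *\<^sub>R u t"
    proof (intro AE_I2)
      fix t
      have "\<forall>\<^sub>F n in sequentially. indicator {0<..<S n} t = (indicator {0<..<x} t :: real)"
      proof (cases "t < x")
        case True
        then have "\<forall>\<^sub>F n in sequentially. t < S n" using S(4) by (intro order_tendstoD) auto
        then show ?thesis by (rule eventually_mono) (use True in \<open>auto simp: indicator_def\<close>)
      next
        case False
        then have "\<not> t < S n" for n using S(1)[of n] by linarith
        then show ?thesis using False by (intro always_eventually) (auto simp: indicator_def)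
      qed
      then have "(\<lambda>n. indicator {0<..<S n} t :: real) \<longlonglongrightarrow> indicator {0<..<x} t"
        by (rule tendsto_eventually)
      then show "(\<lambda>n. indicator {0<..<S n} t *\<^sub>R u t) \<longlonglongrightarrow> indicator {0<..<x} t *\<^sub>R u t"
        by (intro tendsto_scaleR tendsto_const)
    qed
    show "AE t in \<mu>. norm (indicator {0<..<S n} t *\<^sub>R u t) \<le> indicator {0<..<x} t *\<^sub>R B" for n
      using u(2) S(1)[of n] order_trans[OF abs_ge_zero u(2)[of 0]]
      by (intro AE_I2) (auto simp: indicator_def)
  qed (auto intro!: measurable)
qed (use \<open>x > 0\<close> in auto)

text \<open>Fubini for w(x) u(t) on the triangle 0 < t < x < b: integrating first over x leaves u(b)
  - u(t) = -u(t). Only one of the two factors is absolutely continuous; the other may jump at atoms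
  of \<mu>.\<close>

lemma distf_by_parts:
  assumes u: "u \<in> borel_measurable borel" "\<And>x. \<bar>u x\<bar> \<le> B" "\<And>x. u x = (LINT t:{0<..<x}|lborel. w t)"
    and w: "w \<in> borel_measurable borel" "set_integrable lborel {0<..<b} w"
    and b: "b > 0" "u b = 0"
  shows "(LINT x:{0<..<b}|lborel. w x * distf u x) = - (LINT t:{0<..<b}|\<mu>. (u t)\<^sup>2)"
proof -
  interpret P: pair_sigma_finite lborel \<mu> ..
  note id_measurable [measurable]
  have [measurable]: "u \<in> borel_measurable borel" "w \<in> borel_measurable borel" by fact+
  have [measurable]: "u \<in> borel_measurable \<mu>" by (rule borel_measurable_half_line) (rule u)
  define k where "k = (\<lambda>x t. if 0 < t \<and> t < x \<and> x < b then w x * u t else 0)"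
  have [measurable]: "case_prod k \<in> borel_measurable (lborel \<Otimes>\<^sub>M \<mu>)"
    unfolding k_def by measurable
  have set\<mu>: "{0<..<y} \<in> sets \<mu>" for y :: real by (rule sets_half_line) auto
  have "integrable (lborel \<Otimes>\<^sub>M \<mu>) (\<lambda>(x, t). (indicator {0<..<b} x *\<^sub>R \<bar>w x\<bar>) * (indicator {0<..<b} t *\<^sub>R B))"
  proof -
    have i1: "integrable lborel (\<lambda>x. indicator {0<..<b} x *\<^sub>R \<bar>w x\<bar>)"
      using set_integrable_abs[OF w(2)] by (simp add: set_integrable_def)
    have i2: "integrable \<mu> (\<lambda>t. indicator {0<..<b} t *\<^sub>R B)"
      using finite_interval[of b] set\<mu> by (intro integrable_scaleR_left integrable_real_indicator) auto
    show ?thesis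
    proof (rule P.Fubini_integrable)
      have [measurable]: "{0<..<b} \<in> sets \<mu>" by (rule set\<mu>)
      show "(\<lambda>(x, t). (indicator {0<..<b} x *\<^sub>R \<bar>w x\<bar>) * (indicator {0<..<b} t *\<^sub>R B))
          \<in> borel_measurable (lborel \<Otimes>\<^sub>M \<mu>)" by measurable
      show "AE x in lborel. integrable \<mu> (\<lambda>t. case (x, t) of (x, t) \<Rightarrow>
          (indicator {0<..<b} x *\<^sub>R \<bar>w x\<bar>) * (indicator {0<..<b} t *\<^sub>R B))"
        unfolding prod.case by (intro AE_I2 integrable_mult_right i2)
      have "integrable lborel (\<lambda>x. (indicator {0<..<b} x *\<^sub>R \<bar>w x\<bar>) * (LINT t|\<mu>. \<bar>indicator {0<..<b} t *\<^sub>R B\<bar>))"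
        by (intro integrable_mult_left i1)
      then show "integrable lborel (\<lambda>x. LINT t|\<mu>. norm (case (x, t) of (x, t) \<Rightarrow>
          (indicator {0<..<b} x *\<^sub>R \<bar>w x\<bar>) * (indicator {0<..<b} t *\<^sub>R B)))"
        by (simp add: abs_mult)
    qed
  qed
  then have int: "integrable (lborel \<Otimes>\<^sub>M \<mu>) (case_prod k)"
  proof (rule Bochner_Integration.integrable_bound)
    have "\<bar>u t\<bar> \<le> \<bar>B\<bar>" for t using u(2)[of t] by linarith
    then show "AE x in lborel \<Otimes>\<^sub>M \<mu>. norm (case_prod k x) \<le> norm (case x of (x, t) \<Rightarrow>
        (indicator {0<..<b} x *\<^sub>R \<bar>w x\<bar>) * (indicator {0<..<b} t *\<^sub>R B))"
      by (intro AE_I2) (auto simp: k_def indicator_def abs_mult intro!: mult_left_mono)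
  qed simp
  have wint: "set_integrable lborel {0<..<t} w" if "t \<le> b" for t
    by (rule set_integrable_subset[OF w(2)]) (use that in auto)
  have "(LINT x:{0<..<b}|lborel. w x * distf u x) = (LINT x|lborel. LINT t|\<mu>. k x t)"
    unfolding set_lebesgue_integral_def distf_def
  proof (intro Bochner_Integration.integral_cong refl)
    fix x
    show "indicator {0<..<b} x *\<^sub>R (w x * (LINT t|\<mu>. indicator {0<..<x} t *\<^sub>R u t)) = (LINT t|\<mu>. k x t)"
    proof (cases "0 < x \<and> x < b")
      case True
      have "(LINT t|\<mu>. k x t) = (LINT t|\<mu>. w x * (indicator {0<..<x} t *\<^sub>R u t))"
        using True by (intro Bochner_Integration.integral_cong refl) (auto simp: k_def indicator_def)
      then show ?thesis using True by simp
    next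
      case False
      then have "k x t = 0" for t by (auto simp: k_def)
      then show ?thesis using False by auto
    qed
  qed
  also have "\<dots> = (LINT t|\<mu>. LINT x|lborel. k x t)"
    by (rule P.Fubini_integral[OF int, symmetric])
  also have "\<dots> = (LINT t:{0<..<b}|\<mu>. - (u t)\<^sup>2)"
    unfolding set_lebesgue_integral_def
  proof (intro Bochner_Integration.integral_cong refl)
    fix t
    show "(LINT x|lborel. k x t) = indicator {0<..<b} t *\<^sub>R - (u t)\<^sup>2"
    proof (cases "0 < t \<and> t < b")
      case True
      have "(LINT x|lborel. k x t) = u t * (LINT x:{t<..<b}|lborel. w x)"
        unfolding set_lebesgue_integral_def using True
        by (subst integral_mult_right_zero[symmetric], intro Bochner_Integration.integral_cong)
           (auto simp: k_def indicator_def)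
      \<comment> \<open>The endpoint t is added with respect to Lebesgue measure, so a possible atom
        of \<mu> at t does not count here.\<close>
      also have "(LINT x:{t<..<b}|lborel. w x) = (LINT x:{t..<b}|lborel. w x)"
        unfolding set_lebesgue_integral_def
        using AE_lborel_singleton[of t]
        by (intro integral_cong_AE) (auto simp: indicator_def elim!: eventually_mono)
      also have "\<dots> = u b - u t"
      proof -
        have eq: "{0<..<b} = {0<..<t} \<union> {t..<b}" using True by auto
        have "u b = u t + (LINT x:{t..<b}|lborel. w x)"
          unfolding u(3) eq
          using True by (intro set_integral_Un wint set_integrable_subset[OF w(2)]) auto
        then show ?thesis by simp
      qed
      finally show ?thesis using True b by (simp add: power2_eq_square)
    next
      case False
      then have "k x t = 0" for x by (auto simp: k_def)
      then show ?thesis using False by auto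
    qed
  qed
  finally show ?thesis by (simp add: set_lebesgue_integral_def)
qed

end


lemma half_line_radon_lborel: "half_line_radon lborel"
proof (intro half_line_radon.intro half_line_radon_axioms.intro)
  show "sigma_finite_measure (lborel :: real measure)" by (rule sigma_finite_lborel)
  show "emeasure lborel {0<..<c} < \<infinity>" for c :: real by (cases "c > 0") auto
qed auto

lemma half_line_radonI:
  fixes \<nu> :: "real measure"
  assumes sets: "sets \<nu> = sets (restrict_space borel {0<..})"
    and fin: "\<And>c. c > 0 \<Longrightarrow> emeasure \<nu> {0<..<c} < \<infinity>"
  shows "half_line_radon \<nu>"
proof (intro half_line_radon.intro half_line_radon_axioms.intro)
  have space: "space \<nu> = {0<..}"
    using sets_eq_imp_space_eq[OF sets] by (simp add: space_restrict_space)
  have s: "A \<in> sets \<nu>" if "A \<in> sets borel" "A \<subseteq> {0<..}" for A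
    unfolding sets using that by (auto simp: sets_restrict_space image_iff intro!: bexI[of _ A])
  show "A \<in> sets borel \<Longrightarrow> A \<subseteq> {0<..} \<Longrightarrow> A \<in> sets \<nu>" for A by (rule s)
  show "emeasure \<nu> {0<..<c} < \<infinity>" for c
    using fin[of c] by (cases "c > 0") auto
  show "(\<lambda>x. x) \<in> borel_measurable \<nu>"
    unfolding measurable_cong_sets[OF sets refl] by (rule measurable_restrict_space1) simp
  show "sigma_finite_measure \<nu>"
  proof
    show "\<exists>A. countable A \<and> A \<subseteq> sets \<nu> \<and> \<Union>A = space \<nu> \<and> (\<forall>a\<in>A. emeasure \<nu> a \<noteq> \<infinity>)"
    proof (intro exI[of _ "range (\<lambda>n::nat. {0<..<real n + 1})"] conjI ballI)
      show "\<Union> (range (\<lambda>n::nat. {0<..<real n + 1})) = space \<nu>"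
      proof (auto simp: space)
        fix x :: real
        obtain n :: nat where "x < real n" using reals_Archimedean2 by blast
        then show "\<exists>n::nat. x < real n + 1" by (intro exI[of _ n]) simp
      qed
      show "range (\<lambda>n::nat. {0<..<real n + 1}) \<subseteq> sets \<nu>" by (auto intro!: s)
      show "emeasure \<nu> a \<noteq> \<infinity>" if "a \<in> range (\<lambda>n::nat. {0<..<real n + 1})" for a
        using that fin by (auto simp: less_top)
    qed auto
  qed
qed

section \<open>Primitives with respect to dP\<close>

locale signed_half_line =
  fixes \<nu>\<^sub>p \<nu>\<^sub>n :: "real measure"
  assumes signed: "signed_radon_measure \<nu>\<^sub>p \<nu>\<^sub>n"
begin

sublocale L: half_line_radon lborel by (rule half_line_radon_lborel)

sublocale p: half_line_radon \<nu>\<^sub>p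
  using signed by (intro half_line_radonI) (auto simp: signed_radon_measure_def less_top)

sublocale n: half_line_radon \<nu>\<^sub>n
  using signed by (intro half_line_radonI) (auto simp: signed_radon_measure_def less_top)

text \<open>The function vanishing at \<open>0+\<close> whose quasi-derivative is \<open>u\<close>.\<close>

definition dP_distf :: "(real \<Rightarrow> real) \<Rightarrow> real \<Rightarrow> real" where
  "dP_distf u x = L.distf u x + p.distf u x - n.distf u x"

text \<open>The mass of dx + |d\<nu>| on (0,c), which is the constant in the sup-norm bounds for
  \<open>dP_distf\<close>.\<close>

definition dP_variation :: "real \<Rightarrow> real" where
  "dP_variation c = measure lborel {0<..<c} + measure \<nu>\<^sub>p {0<..<c} + measure \<nu>\<^sub>n {0<..<c}"

lemma dP_variation_nonneg: "0 \<le> dP_variation c"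
  by (simp add: dP_variation_def)

lemma dP_distf_add:
  assumes "u \<in> borel_measurable borel" "\<And>x. \<bar>u x\<bar> \<le> B"
    and "v \<in> borel_measurable borel" "\<And>x. \<bar>v x\<bar> \<le> B'"
  shows "dP_distf (\<lambda>x. u x + v x) b = dP_distf u b + dP_distf v b"
  unfolding dP_distf_def L.distf_add[OF assms] p.distf_add[OF assms] n.distf_add[OF assms] by simp

lemma dP_distf_cmult: "dP_distf (\<lambda>x. c * u x) b = c * dP_distf u b"
  unfolding dP_distf_def L.distf_cmult p.distf_cmult n.distf_cmult by (simp add: algebra_simps)

lemma dP_distf_diff:
  assumes "u \<in> borel_measurable borel" "\<And>x. \<bar>u x\<bar> \<le> B"
    and "v \<in> borel_measurable borel" "\<And>x. \<bar>v x\<bar> \<le> B'"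
  shows "dP_distf (\<lambda>x. u x - v x) b = dP_distf u b - dP_distf v b"
proof -
  have "dP_distf (\<lambda>x. u x + (- 1) * v x) b = dP_distf u b + dP_distf (\<lambda>x. (- 1) * v x) b"
  proof (rule dP_distf_add[OF assms(1,2)])
    show "\<bar>(- 1) * v x\<bar> \<le> B'" for x using assms(4)[of x] by simp
  qed (use assms(3) in measurable)
  then show ?thesis unfolding dP_distf_cmult by simp
qed

lemma dP_distf_bound:
  assumes "u \<in> borel_measurable borel" "\<And>x. \<bar>u x\<bar> \<le> B" "x \<le> c"
  shows "\<bar>dP_distf u x\<bar> \<le> B * dP_variation c"
  using L.distf_bound[OF assms] p.distf_bound[OF assms] n.distf_bound[OF assms]
  unfolding dP_distf_def dP_variation_def distrib_left by linarith

lemma dP_distf_const_right: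
  assumes "u \<in> borel_measurable borel" "\<And>x. \<bar>u x\<bar> \<le> B" "0 < b" "b \<le> x"
    and "\<And>t. t \<ge> b \<Longrightarrow> u t = 0"
  shows "dP_distf u x = dP_distf u b"
proof -
  have "L.distf u x = L.distf u b" by (rule L.distf_const_right[OF assms])
  moreover have "p.distf u x = p.distf u b" by (rule p.distf_const_right[OF assms])
  moreover have "n.distf u x = n.distf u b" by (rule n.distf_const_right[OF assms])
  ultimately show ?thesis by (simp only: dP_distf_def)
qed

lemma dP_distf_bound':
  assumes "u \<in> borel_measurable borel" "\<And>x. \<bar>u x\<bar> \<le> B" "0 < b" "\<And>t. t \<ge> b \<Longrightarrow> u t = 0"
  shows "\<bar>dP_distf u x\<bar> \<le> B * dP_variation b"
proof (cases "x \<le> b")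
  case False
  then have "dP_distf u x = dP_distf u b" by (intro dP_distf_const_right[OF assms(1-3) _ assms(4)]) auto
  then show ?thesis using dP_distf_bound[OF assms(1,2) order_refl[of b]] by simp
qed (rule dP_distf_bound[OF assms(1,2)])

lemma dP_distf_zero_left:
  assumes "x \<le> a" "\<And>t. t \<le> a \<Longrightarrow> u t = 0"
  shows "dP_distf u x = 0"
proof -
  have "L.distf u x = 0" by (rule L.distf_zero_left[OF assms])
  moreover have "p.distf u x = 0" by (rule p.distf_zero_left[OF assms])
  moreover have "n.distf u x = 0" by (rule n.distf_zero_left[OF assms])
  ultimately show ?thesis by (simp add: dP_distf_def)
qed

lemma dP_distf_measurable:
  assumes "u \<in> borel_measurable borel"
  shows "dP_distf u \<in> borel_measurable borel"
  unfolding dP_distf_def[abs_def]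
  by (intro borel_measurable_diff borel_measurable_add L.distf_measurable p.distf_measurable
      n.distf_measurable assms)

lemma dP_distf_left_continuous:
  assumes "u \<in> borel_measurable borel" "\<And>x. \<bar>u x\<bar> \<le> B" "x > 0"
  shows "continuous (at_left x) (dP_distf u)"
  unfolding dP_distf_def[abs_def]
  by (intro continuous_intros L.distf_left_continuous[OF assms]
      p.distf_left_continuous[OF assms] n.distf_left_continuous[OF assms])

end

text \<open>Lebesgue measure has no atoms, so continuity is two-sided, which allows the fixed point
  argument to be carried out in the space of bounded continuous functions.\<close>

lemma isCont_lborel_distf:
  fixes w :: "real \<Rightarrow> real" and x :: real
  assumes w: "w \<in> borel_measurable borel" "set_integrable lborel {0<..<x + 1} w"
  shows "isCont (\<lambda>x. LINT t:{0<..<x}|lborel. w t) x"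
  unfolding continuous_at_sequentially
proof (intro allI impI)
  have [measurable]: "w \<in> borel_measurable borel" by fact
  fix S :: "nat \<Rightarrow> real"
  assume S: "S \<longlonglongrightarrow> x"
  obtain N where N: "\<And>n. n \<ge> N \<Longrightarrow> S n < x + 1"
    using order_tendstoD(2)[OF S, of "x + 1"] by (auto simp: eventually_sequentially)
  have "(\<lambda>n. LINT t:{0<..<S (n + N)}|lborel. w t) \<longlonglongrightarrow> (LINT t:{0<..<x}|lborel. w t)"
    unfolding set_lebesgue_integral_def
  proof (rule integral_dominated_convergence)
    show "integrable lborel (\<lambda>t. norm (indicator {0<..<x + 1} t *\<^sub>R w t))"
      using w(2) by (auto simp: set_integrable_def)
    show "AE t in lborel. (\<lambda>n. indicator {0<..<S (n + N)} t *\<^sub>R w t) \<longlonglongrightarrow> indicator {0<..<x} t *\<^sub>R w t"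
      using AE_lborel_singleton[of x]
    proof eventually_elim
      fix t assume t: "t \<noteq> x"
      have S': "(\<lambda>n. S (n + N)) \<longlonglongrightarrow> x" using S by (rule LIMSEQ_ignore_initial_segment)
      have "\<forall>\<^sub>F n in sequentially. indicator {0<..<S (n + N)} t = (indicator {0<..<x} t :: real)"
      proof (cases "t < x")
        case True
        then have "\<forall>\<^sub>F n in sequentially. t < S (n + N)" using S' by (intro order_tendstoD)
        then show ?thesis by (rule eventually_mono) (use True in \<open>auto simp: indicator_def\<close>)
      next
        case False
        then have "\<forall>\<^sub>F n in sequentially. S (n + N) < t" using S' t by (intro order_tendstoD) auto
        then show ?thesis by (rule eventually_mono) (use False in \<open>auto simp: indicator_def\<close>)
      qed
      then have "(\<lambda>n. indicator {0<..<S (n + N)} t :: real) \<longlonglongrightarrow> indicator {0<..<x} t"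
        by (rule tendsto_eventually)
      then show "(\<lambda>n. indicator {0<..<S (n + N)} t *\<^sub>R w t) \<longlonglongrightarrow> indicator {0<..<x} t *\<^sub>R w t"
        by (intro tendsto_scaleR tendsto_const)
    qed
    show "AE t in lborel. norm (indicator {0<..<S (n + N)} t *\<^sub>R w t) \<le> norm (indicator {0<..<x + 1} t *\<^sub>R w t)" for n
      using N[of "n + N"] by (intro AE_I2) (auto simp: indicator_def)
  qed auto
  then show "((\<lambda>x. LINT t:{0<..<x}|lborel. w t) \<circ> S) \<longlonglongrightarrow> (LINT t:{0<..<x}|lborel. w t)"
    unfolding o_def by (rule LIMSEQ_offset)
qed

section \<open>Elements of the domain with prescribed support\<close>

text \<open>Here q is Borel, so that it can be integrated together with Borel functions against
  \<open>lborel\<close> and the parts of \<nu>. The given potential is only Lebesgue measurable and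
  enters later as \<open>q'\<close>, equal to q almost everywhere.\<close>

locale half_line_potential = signed_half_line +
  fixes q :: "real \<Rightarrow> real"
  assumes q_borel [measurable]: "q \<in> borel_measurable borel"
    and q_int: "\<And>c. set_integrable lborel {0<..<c} q"
begin

lemma potential_tail_small:
  fixes \<alpha> \<beta> :: real
  assumes "0 < \<alpha>" "\<rho> > 0"
  obtains k :: nat where
    "(LINT t|lborel. \<bar>if \<alpha> < t \<and> t < \<beta> \<and> \<bar>q t\<bar> > real k then q t else 0\<bar>) < \<rho>"
proof -
  define r where "r = (\<lambda>(k::nat) t. if \<alpha> < t \<and> t < \<beta> \<and> \<bar>q t\<bar> > real k then q t else 0)"
  have "(\<lambda>k. LINT t|lborel. \<bar>r k t\<bar>) \<longlonglongrightarrow> (LINT t|(lborel :: real measure). (0::real))"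
  proof (rule integral_dominated_convergence)
    show "integrable lborel (\<lambda>t. norm (indicator {0<..<\<beta>} t *\<^sub>R q t))"
      using q_int[of \<beta>] by (auto simp: set_integrable_def)
    show "AE t in lborel. (\<lambda>k. \<bar>r k t\<bar>) \<longlonglongrightarrow> 0"
    proof (intro AE_I2 tendsto_eventually)
      fix t
      obtain k0 :: nat where "\<bar>q t\<bar> < real k0" using reals_Archimedean2 by blast
      then show "\<forall>\<^sub>F k in sequentially. \<bar>r k t\<bar> = 0"
        unfolding eventually_sequentially by (intro exI[of _ k0]) (auto simp: r_def)
    qed
    show "AE t in lborel. norm \<bar>r k t\<bar> \<le> norm (indicator {0<..<\<beta>} t *\<^sub>R q t)" for k
      using assms(1) by (intro AE_I2) (auto simp: r_def indicator_def)
  qed (auto simp: r_def)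
  then have "\<forall>\<^sub>F k in sequentially. (LINT t|lborel. \<bar>r k t\<bar>) < \<rho>"
    using assms(2) by (intro order_tendstoD(2)) auto
  then show thesis using that by (auto simp: r_def eventually_sequentially)
qed

text \<open>
  A smooth quasi-derivative \<open>v\<close> does not give an element of the domain, because \<open>q\<close> is only locally
  integrable. It is corrected by absorbing into \<open>\<omega> = u'\<close> the part \<open>r\<close> of \<open>q\<close> exceeding a large
  constant, which is small in \<open>L\<^sup>1\<close>: \<open>u\<close> is the fixed point of the contraction
  \<open>u \<mapsto> v + \<integral>r (\<integral>u dP) dx - c\<^sub>1 w\<^sub>1 - c\<^sub>2 w\<^sub>2\<close>, where \<open>c\<^sub>1, c\<^sub>2\<close> (linear in \<open>u\<close>) restore the two
  boundary conditions \<open>u \<beta> = 0\<close> and \<open>\<integral>u dP = 0\<close>.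
\<close>

lemma domain_perturbation:
  fixes \<alpha> \<beta> :: real and v' w1' w2' :: "real \<Rightarrow> real"
  assumes \<alpha>\<beta>: "0 < \<alpha>" "\<alpha> < \<beta>" and \<eta>: "\<eta> > 0"
    and borel [measurable]: "v' \<in> borel_measurable borel" "w1' \<in> borel_measurable borel"
      "w2' \<in> borel_measurable borel"
    and bnd: "\<And>x. \<bar>v' x\<bar> \<le> B" "\<And>x. \<bar>w1' x\<bar> \<le> B" "\<And>x. \<bar>w2' x\<bar> \<le> B"
    and supp: "\<And>x. x \<notin> {\<alpha><..<\<beta>} \<Longrightarrow> v' x = 0" "\<And>x. x \<notin> {\<alpha><..<\<beta>} \<Longrightarrow> w1' x = 0"
      "\<And>x. x \<notin> {\<alpha><..<\<beta>} \<Longrightarrow> w2' x = 0"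
    and bdry: "L.distf v' \<beta> = 0" "L.distf w1' \<beta> = 1" "L.distf w2' \<beta> = 0"
      "dP_distf (L.distf v') \<beta> = 0" "dP_distf (L.distf w1') \<beta> = 0" "dP_distf (L.distf w2') \<beta> = 1"
  obtains u \<omega> :: "real \<Rightarrow> real" and C where "u = L.distf \<omega>" "\<omega> \<in> borel_measurable borel"
    "integrable lborel \<omega>"
    "\<And>x. x \<notin> {\<alpha><..<\<beta>} \<Longrightarrow> u x = 0 \<and> \<omega> x = 0 \<and> dP_distf u x = 0"
    "\<And>x. \<bar>u x - L.distf v' x\<bar> \<le> \<eta>" "\<And>x. \<bar>dP_distf u x - dP_distf (L.distf v') x\<bar> \<le> \<eta>"
    "\<And>x. \<bar>- \<omega> x + q x * dP_distf u x\<bar> \<le> C"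
proof -
  define N where "N = dP_variation \<beta>"
  have N0: "N \<ge> 0" by (simp add: N_def dP_variation_nonneg)
  have b0: "\<beta> > 0" using \<alpha>\<beta> by simp
  define W where "W = B * \<beta>"
  have B0: "B \<ge> 0" using bnd(1)[of 0] by linarith
  then have W0: "W \<ge> 0" using b0 by (simp add: W_def)
  have Lb: "\<bar>L.distf w x\<bar> \<le> W"
    if w: "w \<in> borel_measurable borel" "\<And>x. \<bar>w x\<bar> \<le> B" "\<And>x. x \<notin> {\<alpha><..<\<beta>} \<Longrightarrow> w x = 0" for w x
  proof (cases "x \<le> \<beta>")
    case True
    then show ?thesis using L.distf_bound[OF w(1,2) True] b0 by (simp add: W_def)
  next
    case False
    then have "L.distf w x = L.distf w \<beta>" using w b0 by (intro L.distf_const_right) auto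
    then show ?thesis using L.distf_bound[OF w(1,2), of \<beta> \<beta>] b0 by (simp add: W_def)
  qed
  define v w1 w2 where "v = L.distf v'" and "w1 = L.distf w1'" and "w2 = L.distf w2'"
  have vb: "\<bar>v x\<bar> \<le> W" "\<bar>w1 x\<bar> \<le> W" "\<bar>w2 x\<bar> \<le> W" for x
    unfolding v_def w1_def w2_def by (intro Lb borel bnd supp, assumption)+
  have cont: "isCont (L.distf w) x" if "w \<in> borel_measurable borel" "\<And>c. set_integrable lborel {0<..<c} w" for w x
    using isCont_lborel_distf[OF that(1,2), of x] unfolding L.distf_def[abs_def] .
  have int': "set_integrable lborel {0<..<c} w" if "w \<in> borel_measurable borel" "\<And>x. \<bar>w x\<bar> \<le> B" for w :: "real \<Rightarrow> real" and c
    using that by (intro L.set_integrable_bounded[where B=B and c=c]) auto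
  have vc: "isCont v x" "isCont w1 x" "isCont w2 x" for x
    unfolding v_def w1_def w2_def by (intro cont int' borel bnd)+
  have [measurable]: "v \<in> borel_measurable borel" "w1 \<in> borel_measurable borel" "w2 \<in> borel_measurable borel"
    unfolding v_def w1_def w2_def by (intro L.distf_measurable borel)+
  \<comment> \<open>Relative to \<rho> times the sup norm of g, the three correction terms
    \<open>G g\<close>, \<open>c1 g * w1\<close>, \<open>c2 g * w2\<close> are bounded by N, N W and
    N N W.\<close>
  define M where "M = N * (1 + W + N * W)"
  have M0: "M \<ge> 0" using N0 W0 by (simp add: M_def)
  \<comment> \<open>The bound 1/2 makes the map a contraction and gives a fixed point of norm at
    most 2 W. The second bound then makes its distance from v, and N times that distance, at most
    \<eta>.\<close>
  define \<kappa> where "\<kappa> = min (1/2) (\<eta> / (2 * (W + 1) * (N + 1)))"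
  have "0 < 2 * (W + 1) * (N + 1)" using W0 N0 by simp
  then have \<kappa>: "\<kappa> > 0" "\<kappa> \<le> 1/2"
    unfolding \<kappa>_def using \<eta> by (simp_all only: min_less_iff_conj divide_pos_pos min.cobounded1)
  have \<kappa>\<eta>: "\<kappa> * (2 * (W + 1) * (N + 1)) \<le> \<eta>"
  proof -
    have "\<kappa> \<le> \<eta> / (2 * (W + 1) * (N + 1))" by (simp add: \<kappa>_def)
    moreover have "2 * (W + 1) * (N + 1) > 0" using W0 N0 by simp
    ultimately show ?thesis by (simp add: pos_le_divide_eq)
  qed
  obtain k :: nat where k: "(LINT t|lborel. \<bar>if \<alpha> < t \<and> t < \<beta> \<and> \<bar>q t\<bar> > real k then q t else 0\<bar>) < \<kappa> / (M + 1)"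
    using potential_tail_small[OF \<alpha>\<beta>(1), of "\<kappa> / (M + 1)" \<beta>] \<kappa>(1) M0 by auto
  define r where "r = (\<lambda>t. if \<alpha> < t \<and> t < \<beta> \<and> \<bar>q t\<bar> > real k then q t else 0)"
  define \<rho> where "\<rho> = (LINT t|lborel. \<bar>r t\<bar>)"
  have [measurable]: "r \<in> borel_measurable borel" by (simp add: r_def)
  have r_int: "integrable lborel r"
  proof (rule Bochner_Integration.integrable_bound)
    show "integrable lborel (\<lambda>t. indicator {0<..<\<beta>} t *\<^sub>R q t)"
      using q_int[of \<beta>] by (simp add: set_integrable_def)
    show "AE x in lborel. norm (r x) \<le> norm (indicator {0<..<\<beta>} x *\<^sub>R q x)"
      using \<alpha>\<beta> by (intro AE_I2) (auto simp: r_def indicator_def)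
  qed simp
  have \<rho>0: "\<rho> \<ge> 0" by (simp add: \<rho>_def)
  have \<rho>M: "\<rho> * M \<le> \<kappa>"
  proof -
    have "\<rho> < \<kappa> / (M + 1)" using k by (simp add: \<rho>_def r_def)
    then have "\<rho> * (M + 1) \<le> \<kappa>" using M0 by (simp add: pos_less_divide_eq)
    moreover have "\<rho> * M \<le> \<rho> * (M + 1)" using \<rho>0 by (intro mult_left_mono) auto
    ultimately show ?thesis by linarith
  qed
  \<comment> \<open>The iteration runs over all bounded continuous functions on the line, so g is
    cut to (\<alpha>,\<beta>) before it is integrated; this bounds F by N times the sup norm. On the
    fixed point, which vanishes outside, the cut has no effect.\<close>
  define E where "E = (\<lambda>(g::real \<Rightarrow> real) t. if \<alpha> < t \<and> t < \<beta> then g t else 0)"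
  have E_meas [measurable]: "E g \<in> borel_measurable borel" if [measurable]: "g \<in> borel_measurable borel" for g
    by (simp add: E_def)
  have E_bnd: "\<bar>E g x\<bar> \<le> D" if "\<And>x. \<bar>g x\<bar> \<le> D" for g D x
    using that[of x] by (auto simp: E_def)
  define F where "F = (\<lambda>g. dP_distf (E g))"
  have F_meas [measurable]: "F g \<in> borel_measurable borel" if [measurable]: "g \<in> borel_measurable borel" for g
    unfolding F_def by (rule dP_distf_measurable) (rule E_meas, rule that)
  have F_bnd: "\<bar>F g x\<bar> \<le> D * N" if "g \<in> borel_measurable borel" "\<And>x. \<bar>g x\<bar> \<le> D" for g D x
    unfolding F_def N_def using that b0 E_bnd[of g D] by (intro dP_distf_bound') (auto simp: E_def)
  have F_diff: "F (\<lambda>x. g x - h x) y = F g y - F h y"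
    if "g \<in> borel_measurable borel" "\<And>x. \<bar>g x\<bar> \<le> D" "h \<in> borel_measurable borel" "\<And>x. \<bar>h x\<bar> \<le> D'" for g h D D' y
  proof -
    have "E (\<lambda>x. g x - h x) = (\<lambda>x. E g x - E h x)" by (auto simp: E_def)
    then show ?thesis
      unfolding F_def
      using dP_distf_diff[OF E_meas[OF that(1)] E_bnd[OF that(2)] E_meas[OF that(3)] E_bnd[OF that(4)]]
      by simp
  qed
  define G where "G = (\<lambda>g. L.distf (\<lambda>t. r t * F g t))"
  have rF_int: "integrable lborel (\<lambda>t. r t * F g t)"
    and rF_bnd: "(LINT t|lborel. \<bar>r t * F g t\<bar>) \<le> \<rho> * (D * N)"
    if g: "g \<in> borel_measurable borel" "\<And>x. \<bar>g x\<bar> \<le> D" for g D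
  proof -
    have [measurable]: "g \<in> borel_measurable borel" by fact
    have le: "\<bar>r t * F g t\<bar> \<le> \<bar>r t\<bar> * (D * N)" for t
      using F_bnd[OF g, of t] by (auto simp: abs_mult intro!: mult_left_mono)
    have i: "integrable lborel (\<lambda>t. \<bar>r t\<bar> * (D * N))" using r_int by auto
    show int: "integrable lborel (\<lambda>t. r t * F g t)"
      by (rule Bochner_Integration.integrable_bound[OF i]) (use le in \<open>auto intro: order_trans[OF _ abs_ge_self]\<close>)
    have "(LINT t|lborel. \<bar>r t * F g t\<bar>) \<le> (LINT t|lborel. \<bar>r t\<bar> * (D * N))"
      using int i le by (intro integral_mono) auto
    then show "(LINT t|lborel. \<bar>r t * F g t\<bar>) \<le> \<rho> * (D * N)" by (simp add: \<rho>_def)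
  qed
  have set_int: "set_integrable lborel {0<..<c} w" if "integrable lborel w" for w :: "real \<Rightarrow> real" and c
    unfolding set_integrable_def by (rule integrable_mult_indicator) (use that in auto)
  have G_cont: "isCont (G g) x" if g: "g \<in> borel_measurable borel" "\<And>x. \<bar>g x\<bar> \<le> D" for g D x
    unfolding G_def using rF_int[OF g] g(1) by (intro cont set_int) auto
  have G_meas [measurable]: "G g \<in> borel_measurable borel" if [measurable]: "g \<in> borel_measurable borel" for g
    unfolding G_def by (rule L.distf_measurable) measurable
  have G_bnd: "\<bar>G g x\<bar> \<le> \<rho> * (D * N)" if g: "g \<in> borel_measurable borel" "\<And>x. \<bar>g x\<bar> \<le> D" for g D x
  proof -
    have "\<bar>G g x\<bar> \<le> (LINT t|lborel. \<bar>indicator {0<..<x} t *\<^sub>R (r t * F g t)\<bar>)"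
      unfolding G_def L.distf_def set_lebesgue_integral_def by (rule integral_abs_bound)
    also have "\<dots> \<le> (LINT t|lborel. \<bar>r t * F g t\<bar>)"
      using set_int[OF rF_int[OF g], of x] rF_int[OF g]
      by (intro integral_mono) (auto simp: set_integrable_def indicator_def)
    finally show ?thesis using rF_bnd[OF g] by linarith
  qed
  have G_diff: "G (\<lambda>x. g x - h x) y = G g y - G h y"
    if g: "g \<in> borel_measurable borel" "\<And>x. \<bar>g x\<bar> \<le> D" and h: "h \<in> borel_measurable borel" "\<And>x. \<bar>h x\<bar> \<le> D'" for g h D D' y
    unfolding G_def L.distf_def
    using set_int[OF rF_int[OF g], of y] set_int[OF rF_int[OF h], of y]
    by (simp add: F_diff[OF g h] right_diff_distrib set_integral_diff)
  \<comment> \<open>\<open>c1\<close> and \<open>c2\<close> are the defects of \<open>G g\<close> in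
    the two conditions at \<beta>: its value there and the dP-integral of its cut.\<close>
  define c1 where "c1 = (\<lambda>g. G g \<beta>)"
  define c2 where "c2 = (\<lambda>g. F (G g) \<beta>)"
  define \<phi> where "\<phi> = (\<lambda>g x. v x + G g x - c1 g * w1 x - c2 g * w2 x)"
  have c2_diff: "c2 (\<lambda>x. g x - h x) = c2 g - c2 h"
    if g: "g \<in> borel_measurable borel" "\<And>x. \<bar>g x\<bar> \<le> D" and h: "h \<in> borel_measurable borel" "\<And>x. \<bar>h x\<bar> \<le> D'" for g h D D'
  proof -
    have "G (\<lambda>x. g x - h x) = (\<lambda>x. G g x - G h x)" by (rule ext) (rule G_diff[OF g h])
    then show ?thesis
      unfolding c2_def using F_diff[OF G_meas[OF g(1)] G_bnd[OF g] G_meas[OF h(1)] G_bnd[OF h]] by simp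
  qed
  have lin_bnd: "\<bar>G g x - c1 g * w1 x - c2 g * w2 x\<bar> \<le> \<kappa> * D"
    if g: "g \<in> borel_measurable borel" "\<And>x. \<bar>g x\<bar> \<le> D" for g D x
  proof -
    have D0: "D \<ge> 0" using g(2)[of 0] by linarith
    have a: "\<bar>G g x\<bar> \<le> \<rho> * (D * N)" by (rule G_bnd[OF g])
    have "\<bar>c1 g * w1 x\<bar> \<le> (\<rho> * (D * N)) * W"
      unfolding abs_mult c1_def using D0 \<rho>0 N0 by (intro mult_mono G_bnd[OF g] vb) auto
    moreover have "\<bar>c2 g * w2 x\<bar> \<le> (\<rho> * (D * N) * N) * W"
      unfolding abs_mult c2_def using D0 \<rho>0 N0
      by (intro mult_mono F_bnd[OF G_meas[OF g(1)] G_bnd[OF g]] vb) auto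
    ultimately have "\<bar>G g x - c1 g * w1 x - c2 g * w2 x\<bar> \<le> \<rho> * (D * N) + (\<rho> * (D * N)) * W + (\<rho> * (D * N) * N) * W"
      using a by linarith
    also have "\<dots> = (\<rho> * M) * D" by (simp add: M_def algebra_simps)
    also have "\<dots> \<le> \<kappa> * D" by (intro mult_right_mono \<rho>M D0)
    finally show ?thesis .
  qed
  have \<phi>_diff: "\<bar>\<phi> g x - \<phi> h x\<bar> \<le> \<kappa> * D"
    if g: "g \<in> borel_measurable borel" "\<And>x. \<bar>g x\<bar> \<le> D1" and h: "h \<in> borel_measurable borel" "\<And>x. \<bar>h x\<bar> \<le> D2"
      and gh: "\<And>x. \<bar>g x - h x\<bar> \<le> D" for g h D D1 D2 x
  proof -
    have "\<phi> g x - \<phi> h x = G (\<lambda>x. g x - h x) x - c1 (\<lambda>x. g x - h x) * w1 x - c2 (\<lambda>x. g x - h x) * w2 x"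
      unfolding \<phi>_def c2_diff[OF g h] c1_def G_diff[OF g h] by (simp add: algebra_simps)
    then show ?thesis using lin_bnd[of "\<lambda>x. g x - h x" D x] g(1) h(1) gh by simp
  qed
  have bc: "apply_bcontfun y \<in> borel_measurable borel" "\<bar>apply_bcontfun y x\<bar> \<le> norm y" for y :: "real \<Rightarrow>\<^sub>C real" and x
    using norm_bounded[of y x] by (auto intro!: borel_measurable_continuous_onI continuous_on_apply_bcontfun)
  have \<phi>_bcont: "\<phi> (apply_bcontfun y) \<in> bcontfun" for y :: "real \<Rightarrow>\<^sub>C real"
  proof (rule bcontfun_normI)
    show "continuous_on UNIV (\<phi> (apply_bcontfun y))"
      unfolding \<phi>_def continuous_on_eq_continuous_at[OF open_UNIV]
      by (intro ballI continuous_intros vc G_cont[OF bc])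
    fix x
    show "norm (\<phi> (apply_bcontfun y) x) \<le> W + \<kappa> * norm y"
      using lin_bnd[OF bc, of y x] vb(1)[of x] unfolding \<phi>_def real_norm_def by linarith
  qed
  define \<Phi> where "\<Phi> = (\<lambda>y. Bcontfun (\<phi> (apply_bcontfun y)))"
  have \<Phi>: "apply_bcontfun (\<Phi> y) x = \<phi> (apply_bcontfun y) x" for y x
    using \<phi>_bcont[of y] by (simp add: \<Phi>_def Bcontfun_inverse)
  have "\<exists>!y. \<Phi> y = y"
  proof (rule banach_fix_type)
    show "0 \<le> \<kappa>" "\<kappa> < 1" using \<kappa> by auto
    show "\<forall>x y. dist (\<Phi> x) (\<Phi> y) \<le> \<kappa> * dist x y"
    proof (intro allI dist_bound)
      fix y z t
      show "dist (apply_bcontfun (\<Phi> y) t) (apply_bcontfun (\<Phi> z) t) \<le> \<kappa> * dist y z"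
        unfolding \<Phi> dist_real_def
        by (rule \<phi>_diff[OF bc bc]) (use dist_bounded[of y _ z] in \<open>simp add: dist_real_def\<close>)
    qed
  qed
  then obtain y where y: "\<Phi> y = y" by blast
  define u where "u = apply_bcontfun y"
  have u_meas [measurable]: "u \<in> borel_measurable borel" unfolding u_def by (rule bc)
  have u_fix: "u x = v x + G u x - c1 u * w1 x - c2 u * w2 x" for x
    using \<Phi>[of y x] unfolding y u_def \<phi>_def .
  define D where "D = norm y"
  have uD: "\<bar>u x\<bar> \<le> D" for x unfolding u_def D_def by (rule bc)
  have uv: "\<bar>u x - v x\<bar> \<le> \<kappa> * D" for x
    using lin_bnd[OF u_meas uD, of x] by (simp add: u_fix[of x] algebra_simps)
  have "D \<le> W + \<kappa> * D"
    unfolding D_def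
  proof (rule norm_bound)
    show "norm (apply_bcontfun y x) \<le> W + \<kappa> * norm y" for x
      using uv[of x] vb(1)[of x] unfolding u_def D_def real_norm_def by linarith
  qed
  moreover have "\<kappa> * D \<le> 1/2 * D" using \<kappa>(2) by (intro mult_right_mono) (auto simp: D_def)
  ultimately have D2: "D \<le> 2 * W" by linarith
  have \<kappa>D: "\<kappa> * D \<le> \<eta>" "\<kappa> * D * N \<le> \<eta>"
  proof -
    have "\<kappa> * D * (N + 1) \<le> \<kappa> * (2 * (W + 1)) * (N + 1)"
      using \<kappa>(1) N0 D2 by (intro mult_right_mono mult_left_mono) auto
    also have "\<dots> \<le> \<eta>" using \<kappa>\<eta> by (simp add: mult_ac)
    finally have *: "\<kappa> * D * N + \<kappa> * D \<le> \<eta>" by (simp add: algebra_simps)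
    have "\<kappa> * D \<ge> 0" using \<kappa>(1) by (simp add: D_def)
    moreover from this have "\<kappa> * D * N \<ge> 0" using N0 by simp
    ultimately show "\<kappa> * D \<le> \<eta>" "\<kappa> * D * N \<le> \<eta>" using * by linarith+
  qed
  have w_right: "L.distf w x = L.distf w \<beta>" if "w \<in> borel_measurable borel" "\<And>x. \<bar>w x\<bar> \<le> B"
    "\<And>x. x \<notin> {\<alpha><..<\<beta>} \<Longrightarrow> w x = 0" "x \<ge> \<beta>" for w x
    using that b0 by (intro L.distf_const_right) auto
  have w_left: "L.distf w x = 0" if "\<And>x. x \<notin> {\<alpha><..<\<beta>} \<Longrightarrow> w x = 0" "x \<le> \<alpha>" for w x
    using that \<alpha>\<beta> by (intro L.distf_zero_left[of x \<alpha>]) auto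
  have G_left: "G g x = 0" if "x \<le> \<alpha>" for g x
    unfolding G_def using that by (intro L.distf_zero_left[of x \<alpha>]) (auto simp: r_def)
  have G_right: "G u x = G u \<beta>" if "x \<ge> \<beta>" for x
    unfolding G_def L.distf_def set_lebesgue_integral_def using that
    by (intro Bochner_Integration.integral_cong) (auto simp: r_def indicator_def)
  \<comment> \<open>Left of \<alpha> every term vanishes. From \<beta> on, v and w2 are 0, w1 is 1,
    and \<open>G u\<close> has the constant value \<open>c1 u\<close>, which the term with w1
    removes.\<close>
  have u0: "u x = 0" if "x \<notin> {\<alpha><..<\<beta>}" for x
  proof (cases "x \<le> \<alpha>")
    case True
    then show ?thesis
      using u_fix[of x] w_left[OF supp(1) True] w_left[OF supp(2) True] w_left[OF supp(3) True] G_left[OF True, of u]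
      by (simp add: v_def w1_def w2_def)
  next
    case False
    then have x: "x \<ge> \<beta>" using that by auto
    have "v x = 0" "w1 x = 1" "w2 x = 0"
      unfolding v_def w1_def w2_def
      using w_right[OF borel(1) bnd(1) supp(1) x] w_right[OF borel(2) bnd(2) supp(2) x]
        w_right[OF borel(3) bnd(3) supp(3) x] bdry(1-3) by auto
    then show ?thesis using u_fix[of x] G_right[OF x] by (simp add: c1_def)
  qed
  have Eu: "E u = u" using u0 by (auto simp: E_def fun_eq_iff)
  then have Fu: "F u = dP_distf u" by (simp add: F_def)
  have Pu\<beta>: "dP_distf u \<beta> = 0"
  proof -
    \<comment> \<open>\<open>G u\<close> already vanishes left of \<alpha>, so up to \<beta> the cut
      in the definition of \<open>c2\<close> is invisible, and the term with w2 cancels the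
      dP-integral of \<open>G u\<close> exactly.\<close>
    have "E (G u) t = G u t" if "t < \<beta>" for t
      using that G_left[of t u] by (auto simp: E_def)
    then have "F (G u) \<beta> = dP_distf (G u) \<beta>"
      unfolding F_def dP_distf_def L.distf_def p.distf_def n.distf_def
      by (auto intro!: set_lebesgue_integral_cong arg_cong2[where f="(+)"] arg_cong2[where f="(-)"]
          p.sets_half_line n.sets_half_line)
    then have c2: "dP_distf (G u) \<beta> = c2 u" by (simp add: c2_def)
    have ueq: "u = (\<lambda>x. ((v x + G u x) - c1 u * w1 x) - c2 u * w2 x)" using u_fix by auto
    have Gb: "\<bar>G u x\<bar> \<le> \<rho> * (D * N)" for x by (rule G_bnd[OF u_meas uD])
    have b1: "\<bar>v x + G u x\<bar> \<le> W + \<rho> * (D * N)" for x using Gb[of x] vb(1)[of x] by linarith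
    have b2: "\<bar>c1 u * w1 x\<bar> \<le> \<bar>c1 u\<bar> * W" "\<bar>c2 u * w2 x\<bar> \<le> \<bar>c2 u\<bar> * W" for x
      unfolding abs_mult by (intro mult_left_mono vb; simp)+
    have b3: "\<bar>(v x + G u x) - c1 u * w1 x\<bar> \<le> W + \<rho> * (D * N) + \<bar>c1 u\<bar> * W" for x
      using b1[of x] b2(1)[of x] by linarith
    have "dP_distf u \<beta> = ((dP_distf v \<beta> + dP_distf (G u) \<beta>) - c1 u * dP_distf w1 \<beta>) - c2 u * dP_distf w2 \<beta>"
      by (subst ueq, subst dP_distf_diff[OF _ b3 _ b2(2)], simp, simp,
          subst dP_distf_diff[OF _ b1 _ b2(1)], simp, simp,
          subst dP_distf_add[OF _ vb(1) _ Gb], simp, simp, simp add: dP_distf_cmult)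
    then show ?thesis using bdry(4-6) c2 by (simp add: v_def w1_def w2_def)
  qed
  have Pu0: "dP_distf u x = 0" if "x \<notin> {\<alpha><..<\<beta>}" for x
  proof (cases "x \<le> \<alpha>")
    case True
    then show ?thesis using u0 by (intro dP_distf_zero_left[of x \<alpha>]) auto
  next
    case False
    then have "dP_distf u x = dP_distf u \<beta>"
      using that b0 u0 by (intro dP_distf_const_right[OF u_meas uD]) auto
    then show ?thesis using Pu\<beta> by simp
  qed
  \<comment> \<open>The fixed point equation with each term replaced by its density.\<close>
  define \<omega> where "\<omega> = (\<lambda>x. v' x + r x * F u x - c1 u * w1' x - c2 u * w2' x)"
  have [measurable]: "\<omega> \<in> borel_measurable borel" by (simp add: \<omega>_def)
  have intw: "integrable lborel w" if "w \<in> borel_measurable borel" "\<And>x. \<bar>w x\<bar> \<le> B" "\<And>x. x \<notin> {\<alpha><..<\<beta>} \<Longrightarrow> w x = 0" for w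
  proof -
    have "integrable lborel (\<lambda>x. indicator {0<..<\<beta>} x *\<^sub>R w x)"
      using int'[OF that(1,2), of \<beta>] by (simp add: set_integrable_def)
    moreover have "indicator {0<..<\<beta>} x *\<^sub>R w x = w x" for x
      using that(3)[of x] \<alpha>\<beta> by (cases "x \<in> {\<alpha><..<\<beta>}") (auto simp: indicator_def)
    ultimately show ?thesis by (simp only:)
  qed
  have ints: "integrable lborel v'" "integrable lborel w1'" "integrable lborel w2'" "integrable lborel (\<lambda>t. r t * F u t)"
    using rF_int[OF u_meas uD] by (auto intro!: intw borel bnd supp)
  have \<omega>_int: "integrable lborel \<omega>" unfolding \<omega>_def using ints by auto
  have u\<omega>: "u = L.distf \<omega>"
  proof
    fix x
    have "L.distf \<omega> x = L.distf v' x + G u x - c1 u * L.distf w1' x - c2 u * L.distf w2' x"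
      unfolding G_def L.distf_def \<omega>_def
      using ints[THEN set_int, of x] by (simp add: set_integral_add set_integral_diff)
    then show "u x = L.distf \<omega> x" using u_fix[of x] by (simp add: v_def w1_def w2_def)
  qed
  have \<omega>0: "\<omega> x = 0" if "x \<notin> {\<alpha><..<\<beta>}" for x
    using that supp[OF that] by (auto simp: \<omega>_def r_def)
  have Puv: "\<bar>dP_distf u x - dP_distf v x\<bar> \<le> \<eta>" for x
  proof -
    have "dP_distf u x - dP_distf v x = dP_distf (\<lambda>x. u x - v x) x"
      by (rule dP_distf_diff[symmetric, OF u_meas uD _ vb(1)]) simp
    also have "\<bar>\<dots>\<bar> \<le> \<kappa> * D * N"
      unfolding N_def
    proof (rule dP_distf_bound'[OF _ uv b0])
      fix t assume "t \<ge> \<beta>"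
      then show "u t - v t = 0"
        using u0[of t] w_right[OF borel(1) bnd(1) supp(1), of t] bdry(1) by (simp add: v_def)
    qed simp
    finally show ?thesis using \<kappa>D by linarith
  qed
  \<comment> \<open>In -\<omega> + q f the unbounded product r f cancels. What remains of the
    potential is (q - r) f, where |q - r| \<le> k on (\<alpha>,\<beta>) and f vanishes
    elsewhere.\<close>
  define C where "C = B + \<bar>c1 u\<bar> * B + \<bar>c2 u\<bar> * B + real k * (D * N)"
  have Cb: "\<bar>- \<omega> x + q x * dP_distf u x\<bar> \<le> C" for x
  proof -
    have eq: "- \<omega> x + q x * dP_distf u x = - v' x + c1 u * w1' x + c2 u * w2' x + (q x - r x) * F u x"
      by (simp add: \<omega>_def Fu algebra_simps)
    have "\<bar>(q x - r x) * F u x\<bar> \<le> real k * (D * N)"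
    proof (cases "x \<in> {\<alpha><..<\<beta>}")
      case True
      then have "\<bar>q x - r x\<bar> \<le> real k" by (auto simp: r_def)
      then show ?thesis unfolding abs_mult using F_bnd[OF u_meas uD, of x] by (intro mult_mono) auto
    next
      case False
      then show ?thesis using Pu0[OF False] N0 by (simp add: Fu D_def)
    qed
    moreover have "\<bar>c1 u * w1' x\<bar> \<le> \<bar>c1 u\<bar> * B" "\<bar>c2 u * w2' x\<bar> \<le> \<bar>c2 u\<bar> * B"
      unfolding abs_mult by (intro mult_left_mono bnd; simp)+
    ultimately show ?thesis unfolding eq C_def using bnd(1)[of x] by linarith
  qed
  show thesis
  proof (rule that[OF u\<omega> _ \<omega>_int])
    show "\<bar>u x - L.distf v' x\<bar> \<le> \<eta>" for x using uv[of x] \<kappa>D by (simp add: v_def)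
    show "\<bar>dP_distf u x - dP_distf (L.distf v') x\<bar> \<le> \<eta>" for x using Puv by (simp add: v_def)
  qed (use u0 \<omega>0 Pu0 Cb in auto)
qed

end


section \<open>Real functions of bounded support as elements of the operator domain\<close>

abbreviation cplx :: "(real \<Rightarrow> real) \<Rightarrow> real \<Rightarrow> complex" where
  "cplx g \<equiv> \<lambda>x. complex_of_real (g x)"

lemma borel_measurable_half_line_lebesgue:
  "g \<in> borel_measurable borel \<Longrightarrow> g \<in> borel_measurable half_line"
  by (intro measurable_restrict_space1 measurable_completion) simp

lemma integral_half_line_borel:
  fixes g :: "real \<Rightarrow> real"
  assumes [measurable]: "g \<in> borel_measurable borel" and 0: "\<And>x. x \<notin> {0<..<\<beta>} \<Longrightarrow> g x = 0"
  shows "(LINT x|half_line. g x) = (LINT x:{0<..<\<beta>}|lborel. g x)"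
proof -
  have "(LINT x|half_line. g x) = (LINT x|lebesgue. indicator {0<..} x *\<^sub>R g x)"
    by (rule integral_restrict_space) simp
  also have "\<dots> = (LINT x|lborel. indicator {0<..} x *\<^sub>R g x)"
    by (rule integral_completion) simp
  also have "\<dots> = (LINT x:{0<..<\<beta>}|lborel. g x)"
    unfolding set_lebesgue_integral_def using 0
    by (intro Bochner_Integration.integral_cong refl) (auto simp: indicator_def)
  finally show ?thesis .
qed

lemma L2_bounded_support:
  fixes g :: "real \<Rightarrow> real"
  assumes [measurable]: "g \<in> borel_measurable borel" and b: "\<And>x. \<bar>g x\<bar> \<le> C"
    and 0: "\<And>x. x \<notin> {0<..<\<beta>} \<Longrightarrow> g x = 0"
  shows "(cplx g) \<in> L2"
proof -
  have "integrable lborel (\<lambda>x. indicator {0<..} x *\<^sub>R (cmod (complex_of_real (g x)))\<^sup>2)"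
  proof (rule Bochner_Integration.integrable_bound)
    show "integrable lborel (\<lambda>x. indicator {0<..<\<beta>} x *\<^sub>R C\<^sup>2)"
      by (cases "\<beta> > 0") (auto intro!: integrable_scaleR_left integrable_real_indicator)
    have "(g x)\<^sup>2 \<le> C\<^sup>2" for x using b[of x] by (metis abs_ge_zero power2_abs power_mono)
    then show "AE x in lborel. norm (indicator {0<..} x *\<^sub>R (cmod (complex_of_real (g x)))\<^sup>2)
        \<le> norm (indicator {0<..<\<beta>} x *\<^sub>R C\<^sup>2)"
      using 0 by (intro AE_I2) (auto simp: indicator_def)
  qed simp
  then have "integrable lebesgue (\<lambda>x. indicator {0<..} x *\<^sub>R (cmod (complex_of_real (g x)))\<^sup>2)"
    by (subst integrable_completion) auto
  then have "integrable half_line (\<lambda>x. (cmod (complex_of_real (g x)))\<^sup>2)"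
    by (subst integrable_restrict_space) auto
  then show ?thesis
    unfolding L2_def by (auto intro!: borel_measurable_half_line_lebesgue)
qed

text \<open>The right-hand side is an increment of the nondecreasing function x \<mapsto> B
  \<mu>(0,x), so along a partition the bounds telescope.\<close>

lemma (in half_line_radon) distf_variation:
  assumes u: "u \<in> borel_measurable borel" "\<And>x. \<bar>u x\<bar> \<le> B" and ab: "0 < a" "a \<le> b"
  shows "\<bar>distf u b - distf u a\<bar> \<le> B * measure \<mu> {0<..<b} - B * measure \<mu> {0<..<a}"
proof -
  have one: "distf (\<lambda>_. 1) x = measure \<mu> {0<..<x}" for x
  proof -
    have "{0<..<x} \<in> sets \<mu>" by (rule sets_half_line) auto
    then show ?thesis
      using finite_interval[of x]
      by (simp add: distf_def set_lebesgue_integral_def sets.Int_space_eq2)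
  qed
  have "measure \<mu> {a..<b} = (LINT t:{a..<b}|\<mu>. 1)"
  proof -
    have "{a..<b} \<in> sets \<mu>" using ab by (intro sets_half_line) auto
    then show ?thesis by (simp add: set_lebesgue_integral_def sets.Int_space_eq2)
  qed
  also have "\<dots> = measure \<mu> {0<..<b} - measure \<mu> {0<..<a}"
    using distf_diff[of "\<lambda>_. 1" 1 a b] ab by (simp add: one)
  finally have m: "measure \<mu> {a..<b} = measure \<mu> {0<..<b} - measure \<mu> {0<..<a}" .
  have "\<bar>distf u b - distf u a\<bar> \<le> B * measure \<mu> {a..<b}"
    unfolding distf_diff[OF u ab] by (rule set_integral_bound[OF u, of _ b]) (use ab in auto)
  then show ?thesis by (simp add: m right_diff_distrib)
qed

context signed_half_line
begin

lemma has_quasi_derivative_dP_distf: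
  assumes u: "u \<in> borel_measurable borel" "\<And>x. \<bar>u x\<bar> \<le> B"
  shows "has_quasi_derivative \<nu>\<^sub>p \<nu>\<^sub>n (cplx (dP_distf u)) (cplx u)"
  unfolding has_quasi_derivative_def
proof (intro conjI allI impI)
  have B0: "B \<ge> 0" using u(2)[of 0] by linarith
  show "locally_bounded_variation (cplx (dP_distf u))"
    unfolding locally_bounded_variation_def
  proof (intro allI impI)
    fix c :: real assume "c > 0"
    define V where "V = (\<lambda>x. B * dP_variation x)"
    have V: "\<bar>dP_distf u b - dP_distf u a\<bar> \<le> V b - V a" if "0 < a" "a \<le> b" for a b
      using L.distf_variation[OF u that] p.distf_variation[OF u that] n.distf_variation[OF u that]
      unfolding dP_distf_def V_def dP_variation_def distrib_left by linarith
    show "\<exists>B. \<forall>n x. mono_on {..n} x \<and> x ` {..n} \<subseteq> {0<..<c} \<longrightarrow>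
        (\<Sum>i<n. cmod (complex_of_real (dP_distf u (x (Suc i))) - complex_of_real (dP_distf u (x i)))) \<le> B"
    proof (intro exI[of _ "V c"] allI impI)
      fix n :: nat and x :: "nat \<Rightarrow> real"
      assume x: "mono_on {..n} x \<and> x ` {..n} \<subseteq> {0<..<c}"
      have le: "x i \<le> x (Suc i)" "0 < x i" if "i < n" for i
        using x that by (auto simp: mono_on_def image_subset_iff)
      have "(\<Sum>i<n. cmod (complex_of_real (dP_distf u (x (Suc i))) - complex_of_real (dP_distf u (x i))))
          \<le> (\<Sum>i<n. V (x (Suc i)) - V (x i))"
      proof (intro sum_mono)
        fix i assume i: "i \<in> {..<n}"
        have "cmod (complex_of_real (dP_distf u (x (Suc i))) - complex_of_real (dP_distf u (x i)))
            = \<bar>dP_distf u (x (Suc i)) - dP_distf u (x i)\<bar>"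
          by (simp flip: of_real_diff)
        also have "\<dots> \<le> V (x (Suc i)) - V (x i)" using le i by (intro V) auto
        finally show "cmod (complex_of_real (dP_distf u (x (Suc i))) - complex_of_real (dP_distf u (x i)))
            \<le> V (x (Suc i)) - V (x i)" .
      qed
      also have "\<dots> = V (x n) - V (x 0)" by (rule sum_lessThan_telescope)
      also have "\<dots> \<le> V (x n)" using B0 by (simp add: V_def dP_variation_nonneg)
      also have "\<dots> \<le> V c"
      proof -
        have "0 < x n" "x n \<le> c" using x by (auto simp: image_subset_iff less_imp_le)
        from V[OF this] show ?thesis by linarith
      qed
      finally show "(\<Sum>i<n. cmod (complex_of_real (dP_distf u (x (Suc i))) - complex_of_real (dP_distf u (x i)))) \<le> V c" .
    qed
  qed
  show "continuous (at_left x) (cplx (dP_distf u))" if "0 < x" for x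
    by (intro continuous_of_real dP_distf_left_continuous[OF u that])
  have cu: "(cplx u) \<in> borel_measurable borel" using u(1) by measurable
  have cb: "norm (complex_of_real (u x)) \<le> B" for x using u(2)[of x] by simp
  show "locally_integrable_dP \<nu>\<^sub>p \<nu>\<^sub>n (cplx u)"
    unfolding locally_integrable_dP_def
  proof (intro allI impI conjI)
    fix c :: real
    show "set_integrable lborel {0<..<c} (cplx u)"
      by (rule L.set_integrable_bounded[OF cu cb]) auto
    show "set_integrable \<nu>\<^sub>p {0<..<c} (cplx u)"
      by (rule p.set_integrable_bounded[OF cu cb]) auto
    show "set_integrable \<nu>\<^sub>n {0<..<c} (cplx u)"
      by (rule n.set_integrable_bounded[OF cu cb]) auto
  qed
  fix a b :: real assume ab: "0 < a \<and> a < b"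
  then have ab': "0 < a" "a \<le> b" by auto
  have "dP_distf u b - dP_distf u a
      = (LINT x:{a..<b}|lborel. u x) + (LINT x:{a..<b}|\<nu>\<^sub>p. u x) - (LINT x:{a..<b}|\<nu>\<^sub>n. u x)"
    using L.distf_diff[OF u ab'] p.distf_diff[OF u ab'] n.distf_diff[OF u ab']
    unfolding dP_distf_def by linarith
  then show "complex_of_real (dP_distf u b) - complex_of_real (dP_distf u a)
      = integral_dP \<nu>\<^sub>p \<nu>\<^sub>n {a..<b} (cplx u)"
    unfolding integral_dP_def set_integral_complex_of_real by (simp flip: of_real_diff of_real_add)
qed

text \<open>U has full measure in (a,b), so a compact subset K0 of U misses less than a quarter of
  it. Averaging the indicator of a closed neighbourhood of K0 gives a Lipschitz function equal to 1
  on K0 and 0 off U. It is returned through its bounded derivative \<open>m'\<close>, the form in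
  which \<open>domain_perturbation\<close> takes its data.\<close>

lemma bump_avoiding_null_set:
  assumes ab: "0 < a" "a < b" and U: "open U" "U \<subseteq> {a<..<b}" "{a<..<b} - U \<in> null_sets lebesgue"
  obtains m' B where "m' \<in> borel_measurable borel" "\<And>x. \<bar>m' x\<bar> \<le> B"
    "\<And>x. x \<notin> U \<Longrightarrow> m' x = 0" "\<And>x. 0 \<le> L.distf m' x" "\<And>x. L.distf m' x \<le> 1"
    "\<And>x. x \<notin> U \<Longrightarrow> L.distf m' x = 0"
    "3/4 * (b - a) \<le> L.distf (L.distf m') b" "L.distf (L.distf m') b \<le> b - a"
proof -
  have Ul: "U \<in> sets lebesgue" using U(1) by simp
  obtain K0 where K0: "closed K0" "K0 \<subseteq> U" "U - K0 \<in> lmeasurable"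
    "emeasure lebesgue (U - K0) < ennreal ((b - a) / 4)"
    using sets_lebesgue_inner_closed[OF Ul, of "(b - a) / 4"] ab by auto
  have bddK0: "bounded K0" using K0(2) U(2) bounded_subset[of "{a<..<b}" K0] by auto
  then have cK0: "compact K0" using K0(1) by (simp add: compact_eq_bounded_closed)
  have mK0: "3/4 * (b - a) \<le> measure lborel K0"
  proof -
    have lm: "K0 \<in> lmeasurable" using cK0 by (rule lmeasurable_compact)
    have "{a<..<b} \<subseteq> (K0 \<union> (U - K0)) \<union> ({a<..<b} - U)" by auto
    then have "measure lebesgue {a<..<b} \<le> measure lebesgue ((K0 \<union> (U - K0)) \<union> ({a<..<b} - U))"
      using lm K0(3) fmeasurableI_null_sets[OF U(3)]
      by (intro measure_mono_fmeasurable fmeasurable.Un) auto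
    also have "\<dots> \<le> measure lebesgue (K0 \<union> (U - K0)) + measure lebesgue ({a<..<b} - U)"
      using lm K0(3) U(3) Ul by (intro measure_Un_le sets.Un) auto
    also have "measure lebesgue ({a<..<b} - U) = 0" using U(3) by (simp add: measure_eq_0_null_sets)
    also have "measure lebesgue (K0 \<union> (U - K0)) \<le> measure lebesgue K0 + measure lebesgue (U - K0)"
      using lm K0(3) by (intro measure_Un_le) auto
    finally have "b - a \<le> measure lebesgue K0 + measure lebesgue (U - K0)" using ab by simp
    moreover have "measure lebesgue (U - K0) \<le> (b - a) / 4"
      using K0(3,4) ab by (simp add: emeasure_eq_measure2 ennreal_less_iff)
    moreover have "measure lebesgue K0 = measure lborel K0" using K0(1) by simp
    ultimately show ?thesis by simp
  qed
  then have ne: "K0 \<noteq> {}" using ab by auto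
  obtain e where e: "e > 0" "(\<Union>x\<in>K0. ball x e) \<subseteq> U"
    using compact_subset_open_imp_ball_epsilon_subset[OF cK0 U(1) K0(2)] by blast
  \<comment> \<open>One h is spent on enlarging K0 to K and one on the averaging window; points
    within 2 h < e of K0 are still in U.\<close>
  define h where "h = e / 3"
  have h: "h > 0" using e by (simp add: h_def)
  have near: "t \<in> U" if "infdist t K0 \<le> 2 * h" for t
  proof -
    obtain y where y: "y \<in> K0" "infdist t K0 = dist t y"
      using infdist_attains_inf[OF K0(1) ne] by blast
    then have "t \<in> ball y e" using that e(1) by (simp add: h_def dist_commute)
    then show ?thesis using e(2) y(1) by blast
  qed
  \<comment> \<open>The bump is the average of the indicator of \<open>K\<close> over \<open>[x, x + h)\<close>.\<close>
  define K where "K = {t. infdist t K0 \<le> h}"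
  have Kcl: "closed K" unfolding K_def by (intro closed_Collect_le continuous_intros)
  then have [measurable]: "K \<in> sets borel" by simp
  have inf_shift: "infdist x K0 \<le> infdist t K0 + \<bar>x - t\<bar>" for x t
    using infdist_triangle[of x K0 t] by (simp add: dist_real_def)
  have K_shift: "x \<in> U" if "t \<in> K" "x \<le> t" "t \<le> x + h" for x t
    using inf_shift[of x t] that by (intro near) (auto simp: K_def)
  have KU: "K \<subseteq> U" using K_shift h by fastforce
  have Kpos: "t > a" "t < b" if "t \<in> K" for t using KU U(2) that by auto
  have Kfin: "emeasure lborel (K \<inter> A) < \<infinity>" for A
  proof -
    have "K \<inter> A \<subseteq> {a<..<b}" using KU U(2) by blast
    then have "emeasure lborel (K \<inter> A) \<le> emeasure lborel {a<..<b}" by (intro emeasure_mono) auto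
    also have "\<dots> < \<infinity>" using ab by simp
    finally show ?thesis .
  qed
  \<comment> \<open>The derivative of the moving average: its mass over (0,x) telescopes to the
    measure of K in [x, x + h), divided by h.\<close>
  define m' where "m' = (\<lambda>x. (indicator K (x + h) - indicator K x) / h :: real)"
  have m'_meas [measurable]: "m' \<in> borel_measurable borel" unfolding m'_def by measurable
  have m'_bnd: "\<bar>m' x\<bar> \<le> 1 / h" for x
    using h by (auto simp: m'_def indicator_def)
  have m'0: "m' x = 0" if "x \<notin> U" for x
    using K_shift[of "x + h" x] K_shift[of x x] that h by (auto simp: m'_def indicator_def)
  have m_eq: "L.distf m' x = measure lborel (K \<inter> {x..<x + h}) / h" for x
  proof -
    have i1: "(LINT t:{0<..<x}|lborel. indicator K t) = measure lborel (K \<inter> {..<x})"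
    proof -
      have "(LINT t:{0<..<x}|lborel. indicator K t) = (LINT t|lborel. indicator (K \<inter> {..<x}) t :: real)"
        unfolding set_lebesgue_integral_def using Kpos ab
        by (intro Bochner_Integration.integral_cong refl) (force simp: indicator_def)
      then show ?thesis using Kfin by simp
    qed
    have i2: "(LINT t:{0<..<x}|lborel. indicator K (t + h)) = measure lborel (K \<inter> {..<x + h})"
    proof -
      have pos: "0 < t" if "t + h \<in> K" for t
        using K_shift[of "t + h" t] that h U(2) ab by fastforce
      have "(LINT t|lborel. indicator (K \<inter> {..<x + h}) t :: real)
          = (LINT t|lborel. indicator (K \<inter> {..<x + h}) (h + 1 * t))"
        using lborel_integral_real_affine[of 1 "indicator (K \<inter> {..<x + h}) :: real \<Rightarrow> real" h] by simp
      also have "\<dots> = (LINT t:{0<..<x}|lborel. indicator K (t + h))"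
        unfolding set_lebesgue_integral_def using pos
        by (intro Bochner_Integration.integral_cong refl) (auto simp: indicator_def add.commute)
      finally show ?thesis using Kfin by simp
    qed
    have si: "set_integrable lborel {0<..<x} (\<lambda>t. indicator K (t + s) :: real)" for s
      by (rule L.set_integrable_bounded[where B=1 and c=x]) (auto simp: indicator_def)
    have "L.distf m' x = ((LINT t:{0<..<x}|lborel. indicator K (t + h)) - (LINT t:{0<..<x}|lborel. indicator K t)) / h"
      unfolding L.distf_def m'_def using si[of h] si[of 0] by (simp add: set_integral_diff)
    also have "\<dots> = (measure lborel (K \<inter> {..<x + h}) - measure lborel (K \<inter> {..<x})) / h"
      unfolding i1 i2 ..
    also have "K \<inter> {..<x + h} = (K \<inter> {..<x}) \<union> (K \<inter> {x..<x + h})" using h by auto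
    also have "measure lborel ((K \<inter> {..<x}) \<union> (K \<inter> {x..<x + h}))
        = measure lborel (K \<inter> {..<x}) + measure lborel (K \<inter> {x..<x + h})"
      using Kfin[of "{..<x}"] Kfin[of "{x..<x + h}"] by (intro measure_Union) auto
    finally show ?thesis by simp
  qed
  have m_nonneg: "0 \<le> L.distf m' x" for x unfolding m_eq using h by simp
  have m_le1: "L.distf m' x \<le> 1" for x
  proof -
    have "measure lborel (K \<inter> {x..<x + h}) \<le> measure lborel {x..<x + h}"
      using h by (intro measure_mono_fmeasurable fmeasurableI) auto
    then show ?thesis unfolding m_eq using h by simp
  qed
  have m0: "L.distf m' x = 0" if "x \<notin> U" for x
  proof -
    have "K \<inter> {x..<x + h} = {}" using K_shift that by force
    then show ?thesis unfolding m_eq by simp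
  qed
  have m1: "L.distf m' x = 1" if "x \<in> K0" for x
  proof -
    have "K \<inter> {x..<x + h} = {x..<x + h}"
    proof -
      have "infdist t K0 \<le> h" if "t \<in> {x..<x + h}" for t
        using inf_shift[of t x] infdist_zero[OF \<open>x \<in> K0\<close>] that by auto
      then show ?thesis by (auto simp: K_def)
    qed
    then show ?thesis unfolding m_eq using h by simp
  qed
  have mm: "L.distf m' \<in> borel_measurable borel" by (rule L.distf_measurable) simp
  have mi: "set_integrable lborel {0<..<b} (L.distf m')"
    using m_nonneg m_le1 by (intro L.set_integrable_bounded[OF mm, of _ 1 b]) auto
  have "3/4 * (b - a) \<le> (LINT t:{0<..<b}|lborel. indicator K0 t)"
  proof -
    have "(LINT t:{0<..<b}|lborel. indicator K0 t) = (LINT t|lborel. indicator K0 t :: real)"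
      unfolding set_lebesgue_integral_def using K0(2) U(2) ab
      by (intro Bochner_Integration.integral_cong refl) (force simp: indicator_def)
    then show ?thesis using mK0 by simp
  qed
  also have "\<dots> \<le> L.distf (L.distf m') b"
    unfolding L.distf_def[of "L.distf m'"]
  proof (rule set_integral_mono[OF _ mi])
    show "set_integrable lborel {0<..<b} (indicator K0 :: real \<Rightarrow> real)"
      using K0(1) by (intro L.set_integrable_bounded[where B=1 and c=b]) (auto simp: indicator_def)
    show "indicator K0 t \<le> L.distf m' t" for t
      using m1[of t] m_nonneg[of t] by (auto simp: indicator_def)
  qed
  finally have lower: "3/4 * (b - a) \<le> L.distf (L.distf m') b" .
  have a0: "L.distf (L.distf m') a = 0"
  proof (rule L.distf_zero_left[of a a])
    fix t assume "t \<le> a"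
    then have "t \<notin> U" using U(2) by auto
    then show "L.distf m' t = 0" by (rule m0)
  qed simp
  have "\<bar>L.distf (L.distf m') b - L.distf (L.distf m') a\<bar> \<le> 1 * measure lborel {0<..<b} - 1 * measure lborel {0<..<a}"
    using m_nonneg m_le1 ab by (intro L.distf_variation[OF mm]) auto
  then have upper: "L.distf (L.distf m') b \<le> b - a" using ab a0 by auto
  show thesis by (rule that[OF m'_meas m'_bnd m'0 m_nonneg m_le1 m0 lower upper])
qed

end

context half_line_potential
begin

text \<open>The pairing of h = -u' + q f with f is integrated by parts separately against Lebesgue
  measure and the two parts of \<nu>. The boundary terms vanish with u, and the quadratic form
  appears with u^2 integrated against dP. The operator is that of \<open>q'\<close>, the formulas
  use its Borel version q.\<close>

lemma H_op_element:
  assumes \<beta>: "\<beta> > 0" and u: "u = L.distf \<omega>" "\<And>x. \<bar>u x\<bar> \<le> B"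
    and \<omega>: "\<omega> \<in> borel_measurable borel" "integrable lborel \<omega>"
    and supp: "\<And>x. x \<notin> {0<..<\<beta>} \<Longrightarrow> u x = 0 \<and> \<omega> x = 0 \<and> dP_distf u x = 0"
    and C: "\<And>x. \<bar>- \<omega> x + q x * dP_distf u x\<bar> \<le> C"
    and q': "AE x in half_line. q' x = q x"
  shows "(cplx (dP_distf u), \<lambda>x. complex_of_real (- \<omega> x + q x * dP_distf u x)) \<in> H_op \<nu>\<^sub>p \<nu>\<^sub>n q'"
    and "Re (L2_inner (\<lambda>x. complex_of_real (- \<omega> x + q x * dP_distf u x)) (cplx (dP_distf u)))
      = (LINT x:{0<..<\<beta>}|lborel. (u x)\<^sup>2) + (LINT x:{0<..<\<beta>}|\<nu>\<^sub>p. (u x)\<^sup>2) - (LINT x:{0<..<\<beta>}|\<nu>\<^sub>n. (u x)\<^sup>2)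
        + (LINT x:{0<..<\<beta>}|lborel. q x * (dP_distf u x)\<^sup>2)"
    and "(L2_norm (cplx (dP_distf u)))\<^sup>2 = (LINT x:{0<..<\<beta>}|lborel. (dP_distf u x)\<^sup>2)"
proof -
  define f where "f = dP_distf u"
  define h where "h = (\<lambda>x. - \<omega> x + q x * f x)"
  have [measurable]: "\<omega> \<in> borel_measurable borel" by fact
  have um [measurable]: "u \<in> borel_measurable borel" unfolding u(1) by (rule L.distf_measurable) simp
  have fm [measurable]: "f \<in> borel_measurable borel" unfolding f_def by (rule dP_distf_measurable) simp
  have hm [measurable]: "h \<in> borel_measurable borel" unfolding h_def by measurable
  have f0: "f x = 0" "h x = 0" "u x = 0" "\<omega> x = 0" if "x \<notin> {0<..<\<beta>}" for x
    using supp[OF that] by (auto simp: f_def h_def)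
  have fb: "\<bar>f x\<bar> \<le> B * dP_variation \<beta>" for x
    unfolding f_def by (rule dP_distf_bound'[OF um u(2) \<beta>]) (use f0 in auto)
  have hb: "\<bar>h x\<bar> \<le> C" for x using C[of x] by (simp add: h_def f_def)
  have fL2: "(cplx f) \<in> L2" by (rule L2_bounded_support[OF fm fb f0(1)])
  have hL2: "(cplx h) \<in> L2" by (rule L2_bounded_support[OF hm hb f0(2)])
  have ac: "has_ac_derivative (cplx u) (cplx \<omega>)"
    unfolding has_ac_derivative_def
  proof (intro conjI allI impI)
    have leb: "integrable lebesgue \<omega>" using \<omega> by (subst integrable_completion) auto
    fix c :: real
    have "set_integrable lebesgue {0<..<c} \<omega>"
      unfolding set_integrable_def by (rule integrable_mult_indicator[OF _ leb]) simp
    then show "set_integrable lebesgue {0<..<c} (cplx \<omega>)"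
      unfolding set_integrable_def by (simp add: scaleR_conv_of_real flip: of_real_mult)
  next
    fix x :: real
    have "(LINT t:{0<..<x}|lebesgue. complex_of_real (\<omega> t)) = complex_of_real (LINT t:{0<..<x}|lebesgue. \<omega> t)"
      by (rule set_integral_complex_of_real)
    also have "(LINT t:{0<..<x}|lebesgue. \<omega> t) = (LINT t:{0<..<x}|lborel. \<omega> t)"
      unfolding set_lebesgue_integral_def by (rule integral_completion) simp
    also have "\<dots> = u x" by (simp add: u(1) L.distf_def)
    finally show "complex_of_real (u x) = complex_of_real (u 0) + (LINT t:{0<..<x}|lebesgue. complex_of_real (\<omega> t))"
      using f0(3)[of 0] by simp
  qed
  have hq: "AE x in half_line. complex_of_real (h x)
      = - complex_of_real (\<omega> x) + complex_of_real (q' x) * complex_of_real (f x)"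
    using q' by eventually_elim (simp add: h_def)
  have u0: "complex_of_real (u 0) = 0" using f0(3)[of 0] by simp
  have "(cplx f, cplx h) \<in> H_op \<nu>\<^sub>p \<nu>\<^sub>n q'"
    unfolding H_op_def mem_Collect_eq prod.case
    using fL2 hL2 ac u0 hq has_quasi_derivative_dP_distf[OF um u(2)]
    by (intro conjI exI[of _ "cplx f"] exI[of _ "cplx u"]
        exI[of _ "cplx \<omega>"]) (auto simp: f_def)
  then show "(cplx (dP_distf u), \<lambda>x. complex_of_real (- \<omega> x + q x * dP_distf u x)) \<in> H_op \<nu>\<^sub>p \<nu>\<^sub>n q'"
    by (simp add: f_def h_def)
  have set_int: "set_integrable lborel {0<..<\<beta>} w" if "integrable lborel w" for w :: "real \<Rightarrow> real"
    unfolding set_integrable_def by (rule integrable_mult_indicator[OF _ that]) simp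
  have mult_bnd: "set_integrable lborel {0<..<\<beta>} (\<lambda>x. a x * g x)"
    if a: "set_integrable lborel {0<..<\<beta>} a" "a \<in> borel_measurable borel"
      and g: "g \<in> borel_measurable borel" "\<And>x. \<bar>g x\<bar> \<le> D" for a g :: "real \<Rightarrow> real" and D
  proof -
    have [measurable]: "a \<in> borel_measurable borel" "g \<in> borel_measurable borel" by fact+
    have "integrable lborel (\<lambda>x. indicator {0<..<\<beta>} x *\<^sub>R (a x * g x))"
    proof (rule Bochner_Integration.integrable_bound)
      show "integrable lborel (\<lambda>x. (indicator {0<..<\<beta>} x *\<^sub>R a x) * D)"
        using a by (simp add: set_integrable_def)
      have "\<bar>a x\<bar> * \<bar>g x\<bar> \<le> \<bar>a x\<bar> * \<bar>D\<bar>" for x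
        using g(2)[of x] by (intro mult_left_mono) auto
      then show "AE x in lborel. norm (indicator {0<..<\<beta>} x *\<^sub>R (a x * g x))
          \<le> norm ((indicator {0<..<\<beta>} x *\<^sub>R a x) * D)"
        by (intro AE_I2) (auto simp: abs_mult indicator_def)
    qed measurable
    then show ?thesis by (simp add: set_integrable_def)
  qed
  have u\<omega>: "u x = (LINT t:{0<..<x}|lborel. \<omega> t)" for x by (simp add: u(1) L.distf_def)
  have u\<beta>: "u \<beta> = 0" using f0(3)[of \<beta>] by simp
  have parts: "(LINT x:{0<..<\<beta>}|lborel. \<omega> x * half_line_radon.distf \<mu> u x) = - (LINT x:{0<..<\<beta>}|\<mu>. (u x)\<^sup>2)"
    and parts_int: "set_integrable lborel {0<..<\<beta>} (\<lambda>x. \<omega> x * half_line_radon.distf \<mu> u x)"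
    if "half_line_radon \<mu>" for \<mu>
  proof -
    interpret M: half_line_radon \<mu> by fact
    show "(LINT x:{0<..<\<beta>}|lborel. \<omega> x * M.distf u x) = - (LINT x:{0<..<\<beta>}|\<mu>. (u x)\<^sup>2)"
      by (rule M.distf_by_parts[OF um u(2) u\<omega> _ set_int[OF \<omega>(2)] \<beta> u\<beta>]) simp
    have d: "\<bar>M.distf u x\<bar> \<le> B * measure \<mu> {0<..<\<beta>}" for x
    proof (cases "x \<le> \<beta>")
      case True
      then show ?thesis by (rule M.distf_bound[OF um u(2)])
    next
      case False
      then have "M.distf u x = M.distf u \<beta>"
        using \<beta> f0(3) by (intro M.distf_const_right[OF um u(2)]) auto
      then show ?thesis using M.distf_bound[OF um u(2) order_refl[of \<beta>]] by simp
    qed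
    show "set_integrable lborel {0<..<\<beta>} (\<lambda>x. \<omega> x * M.distf u x)"
      by (rule mult_bnd[OF set_int[OF \<omega>(2)] _ M.distf_measurable[OF um] d]) simp
  qed
  note pL = parts[OF L.half_line_radon_axioms] parts_int[OF L.half_line_radon_axioms]
  note pp = parts[OF p.half_line_radon_axioms] parts_int[OF p.half_line_radon_axioms]
  note pn = parts[OF n.half_line_radon_axioms] parts_int[OF n.half_line_radon_axioms]
  have f2: "\<bar>(f x)\<^sup>2\<bar> \<le> (B * dP_variation \<beta>)\<^sup>2" for x
    using fb[of x] by (simp add: abs_le_square_iff[symmetric])
  have qf_int: "set_integrable lborel {0<..<\<beta>} (\<lambda>x. q x * (f x)\<^sup>2)"
    by (rule mult_bnd[OF q_int q_borel _ f2]) simp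
  have "L2_inner (cplx h) (cplx f)
      = complex_of_real (LINT x|half_line. h x * f x)"
    unfolding L2_inner_def by (simp flip: integral_complex_of_real)
  then have "Re (L2_inner (cplx h) (cplx f))
      = (LINT x|half_line. h x * f x)" by simp
  also have "\<dots> = (LINT x:{0<..<\<beta>}|lborel. h x * f x)"
    by (rule integral_half_line_borel) (use f0 in auto)
  also have "(\<lambda>x. h x * f x) = (\<lambda>x. (\<omega> x * n.distf u x - \<omega> x * L.distf u x - \<omega> x * p.distf u x) + q x * (f x)\<^sup>2)"
    by (auto simp: fun_eq_iff h_def f_def dP_distf_def power2_eq_square algebra_simps)
  also have "(LINT x:{0<..<\<beta>}|lborel. (\<omega> x * n.distf u x - \<omega> x * L.distf u x - \<omega> x * p.distf u x) + q x * (f x)\<^sup>2)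
      = (LINT x:{0<..<\<beta>}|lborel. \<omega> x * n.distf u x) - (LINT x:{0<..<\<beta>}|lborel. \<omega> x * L.distf u x)
        - (LINT x:{0<..<\<beta>}|lborel. \<omega> x * p.distf u x) + (LINT x:{0<..<\<beta>}|lborel. q x * (f x)\<^sup>2)"
    using pL(2) pp(2) pn(2) qf_int by (simp add: set_integral_add set_integral_diff)
  also have "\<dots> = (LINT x:{0<..<\<beta>}|lborel. (u x)\<^sup>2) + (LINT x:{0<..<\<beta>}|\<nu>\<^sub>p. (u x)\<^sup>2)
      - (LINT x:{0<..<\<beta>}|\<nu>\<^sub>n. (u x)\<^sup>2) + (LINT x:{0<..<\<beta>}|lborel. q x * (f x)\<^sup>2)"
    unfolding pL(1) pp(1) pn(1) by simp
  finally show "Re (L2_inner (\<lambda>x. complex_of_real (- \<omega> x + q x * dP_distf u x)) (cplx (dP_distf u)))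
      = (LINT x:{0<..<\<beta>}|lborel. (u x)\<^sup>2) + (LINT x:{0<..<\<beta>}|\<nu>\<^sub>p. (u x)\<^sup>2) - (LINT x:{0<..<\<beta>}|\<nu>\<^sub>n. (u x)\<^sup>2)
        + (LINT x:{0<..<\<beta>}|lborel. q x * (dP_distf u x)\<^sup>2)"
    by (simp add: f_def h_def)
  have "(L2_norm (cplx f))\<^sup>2 = (LINT x|half_line. (f x)\<^sup>2)"
    by (simp add: L2_norm_def)
  also have "\<dots> = (LINT x:{0<..<\<beta>}|lborel. (f x)\<^sup>2)"
    by (rule integral_half_line_borel) (use f0 in auto)
  finally show "(L2_norm (cplx (dP_distf u)))\<^sup>2 = (LINT x:{0<..<\<beta>}|lborel. (dP_distf u x)\<^sup>2)"
    by (simp add: f_def)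
qed

end


lemma (in half_line_radon) distf_AE_zero:
  assumes "v \<in> borel_measurable borel" "AE t in \<mu>. v t = 0"
  shows "distf v x = 0"
proof -
  have "distf v x = (LINT t|\<mu>. 0)"
    unfolding distf_def set_lebesgue_integral_def
  proof (rule integral_cong_AE)
    show "AE t in \<mu>. indicator {0<..<x} t *\<^sub>R v t = 0"
      using assms(2) by eventually_elim simp
    have "{0<..<x} \<in> sets \<mu>" by (rule sets_half_line) auto
    then show "(\<lambda>t. indicator {0<..<x} t *\<^sub>R v t) \<in> borel_measurable \<mu>"
      using borel_measurable_half_line[OF assms(1)] by measurable
  qed simp
  then show ?thesis by simp
qed

lemma (in half_line_radon) distf_lincomb:
  assumes "u \<in> borel_measurable borel" "\<And>x. \<bar>u x\<bar> \<le> B"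
    and "v \<in> borel_measurable borel" "\<And>x. \<bar>v x\<bar> \<le> B'"
  shows "distf (\<lambda>x. a * u x + b * v x) y = a * distf u y + b * distf v y"
proof -
  have b: "\<bar>a * u x\<bar> \<le> \<bar>a\<bar> * B" "\<bar>b * v x\<bar> \<le> \<bar>b\<bar> * B'" for x
    unfolding abs_mult by (intro mult_left_mono assms; simp)+
  have "(\<lambda>x. a * u x) \<in> borel_measurable borel" "(\<lambda>x. b * v x) \<in> borel_measurable borel"
    using assms(1,3) by auto
  then have "distf (\<lambda>x. a * u x + b * v x) y = distf (\<lambda>x. a * u x) y + distf (\<lambda>x. b * v x) y"
    using b by (intro distf_add[of _ "\<bar>a\<bar> * B" _ "\<bar>b\<bar> * B'"])
  then show ?thesis by (simp only: distf_cmult)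
qed

lemma (in signed_half_line) dP_distf_lincomb:
  assumes "u \<in> borel_measurable borel" "\<And>x. \<bar>u x\<bar> \<le> B"
    and "v \<in> borel_measurable borel" "\<And>x. \<bar>v x\<bar> \<le> B'"
  shows "dP_distf (\<lambda>x. a * u x + b * v x) y = a * dP_distf u y + b * dP_distf v y"
  unfolding dP_distf_def L.distf_lincomb[OF assms] p.distf_lincomb[OF assms] n.distf_lincomb[OF assms]
  by (simp add: algebra_simps)

section \<open>The support of \<nu> and functions vanishing on it\<close>

context signed_half_line
begin

abbreviation supp :: "real set" where
  "supp \<equiv> topological_support \<nu>\<^sub>p \<nu>\<^sub>n"

text \<open>The complement is the union of all open sets that are null for both parts of \<nu>; by
  Lindelof countably many of them suffice, so the union is null.\<close>

lemma supp_complement: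
  shows open_supp_complement: "open ({0<..} - supp)"
    and supp_complement_null: "{0<..} - supp \<in> null_sets \<nu>\<^sub>p" "{0<..} - supp \<in> null_sets \<nu>\<^sub>n"
proof -
  define F where "F = {V. open V \<and> V \<subseteq> {0<..} \<and> emeasure \<nu>\<^sub>p V + emeasure \<nu>\<^sub>n V = 0}"
  have UF: "\<Union>F = {0<..} - supp"
  proof (intro equalityI subsetI)
    fix x assume "x \<in> \<Union>F"
    then obtain V where V: "V \<in> F" "x \<in> V" by blast
    then have "V \<inter> {0<..} = V" by (auto simp: F_def)
    then have "x \<notin> supp" "x > 0"
      using V unfolding F_def topological_support_def by (auto intro!: exI[of _ V])
    then show "x \<in> {0<..} - supp" by simp
  next
    fix x assume x: "x \<in> {0<..} - supp"
    then obtain U where U: "open U" "x \<in> U"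
      "\<not> emeasure \<nu>\<^sub>p (U \<inter> {0<..}) + emeasure \<nu>\<^sub>n (U \<inter> {0<..}) > 0"
      unfolding topological_support_def by auto
    then have "U \<inter> {0<..} \<in> F" by (auto simp: F_def open_Int not_less)
    then show "x \<in> \<Union>F" using x U(2) by blast
  qed
  show "open ({0<..} - supp)" unfolding UF[symmetric] by (rule open_Union) (auto simp: F_def)
  obtain F' where F': "F' \<subseteq> F" "countable F'" "\<Union>F' = \<Union>F"
    using Lindelof[of F] by (auto simp: F_def)
  have Fs: "V \<in> sets borel" "V \<subseteq> {0<..}" "emeasure \<nu>\<^sub>p V = 0" "emeasure \<nu>\<^sub>n V = 0" if "V \<in> F'" for V
    using that F'(1) by (auto simp: F_def)
  have Fn: "V \<in> null_sets \<nu>\<^sub>p" "V \<in> null_sets \<nu>\<^sub>n" if "V \<in> F'" for V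
    using Fs[OF that] by (auto intro!: p.sets_half_line n.sets_half_line)
  have "(\<Union>V\<in>F'. V) \<in> null_sets \<nu>\<^sub>p" "(\<Union>V\<in>F'. V) \<in> null_sets \<nu>\<^sub>n"
    by (rule null_sets_UN'[OF F'(2) Fn(1)], assumption, rule null_sets_UN'[OF F'(2) Fn(2)], assumption)
  then show "{0<..} - supp \<in> null_sets \<nu>\<^sub>p" "{0<..} - supp \<in> null_sets \<nu>\<^sub>n"
    using F'(3) UF by simp_all
qed

lemma AE_supp: "AE x in \<nu>\<^sub>p. x \<in> supp" "AE x in \<nu>\<^sub>n. x \<in> supp"
proof -
  have "space \<nu>\<^sub>p = {0<..}" "space \<nu>\<^sub>n = {0<..}"
    using signed sets_eq_imp_space_eq[of _ "restrict_space borel {0<..}"]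
    by (auto simp: signed_radon_measure_def space_restrict_space)
  then show "AE x in \<nu>\<^sub>p. x \<in> supp" "AE x in \<nu>\<^sub>n. x \<in> supp"
    using supp_complement_null by (auto intro: AE_I')
qed

text \<open>Both parts of \<nu> are concentrated on the support, where v vanishes, so dP acts on v
  as dx.\<close>

lemma dP_distf_eq_lborel:
  assumes v: "v \<in> borel_measurable borel" "\<And>x. x \<in> supp \<Longrightarrow> v x = 0"
  shows "dP_distf v x = L.distf v x"
proof -
  have "AE t in \<nu>\<^sub>p. v t = 0" "AE t in \<nu>\<^sub>n. v t = 0"
    using AE_supp by (auto elim!: eventually_mono simp: v(2))
  then show ?thesis
    using p.distf_AE_zero[OF v(1), of x] n.distf_AE_zero[OF v(1), of x] by (simp add: dP_distf_def)
qed

lemma bump_avoiding_supp: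
  assumes ab: "0 < a" "a < b" and null: "supp \<in> null_sets lebesgue"
  obtains m' B where "m' \<in> borel_measurable borel" "\<And>x. \<bar>m' x\<bar> \<le> B"
    "\<And>x. x \<notin> {a<..<b} \<Longrightarrow> m' x = 0" "\<And>x. 0 \<le> L.distf m' x" "\<And>x. L.distf m' x \<le> 1"
    "\<And>x. x \<notin> {a<..<b} \<Longrightarrow> L.distf m' x = 0" "\<And>x. x \<in> supp \<Longrightarrow> L.distf m' x = 0"
    "3/4 * (b - a) \<le> L.distf (L.distf m') b" "L.distf (L.distf m') b \<le> b - a"
proof -
  define U where "U = {a<..<b} \<inter> ({0<..} - supp)"
  have U: "open U" "U \<subseteq> {a<..<b}" unfolding U_def using open_supp_complement by auto
  have "{a<..<b} - U = {a<..<b} \<inter> supp" using ab by (auto simp: U_def)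
  also have "\<dots> \<in> null_sets lebesgue" by (rule null_set_Int1[OF null]) simp
  finally have Un: "{a<..<b} - U \<in> null_sets lebesgue" .
  from bump_avoiding_null_set[OF ab U Un] obtain m' B where m:
    "m' \<in> borel_measurable borel" "\<And>x. \<bar>m' x\<bar> \<le> B"
    "\<And>x. x \<notin> U \<Longrightarrow> m' x = 0" "\<And>x. 0 \<le> L.distf m' x" "\<And>x. L.distf m' x \<le> 1"
    "\<And>x. x \<notin> U \<Longrightarrow> L.distf m' x = 0"
    "3/4 * (b - a) \<le> L.distf (L.distf m') b" "L.distf (L.distf m') b \<le> b - a"
    by metis
  show thesis
    by (rule that[OF m(1,2) _ m(4,5) _ _ m(7,8)]) (auto intro!: m(3,6) simp: U_def)
qed

end

section \<open>Trial elements of the domain on one interval\<close>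

context half_line_potential
begin

text \<open>The quasi-derivative satisfies |u| \<le> 2, which contributes at most 4 \<epsilon>. The
  positive part of \<nu> contributes at most 1, and |f| \<le> 2 \<epsilon> bounds the potential term
  by 4 \<epsilon>^2 Q. The squared norm of f is at least \<epsilon>^3 / 2048, which converts the sum
  into a Rayleigh quotient bound depending on \<epsilon> and Q only.\<close>

lemma local_domain_element:
  fixes \<alpha> \<epsilon> Q :: real
  assumes \<alpha>\<epsilon>: "0 < \<alpha>" "0 < \<epsilon>" and null: "supp \<in> null_sets lebesgue"
    and Q: "(LINT t:{\<alpha><..<\<alpha> + \<epsilon>}|lborel. max (q t) 0) \<le> Q"
    and q': "AE x in half_line. q' x = q x"
  obtains f h :: "real \<Rightarrow> real" where
    "(cplx f, cplx h) \<in> H_op \<nu>\<^sub>p \<nu>\<^sub>n q'"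
    "\<And>x. x \<notin> {\<alpha><..<\<alpha> + \<epsilon>} \<Longrightarrow> f x = 0 \<and> h x = 0"
    "L2_norm (cplx f) > 0"
    "Re (L2_inner (cplx h) (cplx f))
      \<le> 2048 * (4 * \<epsilon> + 1 + 4 * \<epsilon>\<^sup>2 * Q) / \<epsilon> ^ 3 * (L2_norm (cplx f))\<^sup>2"
proof -
  define \<beta> where "\<beta> = \<alpha> + \<epsilon>"
  define \<gamma> where "\<gamma> = \<alpha> + \<epsilon> / 2"
  \<comment> \<open>The quasi-derivative \<open>v\<close> of the trial function is positive on \<open>(\<alpha>, \<gamma>)\<close>, negative on \<open>(\<gamma>, \<beta>)\<close>,
    and vanishes on the support of \<open>\<nu>\<close>, so that \<open>dP\<close> acts on it as Lebesgue measure.\<close>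
  have ord: "0 < \<alpha>" "\<alpha> < \<gamma>" "\<gamma> < \<beta>" "0 < \<gamma>" "0 < \<beta>" "\<alpha> < \<beta>" "\<beta> - \<alpha> = \<epsilon>" "\<gamma> - \<alpha> = \<epsilon> / 2" "\<beta> - \<gamma> = \<epsilon> / 2"
    using \<alpha>\<epsilon> by (auto simp: \<beta>_def \<gamma>_def)
  obtain m1' B1 where m1: "m1' \<in> borel_measurable borel" "\<And>x. \<bar>m1' x\<bar> \<le> B1"
    "\<And>x. x \<notin> {\<alpha><..<\<gamma>} \<Longrightarrow> m1' x = 0" "\<And>x. 0 \<le> L.distf m1' x" "\<And>x. L.distf m1' x \<le> 1"
    "\<And>x. x \<notin> {\<alpha><..<\<gamma>} \<Longrightarrow> L.distf m1' x = 0" "\<And>x. x \<in> supp \<Longrightarrow> L.distf m1' x = 0"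
    "3/4 * (\<gamma> - \<alpha>) \<le> L.distf (L.distf m1') \<gamma>" "L.distf (L.distf m1') \<gamma> \<le> \<gamma> - \<alpha>"
    using bump_avoiding_supp[OF ord(1,2) null] by metis
  obtain m2' B2 where m2: "m2' \<in> borel_measurable borel" "\<And>x. \<bar>m2' x\<bar> \<le> B2"
    "\<And>x. x \<notin> {\<gamma><..<\<beta>} \<Longrightarrow> m2' x = 0" "\<And>x. 0 \<le> L.distf m2' x" "\<And>x. L.distf m2' x \<le> 1"
    "\<And>x. x \<notin> {\<gamma><..<\<beta>} \<Longrightarrow> L.distf m2' x = 0" "\<And>x. x \<in> supp \<Longrightarrow> L.distf m2' x = 0"
    "3/4 * (\<beta> - \<gamma>) \<le> L.distf (L.distf m2') \<beta>" "L.distf (L.distf m2') \<beta> \<le> \<beta> - \<gamma>"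
    using bump_avoiding_supp[OF ord(4,3) null] by metis
  have mm: "L.distf m1' \<in> borel_measurable borel" "L.distf m2' \<in> borel_measurable borel"
    by (rule L.distf_measurable[OF m1(1)], rule L.distf_measurable[OF m2(1)])
  have mb: "\<bar>L.distf m1' x\<bar> \<le> 1" "\<bar>L.distf m2' x\<bar> \<le> 1" for x
    using m1(4,5)[of x] m2(4,5)[of x] by auto
  define A1 where "A1 = L.distf (L.distf m1') \<gamma>"
  define A2 where "A2 = L.distf (L.distf m2') \<beta>"
  have A: "3/8 * \<epsilon> \<le> A1" "A1 \<le> \<epsilon> / 2" "3/8 * \<epsilon> \<le> A2" "A2 \<le> \<epsilon> / 2"
    using m1(8,9) m2(8,9) ord(8,9) by (auto simp: A1_def A2_def)
  then have Apos: "A1 > 0" "A2 > 0" using \<alpha>\<epsilon> by auto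
  have A1\<beta>: "L.distf (L.distf m1') \<beta> = A1"
    unfolding A1_def using ord m1(6) by (intro L.distf_const_right[OF mm(1) mb(1)]) auto
  have A2\<gamma>: "L.distf (L.distf m2') \<gamma> = 0"
    using m2(6) by (intro L.distf_zero_left[of \<gamma> \<gamma>]) auto
  \<comment> \<open>Each bump is weighted with the mass of the other, so the integral of v vanishes
    and the trial function returns to 0 at \<beta>.\<close>
  define v' where "v' = (\<lambda>x. (A2 / \<epsilon>) * m1' x + (- (A1 / \<epsilon>)) * m2' x)"
  define v where "v = L.distf v'"
  have v_eq: "v = (\<lambda>x. (A2 / \<epsilon>) * L.distf m1' x + (- (A1 / \<epsilon>)) * L.distf m2' x)"
    unfolding v_def v'_def using L.distf_lincomb[OF m1(1,2) m2(1,2)] by (rule ext)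
  have v_meas: "v \<in> borel_measurable borel" unfolding v_eq using mm by measurable
  have vb: "\<bar>v x\<bar> \<le> 1" for x
  proof -
    have "\<bar>(A2 / \<epsilon>) * L.distf m1' x\<bar> \<le> 1/2 * 1" "\<bar>(- (A1 / \<epsilon>)) * L.distf m2' x\<bar> \<le> 1/2 * 1"
      unfolding abs_mult using A Apos \<alpha>\<epsilon> by (intro mult_mono mb; simp add: field_simps)+
    then show ?thesis unfolding v_eq by linarith
  qed
  have v_supp: "v x = 0" if "x \<in> supp" for x unfolding v_eq using m1(7)[OF that] m2(7)[OF that] by simp
  have v_out: "v x = 0" if "x \<notin> {\<alpha><..<\<beta>}" for x
    unfolding v_eq using that ord m1(6)[of x] m2(6)[of x] by auto
  have Pv: "dP_distf v x = L.distf v x" for x by (rule dP_distf_eq_lborel[OF v_meas v_supp])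
  have Lv: "L.distf v x = (A2 / \<epsilon>) * L.distf (L.distf m1') x + (- (A1 / \<epsilon>)) * L.distf (L.distf m2') x" for x
    unfolding v_eq by (rule L.distf_lincomb[OF mm(1) mb(1) mm(2) mb(2)])
  have Lv\<beta>: "L.distf v \<beta> = 0" unfolding Lv A1\<beta> by (simp add: A2_def)
  \<comment> \<open>The peak value is A1 A2 / \<epsilon>, and both masses are at least 3/8
    \<epsilon>.\<close>
  have Lv\<gamma>: "9/64 * \<epsilon> \<le> L.distf v \<gamma>"
  proof -
    have "(3/8 * \<epsilon>) * (3/8 * \<epsilon>) \<le> A2 * A1" using A \<alpha>\<epsilon> by (intro mult_mono) auto
    then show ?thesis unfolding Lv A2\<gamma> A1_def[symmetric] using \<alpha>\<epsilon> by (simp add: field_simps)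
  qed
  have Lv_lip: "\<bar>L.distf v y - L.distf v x\<bar> \<le> y - x" if "0 < x" "x \<le> y" for x y
    using L.distf_variation[OF v_meas vb that] that by simp
  have Lv\<alpha>: "L.distf v \<alpha> = 0" using v_out by (intro L.distf_zero_left[of \<alpha> \<alpha>]) auto
  have Lvb: "\<bar>L.distf v x\<bar> \<le> \<epsilon>" if "x \<in> {\<alpha><..<\<beta>}" for x
    using Lv_lip[of \<alpha> x] that ord Lv\<alpha> by auto
  define m where "m = L.distf m1'"
  have Pm: "dP_distf m \<beta> = A1"
    unfolding m_def using dP_distf_eq_lborel[OF mm(1) m1(7)] A1\<beta> by simp
  \<comment> \<open>A density of total mass 1, from which w1 gets its value 1 at \<beta>.\<close>
  define r' where "r' = (\<lambda>x. (1 / \<epsilon>) * indicator {\<alpha><..<\<beta>} x :: real)"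
  have r'_meas: "r' \<in> borel_measurable borel" unfolding r'_def by measurable
  have r'_b: "\<bar>r' x\<bar> \<le> 1 / \<epsilon>" for x unfolding r'_def using \<alpha>\<epsilon> by (auto simp: indicator_def)
  have r'\<beta>: "L.distf r' \<beta> = 1"
  proof -
    have "L.distf r' \<beta> = (1 / \<epsilon>) * (LINT x|lborel. indicator {\<alpha><..<\<beta>} x)"
      unfolding L.distf_def set_lebesgue_integral_def r'_def using ord
      by (subst integral_mult_right_zero[symmetric], intro Bochner_Integration.integral_cong refl)
         (auto simp: indicator_def)
    then show ?thesis using ord \<alpha>\<epsilon> by simp
  qed
  \<comment> \<open>The primitive of \<open>m1'\<close> vanishes at \<beta> but has dP-integral A1 >
    0. Subtracting c times it removes the dP-integral of the primitive of \<open>r'\<close> without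
    changing its end value; dividing by A1 yields w2.\<close>
  define c where "c = dP_distf (L.distf r') \<beta> / A1"
  define w1' where "w1' = (\<lambda>x. 1 * r' x + (- c) * m1' x)"
  define w2' where "w2' = (\<lambda>x. (1 / A1) * m1' x)"
  have m1\<beta>: "L.distf m1' \<beta> = 0" using m1(6)[of \<beta>] ord by auto
  have w1_eq: "L.distf w1' = (\<lambda>x. 1 * L.distf r' x + (- c) * L.distf m1' x)"
    unfolding w1'_def using L.distf_lincomb[OF r'_meas r'_b m1(1,2)] by (rule ext)
  have w2_eq: "L.distf w2' = (\<lambda>x. (1 / A1) * L.distf m1' x)"
    unfolding w2'_def using L.distf_cmult by (rule ext)
  have Lr_meas: "L.distf r' \<in> borel_measurable borel" by (rule L.distf_measurable[OF r'_meas])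
  have Lr_b: "\<bar>L.distf r' x\<bar> \<le> 1 / \<epsilon> * \<beta>" for x
  proof (cases "x \<le> \<beta>")
    case True
    then show ?thesis using L.distf_bound[OF r'_meas r'_b True] ord by simp
  next
    case False
    then have "L.distf r' x = L.distf r' \<beta>"
      using ord by (intro L.distf_const_right[OF r'_meas r'_b]) (auto simp: r'_def)
    then show ?thesis using L.distf_bound[OF r'_meas r'_b order_refl[of \<beta>]] ord by simp
  qed
  have Pw1: "dP_distf (L.distf w1') \<beta> = 0"
    unfolding w1_eq dP_distf_lincomb[OF Lr_meas Lr_b mm(1) mb(1)]
    using Pm Apos by (simp add: m_def c_def)
  have Pw2: "dP_distf (L.distf w2') \<beta> = 1"
    unfolding w2_eq dP_distf_cmult using Pm Apos by (simp add: m_def)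
  define B where "B = \<bar>A2 / \<epsilon>\<bar> * B1 + \<bar>A1 / \<epsilon>\<bar> * B2 + 1 / \<epsilon> + \<bar>c\<bar> * B1 + \<bar>1 / A1\<bar> * B1"
  have B12: "B1 \<ge> 0" "B2 \<ge> 0" using m1(2)[of 0] m2(2)[of 0] by auto
  have nn: "0 \<le> \<bar>A2 / \<epsilon>\<bar> * B1" "0 \<le> \<bar>A1 / \<epsilon>\<bar> * B2" "0 \<le> 1 / \<epsilon>" "0 \<le> \<bar>c\<bar> * B1" "0 \<le> \<bar>1 / A1\<bar> * B1"
    using B12 \<alpha>\<epsilon> by auto
  have cb: "\<bar>a * m1' x\<bar> \<le> \<bar>a\<bar> * B1" "\<bar>a * m2' x\<bar> \<le> \<bar>a\<bar> * B2" for a x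
    unfolding abs_mult by (intro mult_left_mono m1(2) m2(2); simp)+
  have tri: "\<bar>a + b\<bar> \<le> a' + b'" if "\<bar>a\<bar> \<le> a'" "\<bar>b\<bar> \<le> b'" for a b a' b' :: real
    using that by linarith
  have bnd: "\<bar>v' x\<bar> \<le> B" "\<bar>w1' x\<bar> \<le> B" "\<bar>w2' x\<bar> \<le> B" for x
  proof -
    have "\<bar>1 * r' x\<bar> \<le> 1 / \<epsilon>" using r'_b[of x] by simp
    then have "\<bar>v' x\<bar> \<le> \<bar>A2 / \<epsilon>\<bar> * B1 + \<bar>- (A1 / \<epsilon>)\<bar> * B2" "\<bar>w1' x\<bar> \<le> 1 / \<epsilon> + \<bar>- c\<bar> * B1"
      "\<bar>w2' x\<bar> \<le> \<bar>1 / A1\<bar> * B1"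
      unfolding v'_def w1'_def w2'_def by (intro tri cb; assumption)+
    then show "\<bar>v' x\<bar> \<le> B" "\<bar>w1' x\<bar> \<le> B" "\<bar>w2' x\<bar> \<le> B"
      unfolding B_def abs_minus_cancel using nn by (simp_all only: add.assoc)
  qed
  have meas: "v' \<in> borel_measurable borel" "w1' \<in> borel_measurable borel" "w2' \<in> borel_measurable borel"
    unfolding v'_def w1'_def w2'_def using m1(1) m2(1) r'_meas by measurable
  have out: "v' x = 0" "w1' x = 0" "w2' x = 0" if "x \<notin> {\<alpha><..<\<beta>}" for x
    unfolding v'_def w1'_def w2'_def r'_def using m1(3)[of x] m2(3)[of x] that ord by auto
  have bdry: "L.distf v' \<beta> = 0" "L.distf w1' \<beta> = 1" "L.distf w2' \<beta> = 0" "dP_distf (L.distf v') \<beta> = 0"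
    using v_out[of \<beta>] Pv[of \<beta>] Lv\<beta> r'\<beta> m1\<beta> by (simp_all add: w1_eq w2_eq v_def)
  define N where "N = measure \<nu>\<^sub>p {0<..<\<beta>}"
  have N0: "N \<ge> 0" by (simp add: N_def)
  \<comment> \<open>The bound 1 gives |u| \<le> 2. The bound \<epsilon>/64 leaves f \<ge> (9 - 4 -
    1) \<epsilon>/64 = \<epsilon>/16 within \<epsilon>/16 of the peak. The last bound makes \<eta>^2
    N at most 1.\<close>
  define \<eta> where "\<eta> = min (min 1 (\<epsilon> / 64)) (1 / (1 + N))"
  have \<eta>: "\<eta> > 0" "\<eta> \<le> 1" "\<eta> \<le> \<epsilon> / 64" "\<eta> * N \<le> 1"
  proof -
    have "\<eta> \<le> 1 / (1 + N)" by (simp add: \<eta>_def)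
    then have "\<eta> * (1 + N) \<le> 1" using N0 by (simp add: pos_le_divide_eq)
    moreover show "\<eta> > 0" using \<alpha>\<epsilon> N0 by (simp add: \<eta>_def)
    ultimately show "\<eta> * N \<le> 1" by (simp add: distrib_left)
    show "\<eta> \<le> 1" "\<eta> \<le> \<epsilon> / 64" by (simp_all add: \<eta>_def)
  qed
  obtain u \<omega> C where u: "u = L.distf \<omega>" "\<omega> \<in> borel_measurable borel" "integrable lborel \<omega>"
    "\<And>x. x \<notin> {\<alpha><..<\<beta>} \<Longrightarrow> u x = 0 \<and> \<omega> x = 0 \<and> dP_distf u x = 0"
    "\<And>x. \<bar>u x - L.distf v' x\<bar> \<le> \<eta>" "\<And>x. \<bar>dP_distf u x - dP_distf (L.distf v') x\<bar> \<le> \<eta>"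
    "\<And>x. \<bar>- \<omega> x + q x * dP_distf u x\<bar> \<le> C"
    using domain_perturbation[OF ord(1,6) \<eta>(1) meas bnd out bdry Pw1 Pw2] by blast
  define f where "f = dP_distf u"
  define h where "h = (\<lambda>x. - \<omega> x + q x * f x)"
  have u_meas [measurable]: "u \<in> borel_measurable borel" unfolding u(1) by (rule L.distf_measurable[OF u(2)])
  have f_meas [measurable]: "f \<in> borel_measurable borel" unfolding f_def by (rule dP_distf_measurable[OF u_meas])
  have uv: "\<bar>u x - v x\<bar> \<le> \<eta>" and fv: "\<bar>f x - L.distf v x\<bar> \<le> \<eta>" for x
    using u(5,6)[of x] Pv[of x] by (auto simp: v_def f_def)
  have u2: "\<bar>u x\<bar> \<le> 2" for x using uv[of x] vb[of x] \<eta>(2) by linarith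
  have u0: "u x = 0" "f x = 0" "h x = 0" if "x \<notin> {\<alpha><..<\<beta>}" for x
    using u(4)[OF that] by (auto simp: f_def h_def)
  have f_le: "\<bar>f x\<bar> \<le> 2 * \<epsilon>" for x
    using fv[of x] Lvb[of x] \<eta>(3) u0(2)[of x] \<alpha>\<epsilon> by (cases "x \<in> {\<alpha><..<\<beta>}") auto
  have f_ge: "\<epsilon> / 16 \<le> f x" if x: "x \<in> {\<gamma> - \<epsilon> / 16..\<gamma> + \<epsilon> / 16}" for x
  proof -
    have "\<bar>L.distf v x - L.distf v \<gamma>\<bar> \<le> \<epsilon> / 16"
    proof (cases "\<gamma> \<le> x")
      case True
      then show ?thesis using Lv_lip[of \<gamma> x] ord x by auto
    next
      case False
      then have "x \<le> \<gamma>" by simp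
      moreover have "0 < x" "\<gamma> - x \<le> \<epsilon> / 16" using ord x by (auto simp: \<gamma>_def)
      ultimately have "\<bar>L.distf v \<gamma> - L.distf v x\<bar> \<le> \<epsilon> / 16" using Lv_lip[of x \<gamma>] by linarith
      then show ?thesis by (simp only: abs_minus_commute)
    qed
    then show ?thesis using fv[of x] Lv\<gamma> \<eta>(3) by linarith
  qed
  have supp0: "u x = 0 \<and> \<omega> x = 0 \<and> dP_distf u x = 0" if "x \<notin> {0<..<\<beta>}" for x
    using u(4)[of x] that ord(1) by auto
  note el = H_op_element[OF ord(5) u(1) u2 u(2,3) supp0 u(7) q']
  have sq: "(u x)\<^sup>2 \<le> 4" "(f x)\<^sup>2 \<le> 4 * \<epsilon>\<^sup>2" for x
  proof -
    have "(u x)\<^sup>2 \<le> 2\<^sup>2" using u2[of x] by (subst abs_le_square_iff[symmetric]) simp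
    then show "(u x)\<^sup>2 \<le> 4" by simp
    have "(f x)\<^sup>2 \<le> (2 * \<epsilon>)\<^sup>2" using f_le[of x] \<alpha>\<epsilon> by (subst abs_le_square_iff[symmetric]) simp
    then show "(f x)\<^sup>2 \<le> 4 * \<epsilon>\<^sup>2" by (simp add: power_mult_distrib)
  qed
  have T1: "(LINT x:{0<..<\<beta>}|lborel. (u x)\<^sup>2) \<le> 4 * \<epsilon>"
  proof -
    have "(LINT x:{0<..<\<beta>}|lborel. (u x)\<^sup>2) \<le> (LINT x|lborel. indicator {\<alpha><..<\<beta>} x * 4)"
      unfolding set_lebesgue_integral_def
    proof (rule integral_mono)
      show "integrable lborel (\<lambda>x. indicator {0<..<\<beta>} x *\<^sub>R (u x)\<^sup>2)"
        using L.set_integrable_bounded[of "\<lambda>x. (u x)\<^sup>2" "{0<..<\<beta>}" 4 \<beta>] sq(1)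
        by (simp add: set_integrable_def)
      show "indicator {0<..<\<beta>} x *\<^sub>R (u x)\<^sup>2 \<le> indicator {\<alpha><..<\<beta>} x * 4" for x
        using sq(1)[of x] u0(1)[of x] by (auto simp: indicator_def)
    qed (use ord in auto)
    then show ?thesis using ord by simp
  qed
  \<comment> \<open>On the support v is 0 and u is within \<eta> of v, so u^2 \<le> \<eta>^2 there.
    The mass N, which varies with the interval, is absorbed by the choice of \<eta>.\<close>
  have T2: "(LINT x:{0<..<\<beta>}|\<nu>\<^sub>p. (u x)\<^sup>2) \<le> 1"
  proof -
    have s: "{0<..<\<beta>} \<in> sets \<nu>\<^sub>p" by (rule p.sets_half_line) auto
    have "(LINT x:{0<..<\<beta>}|\<nu>\<^sub>p. (u x)\<^sup>2) \<le> (LINT x|\<nu>\<^sub>p. indicator {0<..<\<beta>} x * \<eta>\<^sup>2)"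
      unfolding set_lebesgue_integral_def
    proof (rule integral_mono_AE)
      show "integrable \<nu>\<^sub>p (\<lambda>x. indicator {0<..<\<beta>} x *\<^sub>R (u x)\<^sup>2)"
        using p.set_integrable_bounded[of "\<lambda>x. (u x)\<^sup>2" "{0<..<\<beta>}" 4 \<beta>] sq(1)
        by (simp add: set_integrable_def)
      show "integrable \<nu>\<^sub>p (\<lambda>x. indicator {0<..<\<beta>} x * \<eta>\<^sup>2)"
        using s p.finite_interval[of \<beta>] by (intro integrable_mult_left integrable_real_indicator) auto
      show "AE x in \<nu>\<^sub>p. indicator {0<..<\<beta>} x *\<^sub>R (u x)\<^sup>2 \<le> indicator {0<..<\<beta>} x * \<eta>\<^sup>2"
        using AE_supp(1)
      proof eventually_elim
        fix x assume "x \<in> supp"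
        then have "\<bar>u x\<bar> \<le> \<bar>\<eta>\<bar>" using uv[of x] v_supp[of x] by auto
        then show "indicator {0<..<\<beta>} x *\<^sub>R (u x)\<^sup>2 \<le> indicator {0<..<\<beta>} x * \<eta>\<^sup>2"
          by (auto simp: indicator_def abs_le_square_iff)
      qed
    qed
    also have "\<dots> = N * \<eta>\<^sup>2" using s by (simp add: N_def sets.Int_space_eq2)
    also have "\<dots> = \<eta> * (\<eta> * N)" by (simp add: power2_eq_square)
    also have "\<dots> \<le> 1 * 1" using \<eta> N0 by (intro mult_mono) auto
    finally show ?thesis by simp
  qed
  \<comment> \<open>The negative part of \<nu> enters the form with a minus sign, so only its sign
    matters for an upper bound.\<close>
  have T3: "0 \<le> (LINT x:{0<..<\<beta>}|\<nu>\<^sub>n. (u x)\<^sup>2)"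
    unfolding set_lebesgue_integral_def by (intro integral_nonneg_AE AE_I2) simp
  have qp_int: "set_integrable lborel {\<alpha><..<\<beta>} (\<lambda>x. max (q x) 0)"
  proof (rule set_integrable_bound)
    show "set_integrable lborel {\<alpha><..<\<beta>} q"
      by (rule set_integrable_subset[OF q_int[of \<beta>]]) (use ord in auto)
    show "AE x in lborel. x \<in> {\<alpha><..<\<beta>} \<longrightarrow> norm (max (q x) 0) \<le> norm (q x)"
      by (intro AE_I2) auto
  qed (auto simp: set_borel_measurable_def)
  have T4: "(LINT x:{0<..<\<beta>}|lborel. q x * (f x)\<^sup>2) \<le> 4 * \<epsilon>\<^sup>2 * Q"
  proof -
    have le: "indicator {0<..<\<beta>} x *\<^sub>R (q x * (f x)\<^sup>2) \<le> indicator {\<alpha><..<\<beta>} x *\<^sub>R (max (q x) 0 * (4 * \<epsilon>\<^sup>2))" for x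
    proof (cases "x \<in> {\<alpha><..<\<beta>}")
      case True
      have "q x * (f x)\<^sup>2 \<le> max (q x) 0 * (f x)\<^sup>2" by (intro mult_right_mono) auto
      also have "\<dots> \<le> max (q x) 0 * (4 * \<epsilon>\<^sup>2)" by (intro mult_left_mono sq) auto
      finally show ?thesis using True ord by (auto simp: indicator_def)
    next
      case False
      then show ?thesis using u0(2)[of x] by simp
    qed
    have int: "integrable lborel (\<lambda>x. indicator {\<alpha><..<\<beta>} x *\<^sub>R (max (q x) 0 * (4 * \<epsilon>\<^sup>2)))"
      using set_integrable_mult_left[of "4 * \<epsilon>\<^sup>2", OF qp_int] by (simp add: set_integrable_def)
    have "integrable lborel (\<lambda>x. indicator {0<..<\<beta>} x *\<^sub>R (q x * (f x)\<^sup>2))"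
    proof (rule Bochner_Integration.integrable_bound)
      show "integrable lborel (\<lambda>x. (indicator {0<..<\<beta>} x *\<^sub>R q x) * (4 * \<epsilon>\<^sup>2))"
        using q_int[of \<beta>] by (simp add: set_integrable_def)
      have "\<bar>q x\<bar> * (f x)\<^sup>2 \<le> \<bar>q x\<bar> * (4 * \<epsilon>\<^sup>2)" for x by (intro mult_left_mono sq) auto
      then show "AE x in lborel. norm (indicator {0<..<\<beta>} x *\<^sub>R (q x * (f x)\<^sup>2))
          \<le> norm ((indicator {0<..<\<beta>} x *\<^sub>R q x) * (4 * \<epsilon>\<^sup>2))"
        by (intro AE_I2) (auto simp: indicator_def abs_mult)
    qed measurable
    then have "(LINT x:{0<..<\<beta>}|lborel. q x * (f x)\<^sup>2) \<le> (LINT x:{\<alpha><..<\<beta>}|lborel. max (q x) 0 * (4 * \<epsilon>\<^sup>2))"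
      unfolding set_lebesgue_integral_def by (rule integral_mono[OF _ int le])
    also have "\<dots> = (LINT x:{\<alpha><..<\<beta>}|lborel. max (q x) 0) * (4 * \<epsilon>\<^sup>2)"
      by (rule set_integral_mult_left)
    also have "\<dots> \<le> Q * (4 * \<epsilon>\<^sup>2)" using Q by (intro mult_right_mono) (auto simp: \<beta>_def)
    finally show ?thesis by (simp add: mult_ac)
  qed
  define n2 where "n2 = (L2_norm (cplx f))\<^sup>2"
  have n2_eq: "n2 = (LINT x:{0<..<\<beta>}|lborel. (f x)\<^sup>2)" using el(3) by (simp add: n2_def f_def)
  \<comment> \<open>f \<ge> \<epsilon>/16 on an interval of length \<epsilon>/8.\<close>
  have n2_ge: "\<epsilon> ^ 3 / 2048 \<le> n2"
  proof -
    let ?J = "{\<gamma> - \<epsilon> / 16..\<gamma> + \<epsilon> / 16}"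
    have J: "?J \<subseteq> {0<..<\<beta>}" using \<alpha>\<epsilon> by (auto simp: \<gamma>_def \<beta>_def)
    have "\<epsilon> ^ 3 / 2048 = (LINT x|lborel. indicator ?J x * (\<epsilon> / 16)\<^sup>2)"
      using \<alpha>\<epsilon> by (simp add: power2_eq_square power3_eq_cube)
    also have "\<dots> \<le> (LINT x:{0<..<\<beta>}|lborel. (f x)\<^sup>2)"
      unfolding set_lebesgue_integral_def
    proof (rule integral_mono)
      show "integrable lborel (\<lambda>x. indicator {0<..<\<beta>} x *\<^sub>R (f x)\<^sup>2)"
        using L.set_integrable_bounded[of "\<lambda>x. (f x)\<^sup>2" "{0<..<\<beta>}" "4 * \<epsilon>\<^sup>2" \<beta>] sq(2)
        by (simp add: set_integrable_def)
      show "indicator ?J x * (\<epsilon> / 16)\<^sup>2 \<le> indicator {0<..<\<beta>} x *\<^sub>R (f x)\<^sup>2" for x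
      proof (cases "x \<in> ?J")
        case True
        then have "(\<epsilon> / 16)\<^sup>2 \<le> (f x)\<^sup>2" using f_ge[OF True] \<alpha>\<epsilon> by (intro power_mono) auto
        then show ?thesis using True J by (auto simp: indicator_def)
      qed simp
      show "integrable lborel (\<lambda>x. indicator ?J x * (\<epsilon> / 16)\<^sup>2)"
        using \<alpha>\<epsilon> by (intro integrable_mult_left integrable_real_indicator) auto
    qed
    finally show ?thesis by (simp add: n2_eq)
  qed
  have e3: "\<epsilon> ^ 3 > 0" using \<alpha>\<epsilon> by simp
  show thesis
  proof (rule that[of f h])
    show "(cplx f, cplx h) \<in> H_op \<nu>\<^sub>p \<nu>\<^sub>n q'"
      using el(1) by (simp add: f_def h_def)
    show "f x = 0 \<and> h x = 0" if "x \<notin> {\<alpha><..<\<alpha> + \<epsilon>}" for x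
      using u0[of x] that by (simp add: \<beta>_def)
    have "n2 > 0" using n2_ge e3 by (meson divide_pos_pos less_le_trans zero_less_numeral)
    then have "L2_norm (cplx f) \<noteq> 0" by (auto simp: n2_def)
    then show "L2_norm (cplx f) > 0"
      using L2_norm_nonneg[of "\<lambda>x. complex_of_real (f x)"] by linarith
    define K where "K = 4 * \<epsilon> + 1 + 4 * \<epsilon>\<^sup>2 * Q"
    have "0 \<le> (LINT t:{\<alpha><..<\<alpha> + \<epsilon>}|lborel. max (q t) 0)"
      unfolding set_lebesgue_integral_def by (intro integral_nonneg_AE AE_I2) simp
    then have "K \<ge> 0" unfolding K_def using \<alpha>\<epsilon> Q by simp
    have "Re (L2_inner (cplx h) (cplx f)) \<le> K"
      using el(2) T1 T2 T3 T4 by (simp add: f_def h_def K_def)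
    also have "K = 2048 * K / \<epsilon> ^ 3 * (\<epsilon> ^ 3 / 2048)" using e3 by simp
    also have "\<dots> \<le> 2048 * K / \<epsilon> ^ 3 * n2"
      using n2_ge \<open>K \<ge> 0\<close> e3 by (intro mult_left_mono) auto
    finally show "Re (L2_inner (cplx h) (cplx f))
      \<le> 2048 * (4 * \<epsilon> + 1 + 4 * \<epsilon>\<^sup>2 * Q) / \<epsilon> ^ 3 * (L2_norm (cplx f))\<^sup>2"
      by (simp only: K_def n2_def)
  qed
qed

end


section \<open>Failure of Molchanov's condition\<close>

lemma neg_part_nonneg: "0 \<le> neg_part q x"
  by (simp add: neg_part_def)

lemma set_integrable_neg_part:
  assumes "set_integrable M A q"
  shows "set_integrable M A (neg_part q)"
proof -
  have "set_integrable M A (\<lambda>t. (1/2) * (\<bar>q t\<bar> - q t))"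
    using assms by (intro set_integrable_mult_right set_integral_diff set_integrable_abs)
  then show ?thesis by (simp add: neg_part_def[abs_def])
qed

text \<open>The truncations to (0, n + 1) are measurable by integrability and are eventually
  constant in n at each point.\<close>

lemma borel_measurable_half_line_locally_integrable:
  fixes q :: "real \<Rightarrow> real"
  assumes q: "\<And>c. c > 0 \<Longrightarrow> set_integrable lebesgue {0<..<c} q"
  shows "(\<lambda>t. indicator {0<..} t * q t) \<in> borel_measurable lebesgue"
proof (rule borel_measurable_LIMSEQ_real)
  show "(\<lambda>t. indicator {0<..<real n + 1} t *\<^sub>R q t) \<in> borel_measurable lebesgue" for n
    using q[of "real n + 1"] by (auto simp: set_integrable_def)
  fix t :: real
  obtain n0 :: nat where "t < real n0" using reals_Archimedean2 by blast
  then have "\<forall>\<^sub>F n in sequentially. indicator {0<..<real n + 1} t *\<^sub>R q t = indicator {0<..} t * q t"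
    unfolding eventually_sequentially by (intro exI[of _ n0]) (auto simp: indicator_def)
  then show "(\<lambda>n. indicator {0<..<real n + 1} t *\<^sub>R q t) \<longlonglongrightarrow> indicator {0<..} t * q t"
    by (rule tendsto_eventually)
qed

text \<open>A component that meets [x, x + \<epsilon>] has length at most D, so all of them lie in
  [x - D, x + \<epsilon> + D]. On each component the integral of the negative part is at most C
  times the length; the lengths of disjoint sets add up, and \<Sigma> itself has measure
  zero.\<close>

lemma set_integral_neg_part_bound:
  fixes q :: "real \<Rightarrow> real" and \<Sigma> :: "real set"
  assumes q: "\<And>c. c > 0 \<Longrightarrow> set_integrable lebesgue {0<..<c} q"
    and \<Sigma>: "\<Sigma> \<subseteq> {0<..}" "\<not> bounded \<Sigma>" "\<Sigma> \<in> null_sets lebesgue" "open ({0<..} - \<Sigma>)"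
    and D: "\<And>\<Delta>. \<Delta> \<in> components ({0<..} - \<Sigma>) \<Longrightarrow> measure lebesgue \<Delta> \<le> D"
    and C: "\<And>\<Delta>. \<Delta> \<in> components ({0<..} - \<Sigma>) \<Longrightarrow>
      1 / measure lebesgue \<Delta> * (LINT x:\<Delta>|lebesgue. neg_part q x) \<le> C"
    and nn: "C \<ge> 0" "D \<ge> 0" and x: "x > 0" "\<epsilon> > 0"
  shows "(LINT t:{x..x + \<epsilon>}|lebesgue. neg_part q t) \<le> C * (\<epsilon> + 2 * D)"
proof -
  define G where "G = {0<..} - \<Sigma>"
  define I where "I = {x..x + \<epsilon>}"
  define \<D> where "\<D> = {\<Delta> \<in> components G. \<Delta> \<inter> I \<noteq> {}}"
  have np_int: "set_integrable lebesgue {0<..<c} (neg_part q)" if "c > 0" for c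
    by (rule set_integrable_neg_part[OF q[OF that]])
  have comp: "open \<Delta>" "connected \<Delta>" "\<Delta> \<noteq> {}" "\<Delta> \<subseteq> G" if "\<Delta> \<in> components G" for \<Delta>
    using that open_components[of G] in_components_connected[OF that] in_components_nonempty[OF that]
      in_components_subset[OF that] \<Sigma>(4) by (auto simp: G_def)
  \<comment> \<open>\<Sigma> is unbounded, so beyond any point of a component there is a point of
    \<Sigma>, which a connected set avoiding \<Sigma> cannot cross.\<close>
  have bdd: "\<exists>s>0. \<Delta> \<subseteq> {0<..<s}" if \<Delta>: "\<Delta> \<in> components G" for \<Delta>
  proof -
    obtain y where y: "y \<in> \<Delta>" using comp(3)[OF \<Delta>] by blast
    have "\<exists>s\<in>\<Sigma>. y < s"
    proof (rule ccontr)
      assume "\<not> ?thesis"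
      then have "\<Sigma> \<subseteq> {0..y}" using \<Sigma>(1) by force
      then show False using \<Sigma>(2) bounded_subset bounded_closed_interval by blast
    qed
    then obtain s where s: "s \<in> \<Sigma>" "y < s" by blast
    have "z < s" if z: "z \<in> \<Delta>" for z
    proof (rule ccontr)
      assume "\<not> z < s"
      then have "s \<in> \<Delta>" using connected_contains_Icc[OF comp(2)[OF \<Delta>] y z] s(2) by auto
      then show False using comp(4)[OF \<Delta>] s(1) by (auto simp: G_def)
    qed
    then show ?thesis using comp(4)[OF \<Delta>] s(1) \<Sigma>(1) by (intro exI[of _ s]) (auto simp: G_def)
  qed
  have lm: "\<Delta> \<in> lmeasurable" if "\<Delta> \<in> components G" for \<Delta>
  proof -
    have "bounded \<Delta>" using bdd[OF that] bounded_subset[of "{0<..<_}" \<Delta>] by auto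
    then show ?thesis using comp(1)[OF that] by (rule lmeasurable_open)
  qed
  have diam: "z - y \<le> D" if \<Delta>: "\<Delta> \<in> components G" "y \<in> \<Delta>" "z \<in> \<Delta>" "y \<le> z" for \<Delta> y z
  proof -
    have "measure lebesgue {y..z} \<le> measure lebesgue \<Delta>"
      using connected_contains_Icc[OF comp(2)[OF \<Delta>(1)] \<Delta>(2,3)] lm[OF \<Delta>(1)]
      by (intro measure_mono_fmeasurable) auto
    then show ?thesis using D[of \<Delta>] \<Delta> by (simp add: G_def)
  qed
  have U_sub: "\<Union>\<D> \<subseteq> {x - D..x + \<epsilon> + D}"
  proof
    fix z assume "z \<in> \<Union>\<D>"
    then obtain \<Delta> y where \<Delta>: "\<Delta> \<in> components G" "z \<in> \<Delta>" "y \<in> \<Delta>" "y \<in> I" by (auto simp: \<D>_def)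
    show "z \<in> {x - D..x + \<epsilon> + D}"
      using diam[OF \<Delta>(1,2,3)] diam[OF \<Delta>(1,3,2)] \<Delta>(4) nn(2) by (cases "z \<le> y") (auto simp: I_def)
  qed
  have cD: "countable \<D>"
  proof (rule countable_disjoint_open_subsets)
    show "pairwise disjnt \<D>"
      using pairwise_disjoint_components[of G] by (auto simp: \<D>_def pairwise_def disjnt_def)
  qed (use comp in \<open>auto simp: \<D>_def\<close>)
  have disj: "disjoint_family_on (\<lambda>\<Delta>. \<Delta>) \<D>"
    using pairwise_disjoint_components[of G]
    by (auto simp: \<D>_def disjoint_family_on_def pairwise_def disjnt_def)
  \<comment> \<open>Taking the negative part as a density turns the sum over possibly infinitely
    many components into countable additivity of a measure. The cut to the half-line is needed
    because nothing is known about q elsewhere.\<close>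
  define w where "w = (\<lambda>t. ennreal (indicator {0<..} t * neg_part q t))"
  have "w \<in> borel_measurable lebesgue"
    unfolding w_def using borel_measurable_half_line_locally_integrable[OF np_int] by measurable
  note [measurable] = this
  define M where "M = density lebesgue w"
  have M_eq: "emeasure M A = ennreal (LINT t:A|lebesgue. neg_part q t)"
    if A: "A \<in> sets lebesgue" "A \<subseteq> {0<..<c}" "c > 0" for A c
  proof -
    have "set_integrable lebesgue A (neg_part q)" by (rule set_integrable_subset[OF np_int[OF A(3)] A(1,2)])
    then have int: "integrable lebesgue (\<lambda>t. indicator A t *\<^sub>R neg_part q t)" by (simp add: set_integrable_def)
    have "emeasure M A = (\<integral>\<^sup>+t. w t * indicator A t \<partial>lebesgue)"
      unfolding M_def by (rule emeasure_density) (use A in auto)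
    also have "\<dots> = (\<integral>\<^sup>+t. ennreal (indicator A t *\<^sub>R neg_part q t) \<partial>lebesgue)"
      using A(2) by (intro nn_integral_cong) (auto simp: w_def indicator_def)
    also have "\<dots> = ennreal (LINT t:A|lebesgue. neg_part q t)"
      unfolding set_lebesgue_integral_def
      by (rule nn_integral_eq_integral[OF int]) (auto simp: neg_part_nonneg)
    finally show ?thesis .
  qed
  have M_comp: "emeasure M \<Delta> \<le> ennreal C * emeasure lebesgue \<Delta>" if \<Delta>: "\<Delta> \<in> components G" for \<Delta>
  proof -
    obtain s where s: "s > 0" "\<Delta> \<subseteq> {0<..<s}" using bdd[OF \<Delta>] by blast
    \<comment> \<open>A nonempty open set has positive measure, so the average may be multiplied
      out.\<close>
    have pos: "measure lebesgue \<Delta> > 0"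
    proof -
      have "\<Delta> \<notin> null_sets lebesgue" using comp(1,3)[OF \<Delta>] open_not_negligible negligible_iff_null_sets by blast
      then have "measure lebesgue \<Delta> \<noteq> 0" using lm[OF \<Delta>] measure_eq_0_null_sets
        by (metis emeasure_eq_measure2 ennreal_0 fmeasurableD null_setsI)
      then show ?thesis using measure_nonneg[of lebesgue \<Delta>] by linarith
    qed
    have "(LINT t:\<Delta>|lebesgue. neg_part q t) \<le> C * measure lebesgue \<Delta>"
      using C[of \<Delta>] \<Delta> pos by (simp add: G_def field_simps)
    then have "emeasure M \<Delta> \<le> ennreal (C * measure lebesgue \<Delta>)"
      using M_eq[OF _ s(2,1)] lm[OF \<Delta>] by (simp add: ennreal_leI fmeasurableD)
    also have "\<dots> = ennreal C * emeasure lebesgue \<Delta>"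
      using nn(1) lm[OF \<Delta>] by (simp add: ennreal_mult emeasure_eq_measure2)
    finally show ?thesis .
  qed
  have Dsets: "\<Delta> \<in> sets lebesgue" "\<Delta> \<in> sets M" if "\<Delta> \<in> \<D>" for \<Delta>
    using that lm by (auto simp: \<D>_def M_def)
  have "emeasure M (\<Union>\<Delta>\<in>\<D>. \<Delta>) = (\<integral>\<^sup>+\<Delta>. emeasure M \<Delta> \<partial>count_space \<D>)"
    by (rule emeasure_UN_countable[OF Dsets(2) cD disj])
  also have "\<dots> \<le> (\<integral>\<^sup>+\<Delta>. ennreal C * emeasure lebesgue \<Delta> \<partial>count_space \<D>)"
    by (intro nn_integral_mono M_comp) (auto simp: \<D>_def)
  also have "\<dots> = ennreal C * (\<integral>\<^sup>+\<Delta>. emeasure lebesgue \<Delta> \<partial>count_space \<D>)"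
    by (rule nn_integral_cmult) simp
  also have "(\<integral>\<^sup>+\<Delta>. emeasure lebesgue \<Delta> \<partial>count_space \<D>) = emeasure lebesgue (\<Union>\<Delta>\<in>\<D>. \<Delta>)"
    by (rule emeasure_UN_countable[OF Dsets(1) cD disj, symmetric])
  also have "\<dots> \<le> emeasure lebesgue {x - D..x + \<epsilon> + D}"
    using U_sub by (intro emeasure_mono) auto
  also have "\<dots> = ennreal (\<epsilon> + 2 * D)" using x nn by simp
  also have "ennreal C * ennreal (\<epsilon> + 2 * D) = ennreal (C * (\<epsilon> + 2 * D))"
    using nn x by (simp add: ennreal_mult)
  finally have MU: "emeasure M (\<Union>\<Delta>\<in>\<D>. \<Delta>) \<le> ennreal (C * (\<epsilon> + 2 * D))"
    by (simp add: mult_left_mono)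
  have U_sets: "(\<Union>\<Delta>\<in>\<D>. \<Delta>) \<in> sets lebesgue" using Dsets(1) cD by (intro sets.countable_UN') auto
  have \<Sigma>_sets: "\<Sigma> \<in> sets lebesgue" using \<Sigma>(3) by auto
  have "emeasure M \<Sigma> = (\<integral>\<^sup>+t. w t * indicator \<Sigma> t \<partial>lebesgue)"
    unfolding M_def by (rule emeasure_density) (use \<Sigma>_sets in auto)
  also have "\<dots> = 0" by (rule nn_integral_null_set[OF \<Sigma>(3)])
  finally have M\<Sigma>: "emeasure M \<Sigma> = 0" .
  have "I \<subseteq> (\<Union>\<Delta>\<in>\<D>. \<Delta>) \<union> \<Sigma>"
  proof
    fix y assume y: "y \<in> I"
    show "y \<in> (\<Union>\<Delta>\<in>\<D>. \<Delta>) \<union> \<Sigma>"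
    proof (cases "y \<in> \<Sigma>")
      case False
      then have "y \<in> G" using y x(1) by (auto simp: G_def I_def)
      then obtain \<Delta> where "\<Delta> \<in> components G" "y \<in> \<Delta>" using Union_components[of G] by blast
      then show ?thesis using y unfolding \<D>_def by blast
    qed simp
  qed
  then have "emeasure M I \<le> emeasure M ((\<Union>\<Delta>\<in>\<D>. \<Delta>) \<union> \<Sigma>)"
    using U_sets \<Sigma>_sets by (intro emeasure_mono) (auto simp: M_def)
  also have "\<dots> \<le> emeasure M (\<Union>\<Delta>\<in>\<D>. \<Delta>) + emeasure M \<Sigma>"
    using U_sets \<Sigma>_sets by (intro emeasure_subadditive) (auto simp: M_def)
  also have "\<dots> \<le> ennreal (C * (\<epsilon> + 2 * D))" using MU M\<Sigma> by simp
  also have "emeasure M I = ennreal (LINT t:I|lebesgue. neg_part q t)"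
    by (rule M_eq[of I "x + \<epsilon> + 1"]) (use x in \<open>auto simp: I_def\<close>)
  finally show ?thesis
    using nn x by (simp add: I_def ennreal_le_iff)
qed

lemma ex_borel_potential:
  fixes q :: "real \<Rightarrow> real"
  assumes q: "\<And>c. c > 0 \<Longrightarrow> set_integrable lebesgue {0<..<c} q"
  obtains q0 :: "real \<Rightarrow> real" where "q0 \<in> borel_measurable borel"
    "\<And>c. set_integrable lborel {0<..<c} q0" "AE x in lebesgue. x > 0 \<longrightarrow> q x = q0 x"
proof -
  obtain q0 where q0: "q0 \<in> borel_measurable lborel" "AE x in lborel. indicator {0<..} x * q x = q0 x"
    using completion_ex_borel_measurable_real[OF borel_measurable_half_line_locally_integrable[OF q]] by blast
  have m [measurable]: "q0 \<in> borel_measurable borel" using q0(1) by simp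
  have ae: "AE x in lebesgue. indicator {0<..} x * q x = q0 x" using q0(2) by (rule AE_completion)
  have int: "set_integrable lborel {0<..<c} q0" for c
  proof (cases "c > 0")
    case True
    have "integrable lebesgue (\<lambda>x. indicator {0<..<c} x *\<^sub>R q0 x)"
    proof (rule integrable_cong_AE_imp)
      show "integrable lebesgue (\<lambda>x. indicator {0<..<c} x *\<^sub>R q x)"
        using q[OF True] by (simp add: set_integrable_def)
      show "(\<lambda>x. indicator {0<..<c} x *\<^sub>R q0 x) \<in> borel_measurable lebesgue"
        by (intro measurable_completion) simp
      show "AE x in lebesgue. indicator {0<..<c} x *\<^sub>R q x = indicator {0<..<c} x *\<^sub>R q0 x"
        using ae by eventually_elim (auto simp: indicator_def split: if_splits)
    qed
    then show ?thesis unfolding set_integrable_def by (subst (asm) integrable_completion) auto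
  qed (simp add: set_integrable_def)
  have "AE x in lebesgue. x > 0 \<longrightarrow> q x = q0 x"
    using ae by eventually_elim (auto simp: indicator_def)
  then show thesis using that m int by blast
qed

theorem proposition8p10:
  fixes \<nu>\<^sub>p \<nu>\<^sub>n :: "real measure" and q :: "real \<Rightarrow> real" and \<Sigma> :: "real set"
  assumes "signed_radon_measure \<nu>\<^sub>p \<nu>\<^sub>n"
    and "singular_wrt_lebesgue \<nu>\<^sub>p \<nu>\<^sub>n"
    and "\<And>c. c > 0 \<Longrightarrow> set_integrable lebesgue {0<..<c} q"
    and "\<Sigma> = topological_support \<nu>\<^sub>p \<nu>\<^sub>n"
    and "\<not> bounded \<Sigma>"
    and "\<Sigma> \<in> null_sets lebesgue"
    and "bdd_above ((\<lambda>\<Delta>. measure lebesgue \<Delta>) ` components ({0<..} - \<Sigma>))"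
    and "bdd_above ((\<lambda>\<Delta>. 1 / measure lebesgue \<Delta> * (LINT x:\<Delta>|lebesgue. neg_part q x))
           ` components ({0<..} - \<Sigma>))"
    and "self_adjoint (H_op \<nu>\<^sub>p \<nu>\<^sub>n q)"
    and "lower_semibounded (H_op \<nu>\<^sub>p \<nu>\<^sub>n q)"
    and "\<not> molchanov q"
  shows "\<not> discrete_spectrum (H_op \<nu>\<^sub>p \<nu>\<^sub>n q)"
proof
  assume disc: "discrete_spectrum (H_op \<nu>\<^sub>p \<nu>\<^sub>n q)"
  obtain q0 where q0: "q0 \<in> borel_measurable borel" "\<And>c. set_integrable lborel {0<..<c} q0"
    "AE x in lebesgue. x > 0 \<longrightarrow> q x = q0 x"
    using ex_borel_potential[OF assms(3)] by blast
  interpret half_line_potential \<nu>\<^sub>p \<nu>\<^sub>n q0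
    by unfold_locales (fact assms(1) q0)+
  have \<Sigma>: "\<Sigma> = supp" by (fact assms(4))
  have \<Sigma>pos: "\<Sigma> \<subseteq> {0<..}" by (auto simp: \<Sigma> topological_support_def)
  have G: "open ({0<..} - \<Sigma>)" unfolding \<Sigma> by (rule open_supp_complement)
  obtain D0 where "\<And>\<Delta>. \<Delta> \<in> components ({0<..} - \<Sigma>) \<Longrightarrow> measure lebesgue \<Delta> \<le> D0"
    using assms(7) unfolding bdd_above_def by blast
  then have D: "measure lebesgue \<Delta> \<le> max D0 0" if "\<Delta> \<in> components ({0<..} - \<Sigma>)" for \<Delta>
    using that by (simp add: max.coboundedI1)
  obtain C0 where "\<And>\<Delta>. \<Delta> \<in> components ({0<..} - \<Sigma>) \<Longrightarrow>
      1 / measure lebesgue \<Delta> * (LINT x:\<Delta>|lebesgue. neg_part q x) \<le> C0"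
    using assms(8) unfolding bdd_above_def by blast
  then have C: "1 / measure lebesgue \<Delta> * (LINT x:\<Delta>|lebesgue. neg_part q x) \<le> max C0 0"
    if "\<Delta> \<in> components ({0<..} - \<Sigma>)" for \<Delta>
    using that by (metis max.coboundedI1)
  obtain \<epsilon> where \<epsilon>: "\<epsilon> > 0" "\<not> filterlim (\<lambda>x. LINT t:{x..x + \<epsilon>}|lebesgue. q t) at_top at_top"
    using assms(11) unfolding molchanov_def by blast
  \<comment> \<open>For this \<epsilon> the integrals over [x, x + \<epsilon>] stay below a fixed Z
    for arbitrarily large x.\<close>
  then obtain Z where Z: "\<not> (\<forall>\<^sub>F x in at_top. Z \<le> (LINT t:{x..x + \<epsilon>}|lebesgue. q t))"
    unfolding filterlim_at_top by blast
  have "\<exists>x\<ge>N. (LINT t:{x..x + \<epsilon>}|lebesgue. q t) < Z" for N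
    using Z unfolding eventually_at_top_linorder by (auto simp: not_le)
  then obtain pick where pick: "\<And>N. pick N \<ge> N" "\<And>N. (LINT t:{pick N..pick N + \<epsilon>}|lebesgue. q t) < Z"
    by metis
  \<comment> \<open>Each interval is chosen beyond the end of the previous one; starting from
    \<open>pick 1\<close> keeps all of them inside (0,\<infinity>).\<close>
  define \<alpha> where "\<alpha> = rec_nat (pick 1) (\<lambda>_ a. pick (a + \<epsilon>))"
  have \<alpha>0: "\<alpha> 0 = pick 1" and \<alpha>S: "\<alpha> (Suc n) = pick (\<alpha> n + \<epsilon>)" for n by (simp_all add: \<alpha>_def)
  have \<alpha>Z: "(LINT t:{\<alpha> n..\<alpha> n + \<epsilon>}|lebesgue. q t) < Z" for n
    by (cases n) (simp_all add: \<alpha>0 \<alpha>S pick)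
  have step: "\<alpha> n + \<epsilon> \<le> \<alpha> (Suc n)" for n by (simp add: \<alpha>S pick)
  have gap: "\<alpha> n + \<epsilon> \<le> \<alpha> m" if "n < m" for n m
    using that
  proof (induction m)
    case (Suc m)
    then show ?case using step[of m] step[of n] \<epsilon>(1) by (cases "n = m") auto
  qed simp
  have \<alpha>pos: "\<alpha> n > 0" for n
  proof -
    have "\<alpha> 0 \<ge> 1" unfolding \<alpha>0 by (rule pick)
    then show ?thesis using gap[of 0 n] \<epsilon>(1) by (cases n) auto
  qed
  \<comment> \<open>The positive part of q is q plus its negative part, whose integral over any such
    interval has the uniform bound given by the second summand.\<close>
  define Q where "Q = Z + max C0 0 * (\<epsilon> + 2 * max D0 0)"
  have Qb: "(LINT t:{\<alpha> n<..<\<alpha> n + \<epsilon>}|lborel. max (q0 t) 0) \<le> Q" for n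
  proof -
    let ?I = "{\<alpha> n..\<alpha> n + \<epsilon>}"
    have sub: "?I \<subseteq> {0<..<\<alpha> n + \<epsilon> + 1}" using \<alpha>pos[of n] by auto
    have pos: "\<alpha> n + \<epsilon> + 1 > 0" using \<alpha>pos[of n] \<epsilon>(1) by linarith
    have qi: "set_integrable lebesgue ?I q"
      by (rule set_integrable_subset[OF assms(3)[OF pos] _ sub]) simp
    have ni: "set_integrable lebesgue ?I (neg_part q)" by (rule set_integrable_neg_part[OF qi])
    have "(LINT t:{\<alpha> n<..<\<alpha> n + \<epsilon>}|lborel. max (q0 t) 0) = (LINT t:?I|lborel. max (q0 t) 0)"
      unfolding set_lebesgue_integral_def
      using AE_lborel_singleton[of "\<alpha> n"] AE_lborel_singleton[of "\<alpha> n + \<epsilon>"]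
      by (intro integral_cong_AE) (auto simp: indicator_def elim!: eventually_elim2)
    also have "\<dots> = (LINT t:?I|lebesgue. max (q0 t) 0)"
      unfolding set_lebesgue_integral_def by (rule integral_completion[symmetric]) simp
    also have "\<dots> = (LINT t:?I|lebesgue. q t + neg_part q t)"
      unfolding set_lebesgue_integral_def
    proof (rule integral_cong_AE)
      show "(\<lambda>t. indicator ?I t *\<^sub>R max (q0 t) 0) \<in> borel_measurable lebesgue"
        by (intro measurable_completion) simp
      show "(\<lambda>t. indicator ?I t *\<^sub>R (q t + neg_part q t)) \<in> borel_measurable lebesgue"
        using set_integral_add(1)[OF qi ni] by (auto simp: set_integrable_def)
      show "AE t in lebesgue. indicator ?I t *\<^sub>R max (q0 t) 0 = indicator ?I t *\<^sub>R (q t + neg_part q t)"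
        using q0(3)
      proof eventually_elim
        fix t assume t: "t > 0 \<longrightarrow> q t = q0 t"
        show "indicator ?I t *\<^sub>R max (q0 t) 0 = indicator ?I t *\<^sub>R (q t + neg_part q t)"
        proof (cases "t \<in> ?I")
          case True
          then have "q t = q0 t" using t sub by auto
          then show ?thesis using True by (simp add: neg_part_def max_def)
        qed simp
      qed
    qed
    also have "\<dots> = (LINT t:?I|lebesgue. q t) + (LINT t:?I|lebesgue. neg_part q t)"
      by (rule set_integral_add(2)[OF qi ni])
    also have "\<dots> \<le> Q"
      unfolding Q_def
      using \<alpha>Z[of n] set_integral_neg_part_bound[OF assms(3) \<Sigma>pos assms(5,6) G D C _ _ \<alpha>pos[of n] \<epsilon>(1)]
      by (intro add_mono) auto
    finally show ?thesis .
  qed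
  have q'ae: "AE x in half_line. q x = q0 x"
    using q0(3) by (subst AE_restrict_space_iff) auto
  define K where "K = 2048 * (4 * \<epsilon> + 1 + 4 * \<epsilon>\<^sup>2 * Q) / \<epsilon> ^ 3"
  have "\<exists>f h :: real \<Rightarrow> real.
      (cplx f, cplx h) \<in> H_op \<nu>\<^sub>p \<nu>\<^sub>n q \<and>
      (\<forall>x. x \<notin> {\<alpha> n<..<\<alpha> n + \<epsilon>} \<longrightarrow> f x = 0 \<and> h x = 0) \<and>
      L2_norm (cplx f) > 0 \<and>
      Re (L2_inner (cplx h) (cplx f))
        \<le> K * (L2_norm (cplx f))\<^sup>2" for n
    by (rule local_domain_element[OF \<alpha>pos \<epsilon>(1) assms(6)[unfolded \<Sigma>] Qb[of n] q'ae])
       (unfold K_def, blast)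
  then obtain f h :: "nat \<Rightarrow> real \<Rightarrow> real" where fh:
    "\<And>n. (cplx (f n), cplx (h n)) \<in> H_op \<nu>\<^sub>p \<nu>\<^sub>n q"
    "\<And>n x. x \<notin> {\<alpha> n<..<\<alpha> n + \<epsilon>} \<Longrightarrow> f n x = 0 \<and> h n x = 0"
    "\<And>n. L2_norm (cplx (f n)) > 0"
    "\<And>n. Re (L2_inner (cplx (h n)) (cplx (f n)))
        \<le> K * (L2_norm (cplx (f n)))\<^sup>2"
    by metis
  \<comment> \<open>The supports are disjoint, so the products in both inner products vanish
    pointwise.\<close>
  have disj: "x \<notin> {\<alpha> n<..<\<alpha> n + \<epsilon>} \<or> x \<notin> {\<alpha> m<..<\<alpha> m + \<epsilon>}" if "n \<noteq> m" for n m x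
    using gap[of n m] gap[of m n] that by (cases "n < m") auto
  have zero: "f n x * f m x = 0" "h n x * f m x = 0" if "n \<noteq> m" for n m x
    using disj[OF that, of x] fh(2)[of x n] fh(2)[of x m] by auto
  show False
  proof (rule discrete_spectrum_orthogonal_sequence[OF assms(9,10) disc fh(1,3) _ _ fh(4)])
    fix n m :: nat assume nm: "n \<noteq> m"
    show "L2_inner (cplx (f n)) (cplx (f m)) = 0"
      "L2_inner (cplx (h n)) (cplx (f m)) = 0"
      unfolding L2_inner_def complex_cnj_complex_of_real of_real_mult[symmetric] zero[OF nm] by simp_all
  qed
qed

end
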